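(* Let $(\omega^1,\omega^2,\omega^3)$ be any coframing on a 3-manifold $M$ satisfying the structure equations $$\begin{aligned} d\omega^1&=A_2\,\omega^1\wedge\omega^2+(A_3-C)\,\omega^1\wedge\omega^3+\omega^2\wedge\omega^3,\\ d\omega^2&=-A_1\,\omega^1\wedge\omega^2+\epsilon\,\omega^1\wedge\omega^3+(A_3+C)\,\omega^2\wedge\omega^3,\\ d\omega^3&=\delta\sin(\zeta)\,\omega^1\wedge\omega^3+\cos(\zeta)\,\omega^2\wedge\omega^3,\\ dC&=C_3\,\omega^3,\end{aligned}$$ with $\epsilon,\delta\in\{\pm1\}$, $C_3\neq0$ and $dC\wedge dC_3\neq0$, and let $\zeta_3$ and $\zeta_{33}$ be the derivatives of $\zeta$ and $\zeta_3$, respectively, in the direction dual to $\omega^3$. If $A_1=A_2=0$ identically on an open set $U$ of $M$, then there exist a local invariant coordinate system $(x,y,z)=(\zeta,\zeta_3,\zeta_{33})$, where $\zeta\in(0,\pi/4)$ and $\zeta_3\neq0$, and arbitrary functions $f(x)\in C^3(\mathbb{R})$ and $g(x)\in C^2(\mathbb{R})$ such that the coframing $(\omega^1,\omega^2,\omega^3)$ has the form $$\omega^1=\cos(x)\,\eta^1+\sin(x)\,\eta^2,\qquad \omega^2=-\sin(x)\,\eta^1+\cos(x)\,\eta^2,\qquad \omega^3=\frac1y\,dx,$$ where $\eta^1$ and $\eta^2$ are the 1-forms $$\eta^1=\frac{1}{y^2}\left(N_1\,dx+N_2\,dy-dz\right),\qquad \eta^2=\frac{z}{y^2}\,dx-\frac1y\,dy.$$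 The functions $N_1$ and $N_2$ depend on $\epsilon$: (1) If $\epsilon=1$ then $$N_1=y^2g(x)+2y\left(f(x)-2\cot(2x)\right)\csc(2x)-\left(f(x)^2+f'(x)+1\right)y^2\ln(y)-zf(x),\qquad N_2=\frac{2z-y^2f(x)-2y\csc(2x)}{y},$$ where $f'(x)$ denotes the derivative of $f(x)$. (2) If $\epsilon=-1$ then $$N_1=y^2g(x)-2y\cot(2x)f(x)+2y+4y\csc^2(2x)-\left(f(x)^2+f'(x)+1\right)y^2\ln(y)-zf(x),\qquad N_2=\frac{2z-y^2f(x)+y\cot(2x)}{y}.$$
   Context: The displayed structure equations are those of an adapted coframe of a bi-contact structure $(\omega^1,\omega^2)$, i.e. a pair of contact 1-forms on an orientable 3-manifold with distinct kernels at every point. Here $\omega^1\wedge d\omega^1=-\epsilon\,\omega^2\wedge d\omega^2=\omega^1\wedge\omega^2\wedge\omega^3$, and $C$ is the invariant function given by $\omega^1\wedge d\omega^2+\omega^2\wedge d\omega^1=2C\,\omega^1\wedge\omega^2\wedge\omega^3$. The symbols $A_1,A_2,A_3,\zeta,C,C_3$ denote functions on $M$. If $(e_1,e_2,e_3)$ is the frame dual to the coframing, then $\zeta_3=e_3(\zeta)$ and $\zeta_{33}=e_3(\zeta_3)$.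
   Formalization: For ε=−1, N_2 has 2y cot(2x) in place of y cot(2x); the formulas use (x,y,z)=(δζ,δζ_3,δζ_33), as printed when δ=1; ln|y| replaces ln(y); the claim is made near each point of U where ζ∈(0,π/4), with all data smooth. *)

theory Defs
  imports "HOL-Analysis.Analysis" "HOL-Library.Extended_Nat"
begin

(* Intended for open S only: derivatives are taken in the ambient space. *)
fun Ck_on :: "nat \<Rightarrow> 'a::real_normed_vector set \<Rightarrow> ('a \<Rightarrow> 'b::real_normed_vector) \<Rightarrow> bool" where
  "Ck_on 0 S f \<longleftrightarrow> continuous_on S f"
| "Ck_on (Suc k) S f \<longleftrightarrow>
     (\<forall>x\<in>S. f differentiable (at x)) \<and> (\<forall>v. Ck_on k S (\<lambda>x. frechet_derivative f (at x) v))"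

definition class_on :: "enat \<Rightarrow> 'a::real_normed_vector set \<Rightarrow> ('a \<Rightarrow> 'b::real_normed_vector) \<Rightarrow> bool" where
  "class_on k S f \<longleftrightarrow> (\<forall>n. enat n \<le> k \<longrightarrow> Ck_on n S f)"

type_synonym 'm chart = "'m set \<times> ('m \<Rightarrow> real^3)"

abbreviation chart_dom :: "'m chart \<Rightarrow> 'm set" where "chart_dom c \<equiv> fst c"
abbreviation chart_map :: "'m chart \<Rightarrow> 'm \<Rightarrow> real^3" where "chart_map c \<equiv> snd c"
abbreviation chart_image :: "'m chart \<Rightarrow> (real^3) set" where
  "chart_image c \<equiv> chart_map c ` chart_dom c"

definition chart_inv :: "'m chart \<Rightarrow> real^3 \<Rightarrow> 'm" where
  "chart_inv c = inv_into (chart_dom c) (chart_map c)"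

definition is_chart :: "'m::topological_space chart \<Rightarrow> bool" where
  "is_chart c \<longleftrightarrow> open (chart_dom c) \<and> open (chart_image c) \<and>
     homeomorphism (chart_dom c) (chart_image c) (chart_map c) (chart_inv c)"

definition smooth_transition :: "'m chart \<Rightarrow> 'm chart \<Rightarrow> bool" where
  "smooth_transition c d \<longleftrightarrow>
     class_on \<infinity> (chart_map c ` (chart_dom c \<inter> chart_dom d)) (chart_map d \<circ> chart_inv c)"

definition compatible_chart :: "'m::topological_space chart set \<Rightarrow> 'm chart \<Rightarrow> bool" where
  "compatible_chart A c \<longleftrightarrow>
     is_chart c \<and> (\<forall>d\<in>A. smooth_transition c d \<and> smooth_transition d c)"

(* The 3-manifold is the open subset "manifold_points A" of a Hausdorff, second countable
   space; such a set is itself Hausdorff and second countable, so no generality is lost. *)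
definition smooth_atlas :: "'m::{t2_space, second_countable_topology} chart set \<Rightarrow> bool" where
  "smooth_atlas A \<longleftrightarrow> (\<forall>c\<in>A. compatible_chart A c)"

definition manifold_points :: "'m chart set \<Rightarrow> 'm set" where
  "manifold_points A = (\<Union>c\<in>A. chart_dom c)"

definition partial :: "'m chart \<Rightarrow> ('m \<Rightarrow> real) \<Rightarrow> 'm \<Rightarrow> 3 \<Rightarrow> real" where
  "partial c h p i = frechet_derivative (h \<circ> chart_inv c) (at (chart_map c p)) (axis i 1)"

(* A 1-form (2-form) is represented by its components "\<alpha> c p" at the point p with respect to the
   coordinates of the chart c; the transformation law is part of is_form1. *)
type_synonym 'm form1 = "'m chart \<Rightarrow> 'm \<Rightarrow> real^3"
type_synonym 'm form2 = "'m chart \<Rightarrow> 'm \<Rightarrow> real^3^3"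

definition fun_class :: "'m chart set \<Rightarrow> enat \<Rightarrow> ('m \<Rightarrow> real) \<Rightarrow> bool" where
  "fun_class A k h \<longleftrightarrow> (\<forall>c\<in>A. class_on k (chart_image c) (h \<circ> chart_inv c))"

definition is_form1 :: "'m chart set \<Rightarrow> enat \<Rightarrow> 'm form1 \<Rightarrow> bool" where
  "is_form1 A k \<alpha> \<longleftrightarrow>
     (\<forall>c\<in>A. class_on k (chart_image c) (\<alpha> c \<circ> chart_inv c)) \<and>
     (\<forall>c\<in>A. \<forall>d\<in>A. \<forall>p\<in>chart_dom c \<inter> chart_dom d. \<forall>i.
        \<alpha> c p $ i = (\<Sum>j\<in>UNIV. \<alpha> d p $ j * partial c (\<lambda>q. chart_map d q $ j) p i))"

definition differential :: "('m \<Rightarrow> real) \<Rightarrow> 'm form1" where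
  "differential h c p = (\<chi> i. partial c h p i)"

definition wedge :: "'m form1 \<Rightarrow> 'm form1 \<Rightarrow> 'm form2" where
  "wedge \<alpha> \<beta> c p = (\<chi> i j. \<alpha> c p $ i * \<beta> c p $ j - \<alpha> c p $ j * \<beta> c p $ i)"

definition ext_deriv :: "'m form1 \<Rightarrow> 'm form2" where
  "ext_deriv \<alpha> c p = (\<chi> i j. partial c (\<lambda>q. \<alpha> c q $ j) p i - partial c (\<lambda>q. \<alpha> c q $ i) p j)"

definition is_coframing :: "'m chart set \<Rightarrow> enat \<Rightarrow> 'm form1 \<Rightarrow> 'm form1 \<Rightarrow> 'm form1 \<Rightarrow> bool" where
  "is_coframing A k \<omega>1 \<omega>2 \<omega>3 \<longleftrightarrow>
     is_form1 A k \<omega>1 \<and> is_form1 A k \<omega>2 \<and> is_form1 A k \<omega>3 \<and>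
     (\<forall>c\<in>A. \<forall>p\<in>chart_dom c. det (vector [\<omega>1 c p, \<omega>2 c p, \<omega>3 c p] :: real^3^3) \<noteq> 0)"

definition dual_e3 :: "'m form1 \<Rightarrow> 'm form1 \<Rightarrow> 'm form1 \<Rightarrow> 'm chart \<Rightarrow> 'm \<Rightarrow> real^3" where
  "dual_e3 \<omega>1 \<omega>2 \<omega>3 c p = (THE v. \<omega>1 c p \<bullet> v = 0 \<and> \<omega>2 c p \<bullet> v = 0 \<and> \<omega>3 c p \<bullet> v = 1)"

(* h3 = e3(h), where (e1, e2, e3) is the frame dual to the coframing *)
definition is_e3_deriv ::
  "'m chart set \<Rightarrow> 'm form1 \<Rightarrow> 'm form1 \<Rightarrow> 'm form1 \<Rightarrow> ('m \<Rightarrow> real) \<Rightarrow> ('m \<Rightarrow> real) \<Rightarrow> bool" where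
  "is_e3_deriv A \<omega>1 \<omega>2 \<omega>3 h h3 \<longleftrightarrow>
     (\<forall>c\<in>A. \<forall>p\<in>chart_dom c. h3 p = differential h c p \<bullet> dual_e3 \<omega>1 \<omega>2 \<omega>3 c p)"

definition structure_equations ::
  "'m chart set \<Rightarrow> real \<Rightarrow> real \<Rightarrow> 'm form1 \<Rightarrow> 'm form1 \<Rightarrow> 'm form1 \<Rightarrow>
   ('m \<Rightarrow> real) \<Rightarrow> ('m \<Rightarrow> real) \<Rightarrow> ('m \<Rightarrow> real) \<Rightarrow> ('m \<Rightarrow> real) \<Rightarrow> ('m \<Rightarrow> real) \<Rightarrow> ('m \<Rightarrow> real) \<Rightarrow> bool" where
  "structure_equations A \<epsilon> \<delta> \<omega>1 \<omega>2 \<omega>3 A1 A2 A3 \<zeta> C C3 \<longleftrightarrow>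
     (\<forall>c\<in>A. \<forall>p\<in>chart_dom c.
        ext_deriv \<omega>1 c p = A2 p *\<^sub>R wedge \<omega>1 \<omega>2 c p + (A3 p - C p) *\<^sub>R wedge \<omega>1 \<omega>3 c p
                            + wedge \<omega>2 \<omega>3 c p \<and>
        ext_deriv \<omega>2 c p = - A1 p *\<^sub>R wedge \<omega>1 \<omega>2 c p + \<epsilon> *\<^sub>R wedge \<omega>1 \<omega>3 c p
                            + (A3 p + C p) *\<^sub>R wedge \<omega>2 \<omega>3 c p \<and>
        ext_deriv \<omega>3 c p = (\<delta> * sin (\<zeta> p)) *\<^sub>R wedge \<omega>1 \<omega>3 c p
                            + cos (\<zeta> p) *\<^sub>R wedge \<omega>2 \<omega>3 c p \<and>
        differential C c p = C3 p *\<^sub>R \<omega>3 c p)"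

definition adapted_coframing ::
  "'m::{t2_space, second_countable_topology} chart set \<Rightarrow> enat \<Rightarrow> real \<Rightarrow> real \<Rightarrow>
   'm form1 \<Rightarrow> 'm form1 \<Rightarrow> 'm form1 \<Rightarrow>
   ('m \<Rightarrow> real) \<Rightarrow> ('m \<Rightarrow> real) \<Rightarrow> ('m \<Rightarrow> real) \<Rightarrow> ('m \<Rightarrow> real) \<Rightarrow> ('m \<Rightarrow> real) \<Rightarrow> ('m \<Rightarrow> real) \<Rightarrow> bool" where
  "adapted_coframing A k \<epsilon> \<delta> \<omega>1 \<omega>2 \<omega>3 A1 A2 A3 \<zeta> C C3 \<longleftrightarrow>
     smooth_atlas A \<and> is_coframing A k \<omega>1 \<omega>2 \<omega>3 \<and>
     fun_class A k A1 \<and> fun_class A k A2 \<and> fun_class A k A3 \<and>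
     fun_class A k \<zeta> \<and> fun_class A k C \<and> fun_class A k C3 \<and>
     structure_equations A \<epsilon> \<delta> \<omega>1 \<omega>2 \<omega>3 A1 A2 A3 \<zeta> C C3 \<and>
     (\<forall>p\<in>manifold_points A. C3 p \<noteq> 0) \<and>
     (\<forall>c\<in>A. \<forall>p\<in>chart_dom c. wedge (differential C) (differential C3) c p \<noteq> 0)"

definition csc :: "real \<Rightarrow> real" where
  "csc x = 1 / sin x"

definition N1 :: "real \<Rightarrow> (real \<Rightarrow> real) \<Rightarrow> (real \<Rightarrow> real) \<Rightarrow> real \<Rightarrow> real \<Rightarrow> real \<Rightarrow> real" where
  "N1 \<epsilon> f g x y z =
     (if \<epsilon> = 1
      then y^2 * g x + 2 * y * (f x - 2 * cot (2 * x)) * csc (2 * x)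
           - ((f x)^2 + deriv f x + 1) * y^2 * ln \<bar>y\<bar> - z * f x
      else y^2 * g x - 2 * y * cot (2 * x) * f x + 2 * y + 4 * y * (csc (2 * x))^2
           - ((f x)^2 + deriv f x + 1) * y^2 * ln \<bar>y\<bar> - z * f x)"

(* For \<epsilon> = -1 the coefficient of y cot(2x) has to be 2. The equation for d\<omega>2 and dd = 0 give
   A3 = y f(x) - cot(2x) and N2 = 2z/y - (A3 + C cos(2x)) with C = -csc(2x) (for \<delta> = 1);
   with coefficient 1 the structure equations fail. *)
definition N2 :: "real \<Rightarrow> (real \<Rightarrow> real) \<Rightarrow> real \<Rightarrow> real \<Rightarrow> real \<Rightarrow> real" where
  "N2 \<epsilon> f x y z =
     (if \<epsilon> = 1
      then (2 * z - y^2 * f x - 2 * y * csc (2 * x)) / y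
      else (2 * z - y^2 * f x + 2 * y * cot (2 * x)) / y)"

definition eta1 :: "real \<Rightarrow> (real \<Rightarrow> real) \<Rightarrow> (real \<Rightarrow> real) \<Rightarrow>
    ('m \<Rightarrow> real) \<Rightarrow> ('m \<Rightarrow> real) \<Rightarrow> ('m \<Rightarrow> real) \<Rightarrow> 'm form1" where
  "eta1 \<epsilon> f g x y z c p =
     (1 / (y p)^2) *\<^sub>R (N1 \<epsilon> f g (x p) (y p) (z p) *\<^sub>R differential x c p
                       + N2 \<epsilon> f (x p) (y p) (z p) *\<^sub>R differential y c p
                       - differential z c p)"

definition eta2 :: "('m \<Rightarrow> real) \<Rightarrow> ('m \<Rightarrow> real) \<Rightarrow> ('m \<Rightarrow> real) \<Rightarrow> 'm form1" where
  "eta2 x y z c p =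
     (z p / (y p)^2) *\<^sub>R differential x c p - (1 / y p) *\<^sub>R differential y c p"

(* These forms satisfy d\<omega>3 = sin x \<omega>1 \<and> \<omega>3 + cos x \<omega>2 \<and> \<omega>3. The structure equations involve
   (\<delta>, \<zeta>) only through \<delta> sin \<zeta> = sin (\<delta> \<zeta>) and cos \<zeta> = cos (\<delta> \<zeta>), so the normal form is to be taken
   at x = \<delta> \<zeta>, y = \<delta> \<zeta>3, z = \<delta> \<zeta>33. *)
definition has_normal_form_on ::
  "'m chart set \<Rightarrow> 'm set \<Rightarrow> real \<Rightarrow> (real \<Rightarrow> real) \<Rightarrow> (real \<Rightarrow> real) \<Rightarrow>
   ('m \<Rightarrow> real) \<Rightarrow> ('m \<Rightarrow> real) \<Rightarrow> ('m \<Rightarrow> real) \<Rightarrow> 'm form1 \<Rightarrow> 'm form1 \<Rightarrow> 'm form1 \<Rightarrow> bool" where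
  "has_normal_form_on A V \<epsilon> f g x y z \<omega>1 \<omega>2 \<omega>3 \<longleftrightarrow>
     (\<forall>c\<in>A. \<forall>p\<in>V \<inter> chart_dom c.
        \<omega>1 c p = cos (x p) *\<^sub>R eta1 \<epsilon> f g x y z c p + sin (x p) *\<^sub>R eta2 x y z c p \<and>
        \<omega>2 c p = - sin (x p) *\<^sub>R eta1 \<epsilon> f g x y z c p + cos (x p) *\<^sub>R eta2 x y z c p \<and>
        \<omega>3 c p = (1 / y p) *\<^sub>R differential x c p)"

(* The coordinate domain of the normal form, as a manifold with one global chart *)
definition model_dom :: "(real^3) set" where
  "model_dom = {v. 0 < v $ 1 \<and> v $ 1 < pi / 4 \<and> v $ 2 \<noteq> 0}"

definition model_atlas :: "(real^3) chart set" where
  "model_atlas = {(model_dom, \<lambda>v. v)}"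

end

theory Submission
  imports Defs
begin

text \<open>
  In a chart, 1-forms are vector fields on an open subset of 3-space, the wedge product is the cross
  product and the exterior derivative is the curl. Put \<open>x = \<delta>\<zeta>\<close>, \<open>y = \<delta>\<zeta>\<^sub>3\<close>, \<open>z = \<delta>\<zeta>\<^sub>3\<^sub>3\<close>, and rotate the
  coframing back by \<open>\<eta>\<^sup>1 = cos x \<omega>\<^sup>1 - sin x \<omega>\<^sup>2\<close>, \<open>\<eta>\<^sup>2 = sin x \<omega>\<^sup>1 + cos x \<omega>\<^sup>2\<close>, so that
  \<open>d\<omega>\<^sup>3 = \<eta>\<^sup>2 \<and> \<omega>\<^sup>3\<close>. From \<open>d\<^sup>2 = 0\<close> for the \<open>\<omega>\<^sup>i\<close> one gets \<open>dx = a \<eta>\<^sup>1 + y \<omega>\<^sup>3\<close> and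
  \<open>dA\<^sub>3\<close> modulo \<open>\<omega>\<^sup>3\<close>; then \<open>d\<^sup>2A\<^sub>3 = 0\<close> and \<open>d\<^sup>2x = 0\<close> force \<open>a = 0\<close> and make \<open>C\<close> an explicit function
  of \<open>x\<close>. Hence \<open>dx = y \<omega>\<^sup>3\<close>, where \<open>y \<noteq> 0\<close> because \<open>C\<^sub>3 \<noteq> 0\<close>. Next \<open>d\<^sup>2x = 0\<close> gives \<open>dy = - y \<eta>\<^sup>2 + z \<omega>\<^sup>3\<close>,
  and \<open>d\<^sup>2y = 0\<close> gives \<open>dz\<close> up to a multiple of \<open>\<omega>\<^sup>3\<close>. So \<open>(x, y, z)\<close> are coordinates in which the
  \<open>\<eta>\<^sup>i\<close> are determined by \<open>A\<^sub>3\<close> and one more function \<open>N\<^sub>1\<close>. The remaining relations, \<open>dA\<^sub>3\<close> modulo \<open>\<omega>\<^sup>3\<close> and the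
  equation for \<open>d\<eta>\<^sup>1\<close>, are linear equations in \<open>y\<close> and \<open>z\<close>, whose constants of integration are \<open>f(x)\<close> and \<open>g(x)\<close>.
\<close>

section \<open>Calculus of functions of class \<open>C\<^sup>k\<close>\<close>

unbundle cross3_syntax

text \<open>The relation dh \<and> dx = 0 makes h a function of x only where the fibres of x are
  connected. The coordinate domain is therefore cut down to preimages of balls, whose slices x =
  const are convex, once for \<open>f\<close> and again for \<open>g\<close>. Each resulting
  function lives on an interval only and has to be extended to the real line; this is done in a
  prescribed finite class. That f and g are arbitrary is a separate claim: every pair of class C^3
  and C^2 has to occur. For it the forms are written down on \<open>model_dom\<close> and the
  structure equations are checked by direct differentiation; since \<open>N1\<close> contains
  \<open>deriv f\<close>, these forms are of class C^2. The bound pi/4 matters here: for \<epsilon>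
  = -1 one finds C = - csc (2x), whose derivative vanishes at pi/4, where C3 would be 0. The
  structure equations hold in every chart of the atlas, but the computation takes place in one chart
  around the given point. Both sides of the normal form transform linearly, so its validity carries
  over to all other charts.\<close>

lemma Ck_on_cong:
  assumes "open S" "\<And>x. x \<in> S \<Longrightarrow> f x = g x"
  shows "Ck_on k S f \<longleftrightarrow> Ck_on k S g"
  using assms(2)
proof (induction k arbitrary: f g)
  case 0
  then show ?case by (simp cong: continuous_on_cong)
next
  case (Suc k)
  have *: "Ck_on (Suc k) S q" if p: "Ck_on (Suc k) S p" and pq: "\<And>x. x \<in> S \<Longrightarrow> p x = q x" for p q :: "'a \<Rightarrow> 'b"
  proof -
    have D: "(q has_derivative frechet_derivative p (at x)) (at x)" if x: "x \<in> S" for x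
    proof (rule has_derivative_transform_within_open[OF _ assms(1) x])
      show "(p has_derivative frechet_derivative p (at x)) (at x)"
        using x p by (simp add: frechet_derivative_works)
    qed (rule pq)
    then have "frechet_derivative p (at x) = frechet_derivative q (at x)" if "x \<in> S" for x
      using frechet_derivative_at that by blast
    then have "Ck_on k S (\<lambda>x. frechet_derivative q (at x) v)" for v
      using Suc.IH[of "\<lambda>x. frechet_derivative p (at x) v" "\<lambda>x. frechet_derivative q (at x) v"] p by simp
    with D show ?thesis by (auto simp: differentiable_def)
  qed
  show ?case
    using *[of f g] *[of g f] Suc.prems by (auto simp del: Ck_on.simps)
qed

lemma Ck_on_SucI:
  assumes "open S" "\<And>x. x \<in> S \<Longrightarrow> (f has_derivative f' x) (at x)" "\<And>v. Ck_on k S (\<lambda>x. f' x v)"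
  shows "Ck_on (Suc k) S f"
proof -
  have "frechet_derivative f (at x) = f' x" if "x \<in> S" for x
    using assms(2)[OF that] frechet_derivative_at by metis
  then have "Ck_on k S (\<lambda>x. frechet_derivative f (at x) v)" for v
    using Ck_on_cong[OF assms(1), of "\<lambda>x. frechet_derivative f (at x) v" "\<lambda>x. f' x v" k] assms(3) by simp
  with assms(2) show ?thesis by (auto simp: differentiable_def)
qed

lemma Ck_on_SucD:
  assumes "Ck_on (Suc k) S f" "x \<in> S"
  shows "(f has_derivative frechet_derivative f (at x)) (at x)"
  using assms by (simp add: frechet_derivative_works)

lemma Ck_on_Suc_imp: "Ck_on (Suc k) S f \<Longrightarrow> Ck_on k S f"
proof (induction k arbitrary: f)
  case 0
  then show ?case
    by (auto intro!: continuous_at_imp_continuous_on differentiable_imp_continuous_within)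
next
  case (Suc k)
  have "\<forall>v. Ck_on k S (\<lambda>x. frechet_derivative f (at x) v)"
    using Suc.prems[unfolded Ck_on.simps(2)[of "Suc k"]] Suc.IH by blast
  with Suc.prems show ?case unfolding Ck_on.simps(2) by blast
qed

lemma Ck_on_mono: "Ck_on l S f \<Longrightarrow> k \<le> l \<Longrightarrow> Ck_on k S f"
  by (induction l rule: nat_induct) (auto simp: le_Suc_eq simp del: Ck_on.simps(2) dest: Ck_on_Suc_imp)

lemma Ck_on_subset: "Ck_on k S f \<Longrightarrow> T \<subseteq> S \<Longrightarrow> Ck_on k T f"
  by (induction k arbitrary: f) (auto intro: continuous_on_subset)

lemma Ck_on_imp_continuous: "Ck_on k S f \<Longrightarrow> continuous_on S f"
  using Ck_on_mono[of k S f 0] by simp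

lemma Ck_on_const: "Ck_on k S (\<lambda>x. c)"
proof (induction k arbitrary: c)
  case (Suc k)
  then show ?case by simp
qed simp

lemma Ck_on_bounded_linear:
  assumes "bounded_linear L" "open S" "Ck_on k S f"
  shows "Ck_on k S (\<lambda>x. L (f x))"
  using assms(3)
proof (induction k arbitrary: f)
  case 0
  then show ?case
    using assms(1) by (simp add: bounded_linear.continuous_on)
next
  case (Suc k)
  show ?case
  proof (rule Ck_on_SucI[OF assms(2)])
    show "((\<lambda>x. L (f x)) has_derivative (\<lambda>v. L (frechet_derivative f (at x) v))) (at x)" if "x \<in> S" for x
      using bounded_linear.has_derivative[OF assms(1) Ck_on_SucD[OF Suc.prems that]] .
    show "Ck_on k S (\<lambda>x. L (frechet_derivative f (at x) v))" for v
      using Suc by simp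
  qed
qed

lemma Ck_on_linear: "bounded_linear L \<Longrightarrow> open S \<Longrightarrow> Ck_on k S L"
proof (induction k)
  case 0 then show ?case by (simp add: linear_continuous_on)
next
  case (Suc k)
  then show ?case
    by (intro Ck_on_SucI[where f' = "\<lambda>x. L"]) (auto intro: bounded_linear_imp_has_derivative Ck_on_const)
qed

lemma Ck_on_add:
  assumes "open S" "Ck_on k S f" "Ck_on k S g"
  shows "Ck_on k S (\<lambda>x. f x + g x)"
  using assms(2,3)
proof (induction k arbitrary: f g)
  case 0
  then show ?case by (simp add: continuous_on_add)
next
  case (Suc k)
  show ?case
  proof (rule Ck_on_SucI[OF assms(1)])
    show "((\<lambda>x. f x + g x) has_derivative (\<lambda>v. frechet_derivative f (at x) v + frechet_derivative g (at x) v)) (at x)"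
      if "x \<in> S" for x
      by (intro has_derivative_add Ck_on_SucD[OF Suc.prems(1) that] Ck_on_SucD[OF Suc.prems(2) that])
  qed (use Suc in simp)
qed

lemma Ck_on_bounded_bilinear:
  assumes "bounded_bilinear B" "open S" "Ck_on k S f" "Ck_on k S g"
  shows "Ck_on k S (\<lambda>x. B (f x) (g x))"
  using assms(3,4)
proof (induction k arbitrary: f g)
  case 0
  then show ?case by (simp add: bounded_bilinear.continuous_on[OF assms(1)])
next
  case (Suc k)
  show ?case
  proof (rule Ck_on_SucI[OF assms(2)])
    show "((\<lambda>x. B (f x) (g x)) has_derivative
        (\<lambda>v. B (f x) (frechet_derivative g (at x) v) + B (frechet_derivative f (at x) v) (g x))) (at x)"
      if "x \<in> S" for x
      by (intro bounded_bilinear.FDERIV[OF assms(1)] Ck_on_SucD[OF Suc.prems(1) that] Ck_on_SucD[OF Suc.prems(2) that])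
    have "Ck_on k S f" "Ck_on k S g"
      using Suc.prems by (simp_all add: Ck_on_Suc_imp del: Ck_on.simps)
    then show "Ck_on k S (\<lambda>x. B (f x) (frechet_derivative g (at x) v) + B (frechet_derivative f (at x) v) (g x))" for v
      using Suc.prems by (intro Ck_on_add Suc.IH assms(2)) simp_all
  qed
qed

lemmas Ck_on_scaleR = Ck_on_bounded_bilinear[OF bounded_bilinear_scaleR]
lemmas Ck_on_inner = Ck_on_bounded_bilinear[OF bounded_bilinear_inner]

lemma Ck_on_mult:
  fixes f g :: "'a::real_normed_vector \<Rightarrow> real"
  shows "open S \<Longrightarrow> Ck_on k S f \<Longrightarrow> Ck_on k S g \<Longrightarrow> Ck_on k S (\<lambda>x. f x * g x)"
  by (rule Ck_on_bounded_bilinear[OF bounded_bilinear_mult])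

lemma bounded_bilinear_cross3: "bounded_bilinear (\<lambda>a b. a \<times> b)"
  using bilinear_cross bilinear_conv_bounded_bilinear by blast

lemmas Ck_on_cross = Ck_on_bounded_bilinear[OF bounded_bilinear_cross3]

lemma Ck_on_minus: "open S \<Longrightarrow> Ck_on k S f \<Longrightarrow> Ck_on k S (\<lambda>x. - f x)"
  by (rule Ck_on_bounded_linear[OF bounded_linear_minus[OF bounded_linear_ident]])

lemma Ck_on_diff: "open S \<Longrightarrow> Ck_on k S f \<Longrightarrow> Ck_on k S g \<Longrightarrow> Ck_on k S (\<lambda>x. f x - g x)"
  using Ck_on_add[of S k f "\<lambda>x. - g x"] Ck_on_minus[of S k g] by simp

lemma Ck_on_power:
  fixes f :: "'a::real_normed_vector \<Rightarrow> real"
  shows "open S \<Longrightarrow> Ck_on k S f \<Longrightarrow> Ck_on k S (\<lambda>x. f x ^ n)"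
  by (induction n) (auto intro: Ck_on_const Ck_on_mult)

lemma Ck_on_sum: "open S \<Longrightarrow> (\<And>i. i \<in> I \<Longrightarrow> Ck_on k S (f i)) \<Longrightarrow> Ck_on k S (\<lambda>x. \<Sum>i\<in>I. f i x)"
  by (induction I rule: infinite_finite_induct) (auto intro: Ck_on_const Ck_on_add)

text \<open>\<open>Ck_on\<close> speaks of the derivative along one fixed direction at a time,
  whereas the chain rule evaluates the derivative of \<open>g\<close> in a direction that moves with
  the point. Expanding that direction in a basis of the middle space brings the fixed directions
  back; hence \<open>euclidean_space\<close>.\<close>

lemma Ck_on_compose:
  fixes f :: "'a::real_normed_vector \<Rightarrow> 'b::euclidean_space" and g :: "'b \<Rightarrow> 'c::real_normed_vector"
  assumes "open S" "open T" "Ck_on k S f" "Ck_on k T g" "f ` S \<subseteq> T"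
  shows "Ck_on k S (\<lambda>x. g (f x))"
  using assms(3,4)
proof (induction k arbitrary: g)
  case 0
  then show ?case using assms(5) by (auto intro: continuous_on_compose2)
next
  case (Suc k)
  show ?case
  proof (rule Ck_on_SucI[OF assms(1)])
    let ?D = "\<lambda>x v. frechet_derivative f (at x) v"
    show "((\<lambda>x. g (f x)) has_derivative
        (\<lambda>v. \<Sum>b\<in>Basis. (?D x v \<bullet> b) *\<^sub>R frechet_derivative g (at (f x)) b)) (at x)" if "x \<in> S" for x
    proof -
      have g: "(g has_derivative frechet_derivative g (at (f x))) (at (f x))"
        using Ck_on_SucD[OF Suc.prems(2)] that assms(5) by blast
      have lin: "linear (frechet_derivative g (at (f x)))"
        using g has_derivative_linear by blast
      have chain: "((\<lambda>x. g (f x)) has_derivative (\<lambda>v. frechet_derivative g (at (f x)) (?D x v))) (at x)"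
        using has_derivative_compose[OF Ck_on_SucD[OF Suc.prems(1) that] g] .
      have rep: "frechet_derivative g (at (f x)) w = (\<Sum>b\<in>Basis. (w \<bullet> b) *\<^sub>R frechet_derivative g (at (f x)) b)" for w
        using lin by (subst euclidean_representation[of w, symmetric])
          (simp only: linear_sum linear_scale)
      from chain show ?thesis by (rule has_derivative_eq_rhs) (rule ext, rule rep)
    qed
    have "Ck_on k S f" using Suc.prems(1) by (rule Ck_on_Suc_imp)
    then show "Ck_on k S (\<lambda>x. \<Sum>b\<in>Basis. (?D x v \<bullet> b) *\<^sub>R frechet_derivative g (at (f x)) b)" for v
      using Suc.prems by (intro Ck_on_sum Ck_on_scaleR Ck_on_inner Ck_on_const assms(1) Suc.IH) simp_all
  qed
qed

lemma Ck_on_real_SucI: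
  fixes f :: "real \<Rightarrow> real"
  assumes "open S" "\<And>x. x \<in> S \<Longrightarrow> (f has_real_derivative f' x) (at x)" "Ck_on k S f'"
  shows "Ck_on (Suc k) S f"
proof (rule Ck_on_SucI[OF assms(1)])
  show "(f has_derivative (\<lambda>v. f' x * v)) (at x)" if "x \<in> S" for x
    using assms(2)[OF that] by (simp add: has_field_derivative_def)
  show "Ck_on k S (\<lambda>x. f' x * v)" for v
    by (intro Ck_on_mult Ck_on_const assms)
qed

lemma Ck_on_deriv:
  fixes f :: "real \<Rightarrow> real"
  assumes "open S" "Ck_on (Suc k) S f"
  shows "Ck_on k S (deriv f)" "\<And>x. x \<in> S \<Longrightarrow> (f has_real_derivative deriv f x) (at x)"
proof -
  have f: "f field_differentiable at x" if "x \<in> S" for x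
    using assms(2) that by (auto simp: differentiable_def field_differentiable_def has_real_derivative)
       (metis has_real_derivative)
  then show D: "(f has_real_derivative deriv f x) (at x)" if "x \<in> S" for x
    using that by (simp add: field_differentiable_derivI)
  have "frechet_derivative f (at x) 1 = deriv f x" if "x \<in> S" for x
    using D[OF that] frechet_derivative_at[of f "(*) (deriv f x)" x]
    by (simp add: has_field_derivative_def) (metis mult.right_neutral)
  moreover have "Ck_on k S (\<lambda>x. frechet_derivative f (at x) 1)"
    using assms(2) by simp
  ultimately show "Ck_on k S (deriv f)"
    using Ck_on_cong[OF assms(1), of "\<lambda>x. frechet_derivative f (at x) 1" "deriv f" k] by simp
qed

section \<open>Elementary functions of class C^k\<close>

lemma Ck_on_sin_cos: "Ck_on k UNIV (sin :: real \<Rightarrow> real) \<and> Ck_on k UNIV (cos :: real \<Rightarrow> real)"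
proof (induction k)
  case (Suc k)
  have "Ck_on (Suc k) UNIV (sin :: real \<Rightarrow> real)"
    by (rule Ck_on_real_SucI[of _ sin cos]) (auto intro: Suc[THEN conjunct2])
  moreover have "Ck_on (Suc k) UNIV (cos :: real \<Rightarrow> real)"
    by (rule Ck_on_real_SucI[of _ cos "\<lambda>x. - sin x"]) (auto intro!: Ck_on_minus Suc[THEN conjunct1])
  ultimately show ?case by blast
qed (simp add: continuous_on_sin continuous_on_cos)

lemma Ck_on_inverse_real: "Ck_on k (- {0}) (inverse :: real \<Rightarrow> real)"
proof (induction k)
  case 0 show ?case by (simp add: continuous_on_inverse)
next
  case (Suc k)
  show ?case
    by (rule Ck_on_real_SucI[of _ _ "\<lambda>x. - (inverse x ^ Suc (Suc 0))"])
       (use Suc in \<open>auto intro!: Ck_on_minus Ck_on_power DERIV_inverse simp del: power_Suc\<close>)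
qed

text \<open>The coordinate y may be negative, so the logarithm in \<open>N1\<close> is that of the
  absolute value.\<close>

lemma DERIV_ln_abs: "x \<noteq> 0 \<Longrightarrow> ((\<lambda>x. ln \<bar>x\<bar>) has_real_derivative inverse x) (at x)"
proof (cases "x > 0")
  case True
  have "(ln has_real_derivative inverse x) (at x)"
    using DERIV_ln[OF True] .
  then show ?thesis
    by (rule has_field_derivative_transform_within_open[where S = "{0<..}"]) (use True in auto)
next
  case False
  assume "x \<noteq> 0"
  have "((\<lambda>x. ln (- x)) has_real_derivative inverse x) (at x)"
    using False \<open>x \<noteq> 0\<close> by (auto intro!: derivative_eq_intros simp: field_simps)
  then show ?thesis
    by (rule has_field_derivative_transform_within_open[where S = "{..<0}"]) (use False \<open>x \<noteq> 0\<close> in auto)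
qed

lemma Ck_on_ln_abs_real: "Ck_on k (- {0}) (\<lambda>x::real. ln \<bar>x\<bar>)"
proof -
  \<comment> \<open>One order more is proved than asked, so that k = 0 needs no separate continuity
    argument.\<close>
  have "Ck_on (Suc k) (- {0}) (\<lambda>x::real. ln \<bar>x\<bar>)"
    by (rule Ck_on_real_SucI[of _ _ inverse]) (auto intro: Ck_on_inverse_real DERIV_ln_abs)
  then show ?thesis by (rule Ck_on_Suc_imp)
qed

context
  fixes S :: "'a::real_normed_vector set" and f :: "'a \<Rightarrow> real" and k :: nat
  assumes S: "open S" and f: "Ck_on k S f"
begin

lemma Ck_on_sin: "Ck_on k S (\<lambda>x. sin (f x))"
  by (rule Ck_on_compose[OF S open_UNIV f]) (use Ck_on_sin_cos in auto)

lemma Ck_on_cos: "Ck_on k S (\<lambda>x. cos (f x))"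
  by (rule Ck_on_compose[OF S open_UNIV f]) (use Ck_on_sin_cos in auto)

lemma Ck_on_inverse: "(\<And>x. x \<in> S \<Longrightarrow> f x \<noteq> 0) \<Longrightarrow> Ck_on k S (\<lambda>x. inverse (f x))"
  by (rule Ck_on_compose[OF S _ f Ck_on_inverse_real]) auto

lemma Ck_on_ln_abs: "(\<And>x. x \<in> S \<Longrightarrow> f x \<noteq> 0) \<Longrightarrow> Ck_on k S (\<lambda>x. ln \<bar>f x\<bar>)"
  by (rule Ck_on_compose[OF S _ f Ck_on_ln_abs_real]) auto

end

lemma Ck_on_divide:
  fixes f g :: "'a::real_normed_vector \<Rightarrow> real"
  shows "open S \<Longrightarrow> Ck_on k S f \<Longrightarrow> Ck_on k S g \<Longrightarrow> (\<And>x. x \<in> S \<Longrightarrow> g x \<noteq> 0) \<Longrightarrow> Ck_on k S (\<lambda>x. f x / g x)"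
  unfolding divide_inverse by (intro Ck_on_mult Ck_on_inverse)

lemma Ck_on_vec_nth:
  fixes f :: "'a::real_normed_vector \<Rightarrow> real^'n"
  shows "open S \<Longrightarrow> Ck_on k S f \<Longrightarrow> Ck_on k S (\<lambda>x. f x $ i)"
  by (rule Ck_on_bounded_linear[OF bounded_linear_vec_nth])

lemma Ck_on_vec_lambda:
  fixes f :: "'a::real_normed_vector \<Rightarrow> 'n::finite \<Rightarrow> real"
  assumes "open S" "\<And>i. Ck_on k S (\<lambda>x. f x i)"
  shows "Ck_on k S (\<lambda>x. \<chi> i. f x i)"
proof -
  have "(\<chi> i. f x i) = (\<Sum>i\<in>UNIV. f x i *\<^sub>R axis i 1)" for x
    by (simp add: vec_eq_iff axis_def if_distrib sum.delta cong: if_cong)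
  then show ?thesis
    using assms by (simp only:) (intro Ck_on_sum Ck_on_scaleR Ck_on_const)
qed

lemma vector_3_lambda: "(vector [a, b, c] :: 'a::zero^3) = (\<chi> i. if i = 1 then a else if i = 2 then b else c)"
  by (simp add: vec_eq_iff forall_3)

lemma Ck_on_vector_3:
  fixes f g h :: "'a::real_normed_vector \<Rightarrow> real"
  assumes "open S" "Ck_on k S f" "Ck_on k S g" "Ck_on k S h"
  shows "Ck_on k S (\<lambda>x. vector [f x, g x, h x] :: real^3)"
  unfolding vector_3_lambda
proof (rule Ck_on_vec_lambda[OF assms(1)])
  show "Ck_on k S (\<lambda>x. if i = 1 then f x else if i = 2 then g x else h x)" for i :: 3
    using assms(2-) by (cases "i = 1"; cases "i = 2") simp_all
qed

lemmas Ck_on_intros = Ck_on_const Ck_on_add Ck_on_diff Ck_on_minus Ck_on_mult Ck_on_scaleR Ck_on_inner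
  Ck_on_cross Ck_on_power Ck_on_sin Ck_on_cos Ck_on_inverse Ck_on_divide Ck_on_ln_abs Ck_on_vec_nth Ck_on_vector_3

section \<open>Gradient and curl\<close>

text \<open>The second difference of \<open>h\<close> over the parallelogram spanned by s v and s w:
  the mean value theorem is applied along v to the difference \<open>\<phi>\<close> of
  \<open>h\<close> on two opposite sides, then along w to the directional derivative
  \<open>\<psi>\<close>.\<close>

lemma double_difference_mean_value:
  fixes h :: "'a::real_normed_vector \<Rightarrow> real"
  assumes "Ck_on 2 S h" "s > 0"
    and mem: "\<And>a b. 0 \<le> a \<Longrightarrow> a \<le> s \<Longrightarrow> 0 \<le> b \<Longrightarrow> b \<le> s \<Longrightarrow> x + a *\<^sub>R v + b *\<^sub>R w \<in> S"
  shows "\<exists>a b. 0 < a \<and> a < s \<and> 0 < b \<and> b < s \<and>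
    h (x + s *\<^sub>R v + s *\<^sub>R w) - h (x + s *\<^sub>R v) - h (x + s *\<^sub>R w) + h x =
    s * (s * frechet_derivative (\<lambda>y. frechet_derivative h (at y) v) (at (x + a *\<^sub>R v + b *\<^sub>R w)) w)"
proof -
  define Dv where "Dv = (\<lambda>y. frechet_derivative h (at y) v)"
  have h: "(h has_derivative frechet_derivative h (at y)) (at y)" if "y \<in> S" for y
    using assms(1) that by (simp add: numeral_2_eq_2 frechet_derivative_works)
  have Dv: "(Dv has_derivative frechet_derivative Dv (at y)) (at y)" if "y \<in> S" for y
    using assms(1) that by (simp add: numeral_2_eq_2 frechet_derivative_works Dv_def)
  have line: "((\<lambda>a. f (y + a *\<^sub>R u)) has_real_derivative frechet_derivative f (at (y + a *\<^sub>R u)) u) (at a)"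
    if "(f has_derivative frechet_derivative f (at (y + a *\<^sub>R u))) (at (y + a *\<^sub>R u))"
    for f :: "'a \<Rightarrow> real" and y u a
  proof -
    have "((\<lambda>a. y + a *\<^sub>R u) has_derivative (\<lambda>t. t *\<^sub>R u)) (at a)"
      by (auto intro!: derivative_eq_intros)
    from has_derivative_compose[OF this that]
    show ?thesis
      using linear_scale[OF has_derivative_linear[OF that]]
      by (simp add: has_field_derivative_def mult_commute_abs)
  qed
  define \<phi> where "\<phi> a = h ((x + s *\<^sub>R w) + a *\<^sub>R v) - h (x + a *\<^sub>R v)" for a
  have "(\<phi> has_real_derivative Dv ((x + s *\<^sub>R w) + a *\<^sub>R v) - Dv (x + a *\<^sub>R v)) (at a)"
    if "0 \<le> a" "a \<le> s" for a
  proof -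
    have "(x + s *\<^sub>R w) + a *\<^sub>R v \<in> S" "x + a *\<^sub>R v \<in> S"
      using mem[OF that, of s] mem[OF that, of 0] \<open>s > 0\<close> by (simp_all add: add_ac)
    from DERIV_diff[OF line[OF h[OF this(1)]] line[OF h[OF this(2)]]]
    show ?thesis unfolding \<phi>_def Dv_def .
  qed
  then obtain a where a: "0 < a" "a < s"
      "\<phi> s - \<phi> 0 = (s - 0) * (Dv ((x + s *\<^sub>R w) + a *\<^sub>R v) - Dv (x + a *\<^sub>R v))"
    using MVT2[OF \<open>s > 0\<close>, of \<phi> "\<lambda>a. Dv ((x + s *\<^sub>R w) + a *\<^sub>R v) - Dv (x + a *\<^sub>R v)"] by auto
  define \<psi> where "\<psi> b = Dv ((x + a *\<^sub>R v) + b *\<^sub>R w)" for b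
  have "(\<psi> has_real_derivative frechet_derivative Dv (at ((x + a *\<^sub>R v) + b *\<^sub>R w)) w) (at b)"
    if "0 \<le> b" "b \<le> s" for b
    unfolding \<psi>_def using mem[OF _ _ that, of a] a by (intro line[OF Dv]) simp
  then obtain b where b: "0 < b" "b < s"
      "\<psi> s - \<psi> 0 = (s - 0) * frechet_derivative Dv (at ((x + a *\<^sub>R v) + b *\<^sub>R w)) w"
    using MVT2[OF \<open>s > 0\<close>, of \<psi> "\<lambda>b. frechet_derivative Dv (at ((x + a *\<^sub>R v) + b *\<^sub>R w)) w"] by auto
  have "h (x + s *\<^sub>R v + s *\<^sub>R w) - h (x + s *\<^sub>R v) - h (x + s *\<^sub>R w) + h x = \<phi> s - \<phi> 0"
    by (simp add: \<phi>_def algebra_simps)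
  also have "\<dots> = s * (\<psi> s - \<psi> 0)"
    using a(3) by (simp add: \<psi>_def algebra_simps)
  finally show ?thesis
    using a b unfolding Dv_def by auto
qed

text \<open>The second difference is unchanged when v and w are exchanged, so the two mixed
  derivatives take a common value at two points near x; continuity of the second derivatives then
  gives equality at x itself.\<close>

lemma second_derivative_symmetric:
  fixes h :: "'a::real_normed_vector \<Rightarrow> real"
  assumes S: "open S" and h: "Ck_on 2 S h" and x: "x \<in> S"
  shows "frechet_derivative (\<lambda>y. frechet_derivative h (at y) v) (at x) w =
         frechet_derivative (\<lambda>y. frechet_derivative h (at y) w) (at x) v"
proof -
  define D where "D = (\<lambda>v w y. frechet_derivative (\<lambda>y. frechet_derivative h (at y) v) (at y) w)"
  have cont: "continuous (at x) (D v w)" for v w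
    using h S x by (simp add: numeral_2_eq_2 D_def continuous_on_eq_continuous_at)
  have "\<bar>D v w x - D w v x\<bar> < e" if "e > 0" for e
  proof -
    obtain d1 where d1: "d1 > 0" "\<And>y. dist y x < d1 \<Longrightarrow> dist (D v w y) (D v w x) < e / 2"
      using cont[of v w] \<open>e > 0\<close> unfolding continuous_at_eps_delta by (metis half_gt_zero)
    obtain d2 where d2: "d2 > 0" "\<And>y. dist y x < d2 \<Longrightarrow> dist (D w v y) (D w v x) < e / 2"
      using cont[of w v] \<open>e > 0\<close> unfolding continuous_at_eps_delta by (metis half_gt_zero)
    obtain d3 where d3: "d3 > 0" "ball x d3 \<subseteq> S"
      using S x open_contains_ball by blast
    define d where "d = min d1 (min d2 d3)"
    \<comment> \<open>This size keeps the whole parallelogram within distance d of x; the summand 1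
      avoids division by 0 for v = w = 0.\<close>
    define s where "s = d / (norm v + norm w + 1)"
    have "d > 0" using d1 d2 d3 by (simp add: d_def)
    have "norm v + norm w + 1 > 0"
      by (meson add_nonneg_pos norm_ge_zero add_nonneg_nonneg zero_less_one)
    then have s: "s > 0" "s * (norm v + norm w) < d"
      using \<open>d > 0\<close> unfolding s_def by (auto simp: field_simps)
    have near: "dist (x + a *\<^sub>R v + b *\<^sub>R w) x < d" if "0 \<le> a" "a \<le> s" "0 \<le> b" "b \<le> s" for a b
    proof -
      have "dist (x + a *\<^sub>R v + b *\<^sub>R w) x \<le> norm (a *\<^sub>R v) + norm (b *\<^sub>R w)"
        by (simp add: dist_norm add.assoc norm_triangle_ineq del: norm_scaleR)
      also have "\<dots> \<le> s * norm v + s * norm w"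
        using that by (intro add_mono) (simp_all add: mult_right_mono)
      finally show ?thesis using s(2) by (simp add: algebra_simps)
    qed
    have mem: "x + a *\<^sub>R v + b *\<^sub>R w \<in> S" if "0 \<le> a" "a \<le> s" "0 \<le> b" "b \<le> s" for a b
      using near[OF that] d3 by (auto simp: d_def dist_commute)
    have mem': "x + a *\<^sub>R w + b *\<^sub>R v \<in> S" if "0 \<le> a" "a \<le> s" "0 \<le> b" "b \<le> s" for a b
      using mem[OF that(3,4,1,2)] by (simp add: algebra_simps)
    obtain a b where ab: "0 < a" "a < s" "0 < b" "b < s"
        "h (x + s *\<^sub>R v + s *\<^sub>R w) - h (x + s *\<^sub>R v) - h (x + s *\<^sub>R w) + h x =
         s * (s * D v w (x + a *\<^sub>R v + b *\<^sub>R w))"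
      using double_difference_mean_value[OF h s(1) mem] unfolding D_def by blast
    obtain a' b' where ab': "0 < a'" "a' < s" "0 < b'" "b' < s"
        "h (x + s *\<^sub>R w + s *\<^sub>R v) - h (x + s *\<^sub>R w) - h (x + s *\<^sub>R v) + h x =
         s * (s * D w v (x + a' *\<^sub>R w + b' *\<^sub>R v))"
      using double_difference_mean_value[OF h s(1) mem'] unfolding D_def by blast
    have swap: "x + s *\<^sub>R w + s *\<^sub>R v = x + s *\<^sub>R v + s *\<^sub>R w" by (simp add: algebra_simps)
    then have "s * (s * D w v (x + a' *\<^sub>R w + b' *\<^sub>R v)) = s * (s * D v w (x + a *\<^sub>R v + b *\<^sub>R w))"
      unfolding ab(5)[symmetric] ab'(5)[symmetric] swap by simp
    then have "D v w (x + a *\<^sub>R v + b *\<^sub>R w) = D w v (x + b' *\<^sub>R v + a' *\<^sub>R w)"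
      using s(1) by (simp add: algebra_simps)
    moreover have "dist (D v w (x + a *\<^sub>R v + b *\<^sub>R w)) (D v w x) < e / 2"
      using near[of a b] ab by (intro d1) (auto simp: d_def)
    moreover have "dist (D w v (x + b' *\<^sub>R v + a' *\<^sub>R w)) (D w v x) < e / 2"
      using near[of b' a'] ab' by (intro d2) (auto simp: d_def)
    ultimately show ?thesis unfolding dist_real_def by linarith
  qed
  then have "D v w x = D w v x"
    by (metis less_irrefl right_minus_eq zero_less_abs_iff)
  then show ?thesis by (simp add: D_def)
qed

section \<open>Gradient and curl with their Leibniz rules\<close>

abbreviation pd :: "3 \<Rightarrow> (real^3 \<Rightarrow> real) \<Rightarrow> real^3 \<Rightarrow> real" where
  "pd i h p \<equiv> frechet_derivative h (at p) (axis i 1)"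

definition grad :: "(real^3 \<Rightarrow> real) \<Rightarrow> real^3 \<Rightarrow> real^3" where
  "grad h p = (\<chi> i. pd i h p)"

text \<open>For the derivative D of a 1-form, \<open>D (axis i 1)\<close> holds the i-th partial
  derivatives, and the entries are those of the exterior derivative in the order 23, 31, 12.\<close>

definition curl_of :: "(real^3 \<Rightarrow> real^3) \<Rightarrow> real^3" where
  "curl_of D = vector [D (axis 2 1) $ 3 - D (axis 3 1) $ 2, D (axis 3 1) $ 1 - D (axis 1 1) $ 3,
                       D (axis 1 1) $ 2 - D (axis 2 1) $ 1]"

text \<open>A relation instead of a function: it carries differentiability along, so that curls of
  composite forms are obtained by chaining rules.\<close>

definition has_curl :: "(real^3 \<Rightarrow> real^3) \<Rightarrow> real^3 \<Rightarrow> real^3 \<Rightarrow> bool" where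
  "has_curl \<alpha> K p \<longleftrightarrow> (\<exists>D. (\<alpha> has_derivative D) (at p) \<and> K = curl_of D)"

lemma linear_eq_sum_axis:
  fixes L :: "real^'n \<Rightarrow> 'b::real_normed_vector"
  assumes "linear L"
  shows "L v = (\<Sum>i\<in>UNIV. v $ i *\<^sub>R L (axis i 1))"
proof -
  have "v = (\<Sum>i\<in>UNIV. v $ i *\<^sub>R axis i 1)"
    by (simp add: vec_eq_iff axis_def if_distrib sum.delta cong: if_cong)
  then have "L v = L (\<Sum>i\<in>UNIV. v $ i *\<^sub>R axis i 1)" by (rule arg_cong)
  also have "\<dots> = (\<Sum>i\<in>UNIV. v $ i *\<^sub>R L (axis i 1))"
    by (simp only: linear_sum[OF assms] linear_scale[OF assms])
  finally show ?thesis .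
qed

lemma differentiable_GDERIV:
  assumes "h differentiable (at p)"
  shows "GDERIV h p :> grad h p"
proof -
  have h: "(h has_derivative frechet_derivative h (at p)) (at p)"
    using assms frechet_derivative_works by blast
  have "frechet_derivative h (at p) = (\<lambda>v. v \<bullet> grad h p)"
    by (rule ext, subst linear_eq_sum_axis[OF has_derivative_linear[OF h]]) (simp add: inner_vec_def grad_def)
  with h show ?thesis by (simp add: gderiv_def)
qed

lemma GDERIV_pd: "GDERIV h p :> X \<Longrightarrow> pd i h p = X $ i"
  unfolding gderiv_def using frechet_derivative_at[of h "\<lambda>v. v \<bullet> X" p]
  by (metis cart_eq_inner_axis inner_commute)

lemma GDERIV_grad: "GDERIV h p :> X \<Longrightarrow> grad h p = X"
  by (simp add: grad_def GDERIV_pd vec_eq_iff)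

lemma GDERIV_unique: "GDERIV h p :> X \<Longrightarrow> GDERIV h p :> Y \<Longrightarrow> X = Y"
  for h :: "real^3 \<Rightarrow> real"
  using GDERIV_grad by metis

lemma Ck_on_grad:
  assumes "open W" "Ck_on (Suc k) W h"
  shows "Ck_on k W (grad h)"
  unfolding grad_def[abs_def] using assms by (intro Ck_on_vec_lambda) simp_all

lemma frechet_derivative_vec_nth:
  fixes \<alpha> :: "'a::real_normed_vector \<Rightarrow> real^'n"
  assumes "(\<alpha> has_derivative D) (at p)"
  shows "frechet_derivative (\<lambda>q. \<alpha> q $ i) (at p) v = D v $ i"
  using frechet_derivative_at[OF bounded_linear.has_derivative[OF bounded_linear_vec_nth assms]]
  by metis

lemma has_curl_pd:
  assumes "has_curl \<alpha> K p"
  shows "K = vector [pd 2 (\<lambda>q. \<alpha> q $ 3) p - pd 3 (\<lambda>q. \<alpha> q $ 2) p,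
                     pd 3 (\<lambda>q. \<alpha> q $ 1) p - pd 1 (\<lambda>q. \<alpha> q $ 3) p,
                     pd 1 (\<lambda>q. \<alpha> q $ 2) p - pd 2 (\<lambda>q. \<alpha> q $ 1) p]"
  using assms by (auto simp: has_curl_def curl_of_def frechet_derivative_vec_nth)

lemma has_curl_unique: "has_curl \<alpha> K p \<Longrightarrow> has_curl \<alpha> L p \<Longrightarrow> K = L"
  by (metis has_curl_pd)

lemma has_curl_exists: "\<alpha> differentiable (at p) \<Longrightarrow> \<exists>K. has_curl \<alpha> K p"
  by (auto simp: has_curl_def differentiable_def)

lemma has_curl_eq: "has_curl \<alpha> K p \<Longrightarrow> K = L \<Longrightarrow> has_curl \<alpha> L p"
  by simp

lemma has_curl_transform:
  assumes "has_curl \<alpha> K p" "open W" "p \<in> W" "\<And>q. q \<in> W \<Longrightarrow> \<alpha> q = \<beta> q"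
  shows "has_curl \<beta> K p"
  using assms has_derivative_transform_within_open unfolding has_curl_def by blast

lemma GDERIV_transform:
  assumes "GDERIV f p :> X" "open W" "p \<in> W" "\<And>q. q \<in> W \<Longrightarrow> f q = g q"
  shows "GDERIV g p :> X"
  using assms has_derivative_transform_within_open unfolding gderiv_def by blast

lemma has_curl_add:
  assumes "has_curl \<alpha> K p" "has_curl \<beta> L p"
  shows "has_curl (\<lambda>q. \<alpha> q + \<beta> q) (K + L) p"
proof -
  from assms obtain D E where "(\<alpha> has_derivative D) (at p)" "K = curl_of D"
    "(\<beta> has_derivative E) (at p)" "L = curl_of E" by (auto simp: has_curl_def)
  then show ?thesis unfolding has_curl_def
    by (intro exI[of _ "\<lambda>v. D v + E v"])
      (auto intro!: has_derivative_add simp: curl_of_def vec_eq_iff forall_3)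
qed

text \<open>The rule d(h \<alpha>) = h d\<alpha> + dh \<and> \<alpha>, with the wedge product read
  as a cross product.\<close>

lemma has_curl_scaleR:
  assumes "GDERIV h p :> X" "has_curl \<alpha> K p"
  shows "has_curl (\<lambda>q. h q *\<^sub>R \<alpha> q) (h p *\<^sub>R K + X \<times> \<alpha> p) p"
proof -
  from assms obtain D where D: "(\<alpha> has_derivative D) (at p)" "K = curl_of D" by (auto simp: has_curl_def)
  have h: "(h has_derivative (\<lambda>v. v \<bullet> X)) (at p)" using assms by (simp add: gderiv_def)
  have "h p *\<^sub>R K + X \<times> \<alpha> p = curl_of (\<lambda>v. h p *\<^sub>R D v + (v \<bullet> X) *\<^sub>R \<alpha> p)"
    by (simp add: D curl_of_def cross3_def vec_eq_iff forall_3 inner_commute[of "axis _ _"]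
        cart_eq_inner_axis[symmetric] algebra_simps)
  with has_derivative_scaleR[OF h D(1)] show ?thesis unfolding has_curl_def by blast
qed

lemma has_curl_const: "has_curl (\<lambda>q. c) 0 p"
  unfolding has_curl_def
  by (intro exI[of _ "\<lambda>v. 0"]) (simp add: curl_of_def vec_eq_iff forall_3)

lemma has_curl_scaleR_const: "has_curl \<alpha> K p \<Longrightarrow> has_curl (\<lambda>q. c *\<^sub>R \<alpha> q) (c *\<^sub>R K) p"
  using has_curl_scaleR[OF GDERIV_const] by fastforce

lemma has_curl_minus: "has_curl \<alpha> K p \<Longrightarrow> has_curl (\<lambda>q. - \<alpha> q) (- K) p"
  using has_curl_scaleR_const[of \<alpha> K p "-1"] by simp

lemma has_curl_diff: "has_curl \<alpha> K p \<Longrightarrow> has_curl \<beta> L p \<Longrightarrow> has_curl (\<lambda>q. \<alpha> q - \<beta> q) (K - L) p"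
  using has_curl_add[of \<alpha> K p "\<lambda>q. - \<beta> q" "- L"] has_curl_minus[of \<beta> L p] by simp

text \<open>This is d^2 h = 0, by symmetry of the second derivatives. The field \<open>X\<close> is
  kept general so that any expression known to equal the gradient on \<open>W\<close> can be
  used.\<close>

lemma has_curl_gradient:
  assumes W: "open W" and h: "Ck_on 2 W h" and X: "\<And>q. q \<in> W \<Longrightarrow> GDERIV h q :> X q" and p: "p \<in> W"
  shows "has_curl X 0 p"
proof -
  have Xi: "X q $ i = pd i h q" if "q \<in> W" for q i
    using GDERIV_pd[OF X[OF that]] by simp
  have "Ck_on (Suc 0) W (grad h)"
    using h by (intro Ck_on_grad W) (simp add: numeral_2_eq_2)
  then have D: "(grad h has_derivative frechet_derivative (grad h) (at p)) (at p)"
    using Ck_on_SucD p by blast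
  have "frechet_derivative (grad h) (at p) v $ i = frechet_derivative (pd i h) (at p) v" for v i
    using frechet_derivative_vec_nth[OF D] by (simp add: grad_def)
  then have "curl_of (frechet_derivative (grad h) (at p)) = 0"
    using second_derivative_symmetric[OF W h p]
    by (simp add: curl_of_def vec_eq_iff forall_3)
  then have "has_curl (grad h) 0 p" using D unfolding has_curl_def by metis
  then show ?thesis
    by (rule has_curl_transform[OF _ W p]) (use Xi in \<open>simp add: grad_def vec_eq_iff\<close>)
qed

text \<open>This is \<open>d(\<alpha> \<and> \<beta>) = 0\<close> for an exact 2-form \<open>\<alpha> \<and> \<beta> = d\<omega>\<close>.\<close>
lemma exact_cross_product:
  assumes W: "open W" and w: "Ck_on 2 W w" and cw: "\<And>q. q \<in> W \<Longrightarrow> has_curl w (\<alpha> q \<times> \<beta> q) q"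
    and p: "p \<in> W" and "has_curl \<alpha> A p" "has_curl \<beta> B p"
  shows "A \<bullet> \<beta> p = \<alpha> p \<bullet> B"
proof -
  obtain DA where DA: "(\<alpha> has_derivative DA) (at p)" "A = curl_of DA"
    using assms by (auto simp: has_curl_def)
  obtain DB where DB: "(\<beta> has_derivative DB) (at p)" "B = curl_of DB"
    using assms by (auto simp: has_curl_def)
  define K where "K q = \<alpha> q \<times> \<beta> q" for q
  have DK: "(K has_derivative (\<lambda>v. \<alpha> p \<times> DB v + DA v \<times> \<beta> p)) (at p)"
    unfolding K_def using bounded_bilinear.FDERIV[OF bounded_bilinear_cross3 DA(1) DB(1)] .
  have wj: "Ck_on 2 W (\<lambda>q. w q $ j)" for j
    using w W by (rule Ck_on_vec_nth[rotated])
  have dd: "(pd i (\<lambda>q. w q $ j) has_derivative frechet_derivative (pd i (\<lambda>q. w q $ j)) (at p)) (at p)" for i j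
    using wj[of j] p by (simp add: numeral_2_eq_2 frechet_derivative_works)
  define dw where "dw k i j = pd k (pd i (\<lambda>q. w q $ j)) p" for k i j
  have sym: "dw k i j = dw i k j" for k i j
    unfolding dw_def by (rule second_derivative_symmetric[OF W wj p])
  have comp: "(\<alpha> p \<times> DB (axis k 1) + DA (axis k 1) \<times> \<beta> p) $ l = dw k i j - dw k j i"
    if "\<And>q. q \<in> W \<Longrightarrow> K q $ l = pd i (\<lambda>q. w q $ j) q - pd j (\<lambda>q. w q $ i) q" for k l i j
  proof -
    have "((\<lambda>q. K q $ l) has_derivative (\<lambda>v. frechet_derivative (pd i (\<lambda>q. w q $ j)) (at p) v
        - frechet_derivative (pd j (\<lambda>q. w q $ i)) (at p) v)) (at p)"
      by (rule has_derivative_transform_within_open[OF has_derivative_diff[OF dd dd] W p]) (simp add: that)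
    from frechet_derivative_at[OF this, symmetric] show ?thesis
      using frechet_derivative_vec_nth[OF DK, of l "axis k 1"] by (simp add: dw_def)
  qed
  have K: "K q = vector [pd 2 (\<lambda>q. w q $ 3) q - pd 3 (\<lambda>q. w q $ 2) q,
      pd 3 (\<lambda>q. w q $ 1) q - pd 1 (\<lambda>q. w q $ 3) q, pd 1 (\<lambda>q. w q $ 2) q - pd 2 (\<lambda>q. w q $ 1) q]" if "q \<in> W" for q
    using has_curl_pd[OF cw[OF that]] unfolding K_def .
  \<comment> \<open>The three diagonal terms add up to the divergence of K. The mixed partial
    derivatives of w cancel in pairs, while the product rule turns the same sum into A \<bullet>
    \<beta> - \<alpha> \<bullet> B.\<close>
  have "(\<alpha> p \<times> DB (axis 1 1) + DA (axis 1 1) \<times> \<beta> p) $ 1 = dw 1 2 3 - dw 1 3 2"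
    "(\<alpha> p \<times> DB (axis 2 1) + DA (axis 2 1) \<times> \<beta> p) $ 2 = dw 2 3 1 - dw 2 1 3"
    "(\<alpha> p \<times> DB (axis 3 1) + DA (axis 3 1) \<times> \<beta> p) $ 3 = dw 3 1 2 - dw 3 2 1"
    by (rule comp, simp add: K)+
  then show ?thesis
    using sym[of 1 2 3] sym[of 1 3 2] sym[of 2 3 1]
    by (simp add: DA(2) DB(2) curl_of_def cross3_def inner_vec_def sum_3 algebra_simps)
qed

text \<open>Differentiating the relation \<alpha> \<and> \<beta> = 0; the zero form serves as
  primitive.\<close>

lemma cross_product_eq_0_curl:
  assumes "open W" "\<And>q. q \<in> W \<Longrightarrow> \<alpha> q \<times> \<beta> q = 0" "p \<in> W" "has_curl \<alpha> A p" "has_curl \<beta> B p"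
  shows "A \<bullet> \<beta> p = \<alpha> p \<bullet> B"
  by (rule exact_cross_product[OF assms(1) Ck_on_const _ assms(3-5), of 0])
     (use has_curl_const assms(2) in auto)

section \<open>Coordinate systems on open subsets of 3-space\<close>

lemma continuous_antiderivative:
  fixes H :: "real \<Rightarrow> real"
  assumes "continuous_on UNIV H"
  obtains F where "\<And>x. (F has_real_derivative H x) (at x)"
proof -
  have "\<exists>F. \<forall>x::real. -\<infinity> < ereal x \<longrightarrow> ereal x < \<infinity> \<longrightarrow> (F has_vector_derivative H x) (at x)"
    using assms by (intro einterval_antiderivative) (auto simp: continuous_on_eq_continuous_at)
  then show thesis
    using that by (auto simp: has_real_derivative_iff_has_vector_derivative)
qed

text \<open>For \<open>k = 0\<close> extend by constants; then integrate \<open>k\<close> times.\<close>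
lemma Ck_extension:
  fixes f :: "real \<Rightarrow> real"
  assumes "Ck_on k {a<..<b} f" "a < a'" "a' \<le> b'" "b' < b"
  shows "\<exists>F. Ck_on k UNIV F \<and> (\<forall>x\<in>{a'..b'}. F x = f x)"
  using assms(1)
proof (induction k arbitrary: f)
  case 0
  define F where "F x = f (max a' (min b' x))" for x
  have "continuous_on UNIV F"
    unfolding F_def
    by (rule continuous_on_compose2[where s = UNIV and t = "{a<..<b}"])
       (use 0 assms in \<open>auto intro!: continuous_intros\<close>)
  moreover have "\<forall>x\<in>{a'..b'}. F x = f x"
    by (auto simp: F_def max_def min_def)
  ultimately show ?case by auto
next
  case (Suc k)
  note f' = Ck_on_deriv[OF open_greaterThanLessThan Suc.prems]
  obtain H where H: "Ck_on k UNIV H" "\<And>x. x \<in> {a'..b'} \<Longrightarrow> H x = deriv f x"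
    using Suc.IH[OF f'(1)] by blast
  obtain F where F: "\<And>x. (F has_real_derivative H x) (at x)"
    using continuous_antiderivative[OF Ck_on_imp_continuous[OF H(1)]] by blast
  have "((\<lambda>x. F x - f x) has_field_derivative 0) (at x within {a'..b'})" if x: "x \<in> {a'..b'}" for x
  proof -
    have "(F has_real_derivative deriv f x) (at x)" "(f has_real_derivative deriv f x) (at x)"
      using F[of x] H(2)[OF x] f'(2)[of x] x assms by auto
    from DERIV_diff[OF this] show ?thesis by (simp add: has_field_derivative_at_within)
  qed
  then obtain c where c: "\<And>x. x \<in> {a'..b'} \<Longrightarrow> F x - f x = c"
    using has_field_derivative_zero_constant[of "{a'..b'}" "\<lambda>x. F x - f x"] by auto
  have "((\<lambda>x. F x - c) has_real_derivative H x) (at x)" for x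
    using DERIV_diff[OF F[of x] DERIV_const[of c]] by simp
  then have "Ck_on (Suc k) UNIV (\<lambda>x. F x - c)"
    by (intro Ck_on_real_SucI[of _ _ H] H) auto
  moreover have "\<forall>x\<in>{a'..b'}. F x - c = f x" using c by (auto simp: algebra_simps)
  ultimately show ?case by blast
qed

section \<open>Coordinates with nonvanishing Jacobian\<close>

definition coords :: "('m \<Rightarrow> real) \<Rightarrow> ('m \<Rightarrow> real) \<Rightarrow> ('m \<Rightarrow> real) \<Rightarrow> 'm \<Rightarrow> real^3" where
  "coords x y z p = vector [x p, y p, z p]"

definition jacobian :: "(real^3 \<Rightarrow> real) \<Rightarrow> (real^3 \<Rightarrow> real) \<Rightarrow> (real^3 \<Rightarrow> real) \<Rightarrow> real^3 \<Rightarrow> real" where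
  "jacobian x y z p = grad x p \<bullet> (grad y p \<times> grad z p)"

text \<open>Cramer's rule: divided by the Jacobian, the three cross products form the basis dual to
  the gradients.\<close>

definition coords_inverse_deriv ::
    "(real^3 \<Rightarrow> real) \<Rightarrow> (real^3 \<Rightarrow> real) \<Rightarrow> (real^3 \<Rightarrow> real) \<Rightarrow> real^3 \<Rightarrow> real^3 \<Rightarrow> real^3" where
  "coords_inverse_deriv x y z p v = inverse (jacobian x y z p) *\<^sub>R
     (v $ 1 *\<^sub>R (grad y p \<times> grad z p) + v $ 2 *\<^sub>R (grad z p \<times> grad x p) + v $ 3 *\<^sub>R (grad x p \<times> grad y p))"

lemma has_derivative_vector_3:
  assumes "(f has_derivative f') F" "(g has_derivative g') F" "(h has_derivative h') F"
  shows "((\<lambda>p. vector [f p, g p, h p] :: real^3) has_derivative (\<lambda>v. vector [f' v, g' v, h' v])) F"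
proof -
  have *: "vector [a, b, c] = a *\<^sub>R axis 1 1 + b *\<^sub>R axis 2 1 + c *\<^sub>R (axis 3 1 :: real^3)" for a b c :: real
    by (simp add: vec_eq_iff forall_3 axis_def)
  show ?thesis unfolding * using assms by (intro has_derivative_add has_derivative_scaleR_left)
qed

lemma triple_product_dual_basis:
  fixes X Y Z v :: "real^3"
  assumes "X \<bullet> (Y \<times> Z) \<noteq> 0"
  shows "inverse (X \<bullet> (Y \<times> Z)) *\<^sub>R ((X \<bullet> v) *\<^sub>R (Y \<times> Z) + (Y \<bullet> v) *\<^sub>R (Z \<times> X) + (Z \<bullet> v) *\<^sub>R (X \<times> Y)) = v"
proof -
  have "(X \<bullet> v) *\<^sub>R (Y \<times> Z) + (Y \<bullet> v) *\<^sub>R (Z \<times> X) + (Z \<bullet> v) *\<^sub>R (X \<times> Y) = (X \<bullet> (Y \<times> Z)) *\<^sub>R v"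
    by (simp add: cross3_def inner_vec_def sum_3 vec_eq_iff forall_3 algebra_simps)
  then show ?thesis using assms by simp
qed

lemma cross_triple_dots:
  fixes X Y Z :: "real^3"
  shows "X \<bullet> (Z \<times> X) = 0" "X \<bullet> (X \<times> Y) = 0" "Y \<bullet> (Y \<times> Z) = 0" "Y \<bullet> (X \<times> Y) = 0"
    "Z \<bullet> (Y \<times> Z) = 0" "Z \<bullet> (Z \<times> X) = 0" "Y \<bullet> (Z \<times> X) = X \<bullet> (Y \<times> Z)" "Z \<bullet> (X \<times> Y) = X \<bullet> (Y \<times> Z)"
  by (simp_all add: cross3_def inner_vec_def sum_3 algebra_simps)

locale coordinate_triple =
  fixes V :: "(real^3) set" and x y z :: "real^3 \<Rightarrow> real"
  assumes V: "open V"
    and smooth: "\<And>n. Ck_on n V x" "\<And>n. Ck_on n V y" "\<And>n. Ck_on n V z"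
    and nondegenerate: "\<And>p. p \<in> V \<Longrightarrow> jacobian x y z p \<noteq> 0"
begin

abbreviation F where "F \<equiv> coords x y z"

abbreviation F_deriv where "F_deriv p v \<equiv> (vector [grad x p \<bullet> v, grad y p \<bullet> v, grad z p \<bullet> v] :: real^3)"

lemma GDERIV_coords:
  assumes "p \<in> V"
  shows "GDERIV x p :> grad x p" "GDERIV y p :> grad y p" "GDERIV z p :> grad z p"
  using smooth[of "Suc 0"] assms by (auto intro!: differentiable_GDERIV)

lemma has_derivative_coords: "p \<in> V \<Longrightarrow> (F has_derivative F_deriv p) (at p)"
  using GDERIV_coords[of p] unfolding coords_def[abs_def] gderiv_def
  by (intro has_derivative_vector_3) (simp_all add: inner_commute)

lemma Ck_on_coords: "Ck_on n V F"
  unfolding coords_def[abs_def] by (intro Ck_on_vector_3 V smooth)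

lemma coords_inverse_deriv:
  assumes "p \<in> V"
  shows "F_deriv p (coords_inverse_deriv x y z p v) = v"
    "coords_inverse_deriv x y z p (F_deriv p v) = v"
proof -
  show "F_deriv p (coords_inverse_deriv x y z p v) = v"
    using nondegenerate[OF assms] unfolding coords_inverse_deriv_def jacobian_def
    by (simp add: vec_eq_iff forall_3 inner_add_right cross_triple_dots)
  show "coords_inverse_deriv x y z p (F_deriv p v) = v"
    using triple_product_dual_basis[of "grad x p" "grad y p" "grad z p" v] nondegenerate[OF assms]
    by (simp add: coords_inverse_deriv_def jacobian_def)
qed

lemma bounded_linear_F_deriv: "bounded_linear (F_deriv p)"
  unfolding linear_conv_bounded_linear[symmetric]
  by (rule linearI) (simp_all add: vec_eq_iff forall_3 inner_add_right)

lemma bounded_linear_coords_inverse_deriv: "bounded_linear (coords_inverse_deriv x y z p)"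
  unfolding linear_conv_bounded_linear[symmetric] coords_inverse_deriv_def
  by (rule linearI) (simp_all add: algebra_simps)

lemma Ck_on_grads: "Ck_on n V (grad x)" "Ck_on n V (grad y)" "Ck_on n V (grad z)"
  by (intro Ck_on_grad V smooth)+

text \<open>From the inverse function theorem only injectivity is kept; the smoothness of the
  inverse is recovered in \<open>Ck_on_G\<close>.\<close>

lemma locally_injective:
  assumes p: "p \<in> V"
  obtains V' where "open V'" "p \<in> V'" "V' \<subseteq> V" "inj_on F V'"
proof -
  define f' where "f' q = Blinfun (F_deriv q)" for q
  have f'_apply: "blinfun_apply (f' q) = F_deriv q" for q
    unfolding f'_def by (rule bounded_linear_Blinfun_apply[OF bounded_linear_F_deriv])
  have "continuous_on V (\<lambda>q. F_deriv q v)" for v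
    by (rule Ck_on_imp_continuous[of 0]) (intro Ck_on_vector_3 Ck_on_inner Ck_on_grads Ck_on_const V)
  then have cont: "continuous_on V f'"
    by (intro continuous_on_blinfun_componentwise) (simp add: f'_apply)
  define invf where "invf = Blinfun (coords_inverse_deriv x y z p)"
  have invf: "invf o\<^sub>L f' p = id_blinfun"
    by (rule blinfun_eqI) (simp add: f'_apply invf_def bounded_linear_Blinfun_apply
        bounded_linear_coords_inverse_deriv coords_inverse_deriv(2)[OF p])
  have derF: "(F has_derivative blinfun_apply (f' q)) (at q)" if "q \<in> V" for q
    using has_derivative_coords[OF that] by (simp add: f'_apply)
  obtain U' V2 g where U': "open U'" "U' \<subseteq> V" "p \<in> U'" and hom: "homeomorphism U' V2 F g"
    by (rule inverse_function_theorem[OF V derF cont p invf])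
  have "inj_on F U'"
    using hom by (intro inj_on_inverseI[of _ g]) (rule homeomorphism_apply1)
  with U' show thesis
    using that by blast
qed

end

locale coordinate_chart = coordinate_triple +
  assumes inj: "inj_on (coords x y z) V"
begin

abbreviation G where "G \<equiv> inv_into V F"

lemma G_F: "p \<in> V \<Longrightarrow> G (F p) = p"
  by (simp add: inj)

lemma F_G: "u \<in> F ` V \<Longrightarrow> F (G u) = u"
  by (rule f_inv_into_f)

lemma G_mem: "u \<in> F ` V \<Longrightarrow> G u \<in> V"
  by (rule inv_into_into)

lemma open_image: "open (F ` V)"
  using Ck_on_imp_continuous[OF Ck_on_coords] inj V by (intro invariance_of_domain)

lemma has_derivative_G:
  assumes "u \<in> F ` V"
  shows "(G has_derivative coords_inverse_deriv x y z (G u)) (at u)"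
proof -
  have "(G has_derivative coords_inverse_deriv x y z (G u)) (at (F (G u)))"
    by (rule has_derivative_inverse_strong[OF V G_mem[OF assms] Ck_on_imp_continuous[OF Ck_on_coords] G_F
          has_derivative_coords[OF G_mem[OF assms]]])
       (use coords_inverse_deriv(1)[OF G_mem[OF assms]] in \<open>auto simp: fun_eq_iff\<close>)
  then show ?thesis by (simp add: F_G assms)
qed

text \<open>Bootstrapping: the derivative of \<open>G\<close> at u is a smooth expression evaluated
  at \<open>G u\<close>, so each order of \<open>G\<close> yields the next.\<close>

lemma Ck_on_G: "Ck_on n (F ` V) G"
proof (induction n)
  case 0
  then show ?case
    by (auto intro!: continuous_at_imp_continuous_on has_derivative_continuous[OF has_derivative_G])
next
  case (Suc n)
  show ?case
  proof (rule Ck_on_SucI[OF open_image has_derivative_G])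
    have "Ck_on n V (\<lambda>p. coords_inverse_deriv x y z p v)" for v
      unfolding coords_inverse_deriv_def jacobian_def
      using nondegenerate by (intro Ck_on_intros V Ck_on_grads) (auto simp: jacobian_def)
    from Ck_on_compose[OF open_image V Suc this]
    show "Ck_on n (F ` V) (\<lambda>u. coords_inverse_deriv x y z (G u) v)" for v
      using G_mem by blast
  qed
qed

lemma restrict_to_ball:
  assumes "p \<in> V" "r > 0" "ball (F p) r \<subseteq> F ` V"
  defines "V' \<equiv> V \<inter> F -` ball (F p) r"
  shows "coordinate_chart V' x y z" "p \<in> V'" "V' \<subseteq> V" "F ` V' = ball (F p) r"
proof -
  have V'V: "V' \<subseteq> V" by (auto simp: V'_def)
  have "open V'"
    unfolding V'_def using continuous_open_preimage[OF Ck_on_imp_continuous[OF Ck_on_coords] V open_ball] .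
  then show "coordinate_chart V' x y z"
    using V'V nondegenerate inj
    by unfold_locales (auto intro: Ck_on_subset[OF smooth(1)] Ck_on_subset[OF smooth(2)]
        Ck_on_subset[OF smooth(3)] inj_on_subset)
  show "p \<in> V'" "V' \<subseteq> V" using assms V'V by (auto simp: V'_def)
  show "F ` V' = ball (F p) r"
    using assms(3) by (fastforce simp: V'_def)
qed

text \<open>Along the fibres of \<open>x\<close> inside a coordinate ball, which are convex, \<open>h\<close> is constant.\<close>
lemma function_of_first_coordinate:
  assumes ball: "F ` V = ball u0 r" and r: "r > 0"
    and h: "\<And>n. Ck_on n V h" and par: "\<And>p. p \<in> V \<Longrightarrow> grad h p \<times> grad x p = 0"
  shows "\<exists>\<phi>. (\<forall>n. Ck_on n {u0$1 - r <..< u0$1 + r} \<phi>) \<and> (\<forall>p\<in>V. h p = \<phi> (x p))"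
proof -
  define s :: "real \<Rightarrow> real^3" where "s t = vector [t, u0$2, u0$3]" for t
  have norm_s: "dist u0 (s t) = \<bar>u0$1 - t\<bar>" for t
    by (simp add: dist_norm norm_eq_sqrt_inner s_def inner_vec_def sum_3 real_sqrt_abs2)
  have s_mem: "s t \<in> F ` V" if "t \<in> {u0$1 - r <..< u0$1 + r}" for t
    using that by (auto simp: ball norm_s)
  define \<phi> where "\<phi> t = h (G (s t))" for t
  have "Ck_on n {u0$1 - r <..< u0$1 + r} \<phi>" for n
  proof -
    have hG: "Ck_on n (F ` V) (\<lambda>u. h (G u))"
      using G_mem by (intro Ck_on_compose[OF open_image V Ck_on_G h]) auto
    have s: "Ck_on n {u0$1 - r <..< u0$1 + r} s"
      unfolding s_def[abs_def]
      by (intro Ck_on_vector_3 Ck_on_const open_greaterThanLessThan Ck_on_linear bounded_linear_ident)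
    show ?thesis
      unfolding \<phi>_def[abs_def] using s_mem
      by (intro Ck_on_compose[OF open_greaterThanLessThan open_image s hG]) auto
  qed
  moreover have "h p = \<phi> (x p)" if p: "p \<in> V" for p
  proof -
    define u where "u = F p"
    have u: "u \<in> ball u0 r" using p ball by (auto simp: u_def)
    have x: "u $ 1 = x p" by (simp add: u_def coords_def)
    have "\<bar>u0$1 - x p\<bar> \<le> dist u0 u"
      using component_le_norm_cart[of "u0 - u" 1] by (simp add: dist_norm x)
    then have sx: "s (x p) \<in> ball u0 r" using u by (auto simp: norm_s)
    define v where "v = u - s (x p)"
    define k where "k t = h (G (s (x p) + t *\<^sub>R v))" for t
    have "(k has_field_derivative 0) (at t within {0..1})" if t: "t \<in> {0..1}" for t
    proof -
      define w where "w = s (x p) + t *\<^sub>R v"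
      have "w = (1 - t) *\<^sub>R s (x p) + t *\<^sub>R u" by (simp add: w_def v_def algebra_simps)
      then have w: "w \<in> F ` V"
        using convexD[OF convex_ball sx u, of "1 - t" t] t by (simp add: ball)
      note q = G_mem[OF w]
      have "GDERIV h (G w) :> grad h (G w)"
        using h[of "Suc 0"] q by (auto intro!: differentiable_GDERIV)
      then have "(h has_derivative (\<lambda>v. v \<bullet> grad h (G w))) (at (G w))" by (simp add: gderiv_def)
      from has_derivative_compose[OF has_derivative_G[OF w] this]
      have hG: "((\<lambda>w. h (G w)) has_derivative (\<lambda>v. coords_inverse_deriv x y z (G w) v \<bullet> grad h (G w))) (at w)" .
      have line: "((\<lambda>t. s (x p) + t *\<^sub>R v) has_derivative (\<lambda>t. t *\<^sub>R v)) (at t)"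
        by (auto intro!: derivative_eq_intros)
      have "(k has_derivative (\<lambda>t. coords_inverse_deriv x y z (G w) (t *\<^sub>R v) \<bullet> grad h (G w))) (at t)"
        unfolding k_def[abs_def] by (rule has_derivative_compose[OF line hG[unfolded w_def], folded w_def])
      \<comment> \<open>The segment has constant first coordinate, so its preimage moves along
        combinations of grad z \<times> grad x and grad x \<times> grad y. Both are orthogonal to
        grad x, hence to grad h.\<close>
      moreover have "coords_inverse_deriv x y z (G w) (t *\<^sub>R v) \<bullet> grad h (G w) = 0" for t
      proof -
        have "v $ 1 = 0" by (simp add: v_def x s_def)
        moreover have "(grad z (G w) \<times> grad x (G w)) \<bullet> grad h (G w) = - (grad z (G w) \<bullet> (grad h (G w) \<times> grad x (G w)))"
          "(grad x (G w) \<times> grad y (G w)) \<bullet> grad h (G w) = grad y (G w) \<bullet> (grad h (G w) \<times> grad x (G w))"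
          by (simp_all add: cross3_def inner_vec_def sum_3 algebra_simps)
        ultimately show ?thesis
          using par[OF q] by (simp add: coords_inverse_deriv_def inner_add_left)
      qed
      ultimately have "(k has_derivative (\<lambda>t. 0)) (at t)" by simp
      then show ?thesis
        by (simp add: has_field_derivative_def has_derivative_at_withinI lambda_zero)
    qed
    then obtain c where "\<And>t. t \<in> {0..1} \<Longrightarrow> k t = c"
      using has_field_derivative_zero_constant[of "{0..1}" k] by auto
    then have "k 0 = k 1" by simp
    then show ?thesis
      by (simp add: k_def v_def \<phi>_def u_def G_F[OF p])
  qed
  ultimately show ?thesis by blast
qed

text \<open>Halving the radius leaves a closed interval inside the domain of \<open>\<phi>\<close>,
  as the extension requires. On the line \<open>f\<close> is only known to have class C^k, but over
  \<open>V'\<close> it agrees with the smooth \<open>\<phi>\<close>; hence \<open>deriv f\<close>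
  composed with x is smooth there, which the second integration needs.\<close>

lemma extended_function_of_first_coordinate:
  assumes p: "p \<in> V" and ball: "F ` V = ball (F p) r" and r: "r > 0"
    and h: "\<And>n. Ck_on n V h" and par: "\<And>q. q \<in> V \<Longrightarrow> grad h q \<times> grad x q = 0"
  shows "\<exists>f V'. coordinate_chart V' x y z \<and> p \<in> V' \<and> V' \<subseteq> V \<and> F ` V' = ball (F p) (r / 2) \<and>
    Ck_on k UNIV f \<and> (\<forall>q\<in>V'. h q = f (x q)) \<and> (\<forall>n. Ck_on n V' (\<lambda>q. deriv f (x q)))"
proof -
  define u where "u = F p $ 1"
  have u: "u = x p" by (simp add: u_def coords_def)
  obtain \<phi> where \<phi>: "\<And>n. Ck_on n {u - r <..< u + r} \<phi>" "\<And>q. q \<in> V \<Longrightarrow> h q = \<phi> (x q)"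
    using function_of_first_coordinate[OF ball r h par] unfolding u_def by blast
  obtain f where f: "Ck_on k UNIV f" "\<And>t. t \<in> {u - r / 2 .. u + r / 2} \<Longrightarrow> f t = \<phi> t"
    using Ck_extension[OF \<phi>(1), of "u - r / 2" "u + r / 2" k] r by auto
  define V' where "V' = V \<inter> F -` ball (F p) (r / 2)"
  have V': "coordinate_chart V' x y z" "p \<in> V'" "V' \<subseteq> V" "F ` V' = ball (F p) (r / 2)"
    using restrict_to_ball[OF p, of "r / 2"] r ball subset_ball[of "r / 2" r "F p"] unfolding V'_def by simp_all
  have xV': "x q \<in> {u - r / 2 <..< u + r / 2}" if "q \<in> V'" for q
  proof -
    have "\<bar>u - x q\<bar> \<le> dist (F p) (F q)"
      using component_le_norm_cart[of "F p - F q" 1] by (simp add: dist_norm u coords_def)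
    also have "\<dots> < r / 2" using that V'(4) by auto
    finally show ?thesis unfolding greaterThanLessThan_iff by linarith
  qed
  have deriv_f: "deriv f t = deriv \<phi> t" if "t \<in> {u - r / 2 <..< u + r / 2}" for t
    by (rule deriv_cong_ev)
       (use that f(2) in \<open>auto intro!: eventually_nhds_in_open[THEN eventually_mono, of "{u - r / 2 <..< u + r / 2}"]\<close>)
  have "Ck_on n V' (\<lambda>q. deriv f (x q))" for n
  proof -
    have "open V'" using V'(1) by (simp add: coordinate_chart_def coordinate_triple_def)
    have "Ck_on n {u - r <..< u + r} (deriv \<phi>)"
      by (rule Ck_on_deriv(1)[OF _ \<phi>(1)]) simp
    moreover have "x ` V' \<subseteq> {u - r <..< u + r}" using xV' r by fastforce
    ultimately have "Ck_on n V' (\<lambda>q. deriv \<phi> (x q))"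
      by (intro Ck_on_compose[OF \<open>open V'\<close> open_greaterThanLessThan Ck_on_subset[OF smooth(1) V'(3)]])
    then show ?thesis
      using Ck_on_cong[OF \<open>open V'\<close>, of "\<lambda>q. deriv f (x q)" "\<lambda>q. deriv \<phi> (x q)"] deriv_f xV' by simp
  qed
  moreover have "h q = f (x q)" if "q \<in> V'" for q
    using \<phi>(2)[of q] f(2)[of "x q"] xV'[OF that] V'(3) that by auto
  ultimately show ?thesis using V' f(1) by blast
qed

end

section \<open>The structure equations in a chart\<close>

text \<open>The vectors u, v, w form a basis, and g \<times> w is orthogonal to each of
  them.\<close>

lemma cross_eq_0_if_triples:
  fixes u v w g :: "real^3"
  assumes "(u \<times> v) \<bullet> w \<noteq> 0" "(g \<times> u) \<bullet> w = 0" "(g \<times> v) \<bullet> w = 0"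
  shows "g \<times> w = 0"
proof -
  define k where "k = g \<times> w"
  have tr: "u \<bullet> (v \<times> w) = (u \<times> v) \<bullet> w"
    by (simp add: cross3_def inner_vec_def sum_3 algebra_simps)
  have "u \<bullet> k = - ((g \<times> u) \<bullet> w)" "v \<bullet> k = - ((g \<times> v) \<bullet> w)" "w \<bullet> k = 0"
    by (simp_all add: k_def cross3_def inner_vec_def sum_3 algebra_simps)
  then have "u \<bullet> k = 0" "v \<bullet> k = 0" "w \<bullet> k = 0" using assms by simp_all
  then have "k = 0"
    using triple_product_dual_basis[of u v w k] assms(1) tr by simp
  then show ?thesis by (simp add: k_def)
qed

lemma frame_expansion:
  fixes u v w g :: "real^3"
  assumes "(u \<times> v) \<bullet> w \<noteq> 0"
  shows "g = ((g \<times> v) \<bullet> w / ((u \<times> v) \<bullet> w)) *\<^sub>R u - ((g \<times> u) \<bullet> w / ((u \<times> v) \<bullet> w)) *\<^sub>R v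
           + (g \<bullet> (u \<times> v) / ((u \<times> v) \<bullet> w)) *\<^sub>R w"
proof -
  have "((u \<times> v) \<bullet> w) *\<^sub>R g = ((g \<times> v) \<bullet> w) *\<^sub>R u - ((g \<times> u) \<bullet> w) *\<^sub>R v + (g \<bullet> (u \<times> v)) *\<^sub>R w"
    by (simp add: cross3_def inner_vec_def sum_3 vec_eq_iff forall_3 algebra_simps)
  then have "g = inverse ((u \<times> v) \<bullet> w) *\<^sub>R (((g \<times> v) \<bullet> w) *\<^sub>R u - ((g \<times> u) \<bullet> w) *\<^sub>R v + (g \<bullet> (u \<times> v)) *\<^sub>R w)"
    using assms by (metis scaleR_scaleR left_inverse scaleR_one)
  then show ?thesis by (simp add: algebra_simps divide_inverse)
qed

lemma parallel_expansion:
  fixes u v w g :: "real^3"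
  assumes "(u \<times> v) \<bullet> w \<noteq> 0" "g \<times> w = 0"
  shows "g = (g \<bullet> (u \<times> v) / ((u \<times> v) \<bullet> w)) *\<^sub>R w"
proof -
  have "(g \<times> v) \<bullet> w = - ((g \<times> w) \<bullet> v)" "(g \<times> u) \<bullet> w = - ((g \<times> w) \<bullet> u)"
    by (simp_all add: cross3_def inner_vec_def sum_3 algebra_simps)
  then show ?thesis using frame_expansion[OF assms(1), of g] assms(2) by simp
qed

text \<open>\<open>kfun\<close> is \<open>csc (2x)\<close> for \<open>\<epsilon> = 1\<close> and \<open>- cot (2x)\<close> for \<open>\<epsilon> = -1\<close>. It allows both cases of the
  normal form to be treated by one computation, with \<open>A\<^sub>3 = y f(x) + kfun x\<close>.\<close>
definition kfun :: "real \<Rightarrow> real \<Rightarrow> real" where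
  "kfun \<epsilon> t = ((sin t)^2 + \<epsilon> * (cos t)^2) / (2 * sin t * cos t)"

text \<open>The quotient rule for \<open>kfun\<close>, with the old numerator absorbed into
  \<open>kfun\<close> itself.\<close>

definition kder :: "real \<Rightarrow> real \<Rightarrow> real" where
  "kder \<epsilon> t = 1 - \<epsilon> - kfun \<epsilon> t * ((cos t)^2 - (sin t)^2) / (sin t * cos t)"

lemma DERIV_kfun:
  assumes "sin t \<noteq> 0" "cos t \<noteq> 0"
  shows "(kfun \<epsilon> has_real_derivative kder \<epsilon> t) (at t)"
  unfolding kfun_def[abs_def] kder_def using assms
  by (auto intro!: derivative_eq_intros simp: field_simps power2_eq_square power4_eq_xxxx)

lemma kfun_cases:
  assumes "sin t \<noteq> 0" "cos t \<noteq> 0"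
  shows "kfun 1 t = csc (2 * t)" "kfun (-1) t = - cot (2 * t)"
    "kder 1 t = - 2 * csc (2 * t) * cot (2 * t)" "kder (-1) t = 2 * (csc (2 * t))\<^sup>2"
proof -
  define s where "s = sin t" define c where "c = cos t"
  have sc: "s^2 + c^2 = 1" by (simp add: s_def c_def)
  have k1: "kfun 1 t = 1 / (2 * s * c)" unfolding kfun_def s_def c_def by simp
  have k2: "kfun (-1) t = - ((c^2 - s^2) / (2 * s * c))"
    unfolding kfun_def s_def c_def using assms by (simp add: field_simps)
  have d: "csc (2 * t) = 1 / (2 * s * c)" "cot (2 * t) = (c^2 - s^2) / (2 * s * c)"
    by (simp_all add: csc_def cot_def sin_double cos_double s_def c_def)
  show "kfun 1 t = csc (2 * t)" "kfun (-1) t = - cot (2 * t)" using k1 k2 d by simp_all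
  show "kder 1 t = - 2 * csc (2 * t) * cot (2 * t)"
    unfolding kder_def k1 d s_def[symmetric] c_def[symmetric]
    using assms by (simp add: s_def c_def field_simps)
  have nz: "s \<noteq> 0" "c \<noteq> 0" using assms by (auto simp: s_def c_def)
  have "4 * s^2 * c^2 + (c^2 - s^2)^2 = 1" using sc by algebra
  then have "2 + (c^2 - s^2)^2 / (2 * s^2 * c^2) = 1 / (2 * s^2 * c^2)"
    using nz by (simp add: field_simps)
  then show "kder (-1) t = 2 * (csc (2 * t))\<^sup>2"
    unfolding kder_def k2 d s_def[symmetric] c_def[symmetric]
    by (simp add: power2_eq_square mult_ac)
qed

text \<open>The factor of y unites both cases: it is 2 csc (2x) (f - 2 cot (2x)) for \<epsilon> = 1
  and 2 + 4 (csc (2x))^2 - 2 cot (2x) f for \<epsilon> = -1. It returns later as \<open>m\<close>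
  and as \<open>M\<close>.\<close>

lemma N1_kfun:
  assumes "\<epsilon> = 1 \<or> \<epsilon> = -1" "sin x \<noteq> 0" "cos x \<noteq> 0"
  shows "N1 \<epsilon> f g x y z = y^2 * g x + y * (2 * kder \<epsilon> x + (1 - \<epsilon>) + 2 * kfun \<epsilon> x * f x)
    - ((f x)^2 + deriv f x + 1) * y^2 * ln \<bar>y\<bar> - z * f x"
  using assms kfun_cases[OF assms(2,3)] by (auto simp: N1_def algebra_simps power2_eq_square)

lemma N2_kfun:
  assumes "\<epsilon> = 1 \<or> \<epsilon> = -1" "sin x \<noteq> 0" "cos x \<noteq> 0" "y \<noteq> 0"
  shows "N2 \<epsilon> f x y z = 2 * z / y - y * f x - 2 * kfun \<epsilon> x"
  using assms kfun_cases[OF assms(2,3)] by (auto simp: N2_def field_simps power2_eq_square)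

lemma GDERIV_divide:
  fixes f g :: "'a::real_inner \<Rightarrow> real"
  assumes "GDERIV f p :> F" "GDERIV g p :> G" "g p \<noteq> 0"
  shows "GDERIV (\<lambda>q. f q / g q) p :> (1 / g p) *\<^sub>R F - (f p / (g p)^2) *\<^sub>R G"
  using GDERIV_mult[OF assms(1) GDERIV_inverse[OF assms(2,3)]]
  by (simp add: divide_inverse power2_eq_square algebra_simps)

text \<open>One chart with A1 = A2 = 0 and \<delta> absorbed into x; \<open>A\<close> is A3. All
  three exterior derivatives are then products with w3, the form in which
  \<open>exact_cross_product\<close> applies. The conditions on y and z express differentiation
  along e3, which is w1 \<times> w2 divided by the triple product.\<close>

locale local_coframing =
  fixes \<epsilon> :: real and W :: "(real^3) set" and w1 w2 w3 :: "real^3 \<Rightarrow> real^3"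
    and A x y z C C3 :: "real^3 \<Rightarrow> real"
  assumes eps: "\<epsilon> = 1 \<or> \<epsilon> = -1"
    and W: "open W"
    and smooth_w: "\<And>n. Ck_on n W w1" "\<And>n. Ck_on n W w2" "\<And>n. Ck_on n W w3"
    and smooth_fun: "\<And>n. Ck_on n W A" "\<And>n. Ck_on n W x" "\<And>n. Ck_on n W C"
    and T_nz: "\<And>q. q \<in> W \<Longrightarrow> (w1 q \<times> w2 q) \<bullet> w3 q \<noteq> 0"
    and curl_w1: "\<And>q. q \<in> W \<Longrightarrow> has_curl w1 (((A q - C q) *\<^sub>R w1 q + w2 q) \<times> w3 q) q"
    and curl_w2: "\<And>q. q \<in> W \<Longrightarrow> has_curl w2 ((\<epsilon> *\<^sub>R w1 q + (A q + C q) *\<^sub>R w2 q) \<times> w3 q) q"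
    and curl_w3: "\<And>q. q \<in> W \<Longrightarrow> has_curl w3 ((sin (x q) *\<^sub>R w1 q + cos (x q) *\<^sub>R w2 q) \<times> w3 q) q"
    and GDERIV_C: "\<And>q. q \<in> W \<Longrightarrow> GDERIV C q :> C3 q *\<^sub>R w3 q"
    and C3_nz: "\<And>q. q \<in> W \<Longrightarrow> C3 q \<noteq> 0"
    and sin_nz: "\<And>q. q \<in> W \<Longrightarrow> sin (x q) \<noteq> 0" and cos_nz: "\<And>q. q \<in> W \<Longrightarrow> cos (x q) \<noteq> 0"
    and y_def: "\<And>q. q \<in> W \<Longrightarrow> y q = grad x q \<bullet> (w1 q \<times> w2 q) / ((w1 q \<times> w2 q) \<bullet> w3 q)"
    and z_def: "\<And>q. q \<in> W \<Longrightarrow> z q = grad y q \<bullet> (w1 q \<times> w2 q) / ((w1 q \<times> w2 q) \<bullet> w3 q)"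
begin

text \<open>\<open>n1\<close> and \<open>n2\<close> are \<open>\<eta>\<^sup>1\<close> and \<open>\<eta>\<^sup>2\<close>.\<close>
definition n1 where "n1 q = cos (x q) *\<^sub>R w1 q - sin (x q) *\<^sub>R w2 q"
definition n2 where "n2 q = sin (x q) *\<^sub>R w1 q + cos (x q) *\<^sub>R w2 q"
definition T where "T q = (w1 q \<times> w2 q) \<bullet> w3 q"

lemma T: "q \<in> W \<Longrightarrow> T q \<noteq> 0" using T_nz by (simp add: T_def)

lemma w_eq: "w1 q = cos (x q) *\<^sub>R n1 q + sin (x q) *\<^sub>R n2 q" "w2 q = - sin (x q) *\<^sub>R n1 q + cos (x q) *\<^sub>R n2 q"
proof -
  have "cos (x q) * cos (x q) + sin (x q) * sin (x q) = 1"
    by (metis sin_cos_squared_add3)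
  then have *: "(cos (x q) * cos (x q)) *\<^sub>R v + (sin (x q) * sin (x q)) *\<^sub>R v = v" for v :: "real^3"
    by (metis scaleR_add_left scaleR_one)
  show "w1 q = cos (x q) *\<^sub>R n1 q + sin (x q) *\<^sub>R n2 q" "w2 q = - sin (x q) *\<^sub>R n1 q + cos (x q) *\<^sub>R n2 q"
    using *[of "w1 q"] *[of "w2 q"] by (simp_all add: n1_def n2_def algebra_simps)
qed

lemma n1_cross_n2: "n1 q \<times> n2 q = w1 q \<times> w2 q"
proof -
  have "(c *\<^sub>R u - s *\<^sub>R v) \<times> (s *\<^sub>R u + c *\<^sub>R v) = (s\<^sup>2 + c\<^sup>2) *\<^sub>R (u \<times> v)" for s c and u v :: "real^3"
    by (simp add: cross3_def vec_eq_iff forall_3 algebra_simps power2_eq_square)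
  then show ?thesis by (simp add: n1_def n2_def)
qed

lemma triple_simps:
  "(w2 q \<times> w1 q) \<bullet> w3 q = - T q" "(w1 q \<times> w2 q) \<bullet> w3 q = T q"
  "(w3 q \<times> v) \<bullet> w3 q = 0" "(v \<times> w3 q) \<bullet> w3 q = 0"
  "w1 q \<bullet> (w1 q \<times> v) = 0" "w2 q \<bullet> (w2 q \<times> v) = 0"
  "w1 q \<bullet> (w2 q \<times> w3 q) = T q" "w2 q \<bullet> (w1 q \<times> w3 q) = - T q"
  "(n1 q \<times> n2 q) \<bullet> w3 q = T q" "(n2 q \<times> n1 q) \<bullet> w3 q = - T q"
  "v \<bullet> (v \<times> w3 q) = 0"
proof -
  show "(n1 q \<times> n2 q) \<bullet> w3 q = T q" "(n2 q \<times> n1 q) \<bullet> w3 q = - T q"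
    using cross_skew[of "n2 q" "n1 q"] by (simp_all only: n1_cross_n2 T_def inner_minus_left)
qed (simp_all add: T_def cross3_def inner_vec_def sum_3 algebra_simps)

lemmas tp_simps = triple_simps cross_add_left cross_add_right Cross3.left_diff_distrib Cross3.right_diff_distrib cross_mult_left
  cross_mult_right inner_add_left inner_diff_left inner_add_right inner_diff_right

lemma smooth_y: "Ck_on n W y"
proof -
  have "Ck_on n W (\<lambda>q. grad x q \<bullet> (w1 q \<times> w2 q) / ((w1 q \<times> w2 q) \<bullet> w3 q))"
    using T_nz by (intro Ck_on_intros W smooth_w Ck_on_grad smooth_fun)
  then show ?thesis using Ck_on_cong[OF W, of y] y_def by simp
qed

lemma smooth_z: "Ck_on n W z"
proof -
  have "Ck_on n W (\<lambda>q. grad y q \<bullet> (w1 q \<times> w2 q) / ((w1 q \<times> w2 q) \<bullet> w3 q))"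
    using T_nz by (intro Ck_on_intros W smooth_w Ck_on_grad smooth_y)
  then show ?thesis using Ck_on_cong[OF W, of z] z_def by simp
qed

lemma GDERIV_smooth: "(\<And>n. Ck_on n W h) \<Longrightarrow> q \<in> W \<Longrightarrow> GDERIV h q :> grad h q"
  by (rule differentiable_GDERIV) (metis Ck_on.simps(2))

lemmas GDERIV_x = GDERIV_smooth[OF smooth_fun(2)] and GDERIV_A = GDERIV_smooth[OF smooth_fun(1)]
  and GDERIV_y = GDERIV_smooth[OF smooth_y] and GDERIV_z = GDERIV_smooth[OF smooth_z]

lemma GDERIV_sin: "q \<in> W \<Longrightarrow> GDERIV (\<lambda>q. sin (x q)) q :> cos (x q) *\<^sub>R grad x q"
  and GDERIV_cos: "q \<in> W \<Longrightarrow> GDERIV (\<lambda>q. cos (x q)) q :> - sin (x q) *\<^sub>R grad x q"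
  using GDERIV_DERIV_compose[OF GDERIV_x DERIV_sin, of q] GDERIV_DERIV_compose[OF GDERIV_x DERIV_cos, of q]
  by simp_all

lemma has_curl_grad: "(\<And>n. Ck_on n W h) \<Longrightarrow> q \<in> W \<Longrightarrow> has_curl (grad h) 0 q"
  using has_curl_gradient[OF W _ GDERIV_smooth] by blast

section \<open>Consequences of d^2 = 0\<close>

definition K1 where "K1 q = ((A q - C q) *\<^sub>R w1 q + w2 q) \<times> w3 q"
definition K2 where "K2 q = (\<epsilon> *\<^sub>R w1 q + (A q + C q) *\<^sub>R w2 q) \<times> w3 q"

lemma K_w3: "K1 q \<bullet> w3 q = 0" "K2 q \<bullet> w3 q = 0"
  by (simp_all add: K1_def K2_def triple_simps)

lemma curl_n2: "q \<in> W \<Longrightarrow> has_curl n2 (grad x q \<times> n1 q + sin (x q) *\<^sub>R K1 q + cos (x q) *\<^sub>R K2 q) q"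
  unfolding n2_def[abs_def]
  by (rule has_curl_eq[OF has_curl_add[OF has_curl_scaleR[OF GDERIV_sin curl_w1] has_curl_scaleR[OF GDERIV_cos curl_w2]]])
     (simp_all add: K1_def K2_def n1_def cross_mult_left cross_mult_right Cross3.right_diff_distrib)

lemma curl_n1: "q \<in> W \<Longrightarrow> has_curl n1 (- (grad x q \<times> n2 q) + cos (x q) *\<^sub>R K1 q - sin (x q) *\<^sub>R K2 q) q"
  unfolding n1_def[abs_def]
  by (rule has_curl_eq[OF has_curl_diff[OF has_curl_scaleR[OF GDERIV_cos curl_w1] has_curl_scaleR[OF GDERIV_sin curl_w2]]])
     (simp_all add: K1_def K2_def n2_def cross_mult_left cross_mult_right cross_add_right)

lemma curl_w3_n2: "q \<in> W \<Longrightarrow> has_curl w3 (n2 q \<times> w3 q) q"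
  using curl_w3 by (simp add: n2_def)

text \<open>From d^2 \<omega>^3 = 0: as d\<omega>^3 = \<eta>^2 \<and> \<omega>^3, it reduces to
  d\<eta>^2 \<and> \<omega>^3 = 0, where the contributions of d\<omega>^1 and d\<omega>^2 drop out
  because they contain the factor \<omega>^3.\<close>

lemma grad_x_n1: assumes "q \<in> W" shows "(grad x q \<times> n1 q) \<bullet> w3 q = 0"
  using exact_cross_product[OF W smooth_w(3) curl_w3_n2 assms curl_n2[OF assms] curl_w3_n2[OF assms]]
  by (simp add: inner_add_left K_w3 triple_simps)

text \<open>From d^2 \<omega>^1 = 0. The derivative of C drops out, being a multiple of
  \<omega>^3.\<close>

lemma grad_A_w1: assumes q: "q \<in> W"
  shows "(grad A q \<times> w1 q) \<bullet> w3 q = T q * ((A q - C q) * cos (x q) - sin (x q))"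
proof -
  have "has_curl (\<lambda>q. (A q - C q) *\<^sub>R w1 q + w2 q)
      ((A q - C q) *\<^sub>R K1 q + (grad A q - C3 q *\<^sub>R w3 q) \<times> w1 q + K2 q) q"
    unfolding K1_def K2_def
    using q by (intro has_curl_add has_curl_scaleR GDERIV_diff GDERIV_A GDERIV_C curl_w1 curl_w2)
  from exact_cross_product[OF W smooth_w(1) curl_w1 q this curl_w3_n2[OF q]]
  show ?thesis
    unfolding n2_def by (simp add: K_w3 tp_simps algebra_simps)
qed

text \<open>The same for \<omega>^2; together the two relations give the components of dA3 along
  \<omega>^1 and \<omega>^2.\<close>

lemma grad_A_w2: assumes q: "q \<in> W"
  shows "(grad A q \<times> w2 q) \<bullet> w3 q = T q * (\<epsilon> * cos (x q) - (A q + C q) * sin (x q))"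
proof -
  have "has_curl (\<lambda>q. \<epsilon> *\<^sub>R w1 q + (A q + C q) *\<^sub>R w2 q)
      (\<epsilon> *\<^sub>R K1 q + ((A q + C q) *\<^sub>R K2 q + (grad A q + C3 q *\<^sub>R w3 q) \<times> w2 q)) q"
    unfolding K1_def K2_def
    using q by (intro has_curl_add has_curl_scaleR has_curl_scaleR_const GDERIV_add GDERIV_A GDERIV_C curl_w1 curl_w2)
  from exact_cross_product[OF W smooth_w(2) curl_w2 q this curl_w3_n2[OF q]]
  show ?thesis
    unfolding n2_def by (simp add: K_w3 tp_simps algebra_simps)
qed

text \<open>\<open>P1\<close> and \<open>P2\<close> are the derivatives of \<open>A\<^sub>3\<close> along the frame vectors dual to \<open>\<omega>\<^sup>1\<close> and \<open>\<omega>\<^sup>2\<close>.\<close>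
definition P1 where "P1 q = \<epsilon> * cos (x q) - (A q + C q) * sin (x q)"
definition P2 where "P2 q = sin (x q) - (A q - C q) * cos (x q)"
definition \<gamma> where "\<gamma> q = grad A q - P1 q *\<^sub>R w1 q - P2 q *\<^sub>R w2 q"

lemma \<gamma>_cross: "q \<in> W \<Longrightarrow> \<gamma> q \<times> w3 q = 0"
  by (rule cross_eq_0_if_triples[OF T_nz])
     (simp_all add: \<gamma>_def tp_simps grad_A_w1 grad_A_w2 P1_def P2_def algebra_simps)

text \<open>This is \<open>d\<^sup>2A\<^sub>3 \<and> \<omega>\<^sup>3 = 0\<close>.\<close>
lemma grad_P_relation:
  assumes q: "q \<in> W"
  shows "((- (\<epsilon> * sin (x q) + (A q + C q) * cos (x q))) *\<^sub>R grad x q \<times> w1 q) \<bullet> w3 q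
    - sin (x q) * ((grad A q \<times> w1 q) \<bullet> w3 q)
    + ((cos (x q) + (A q - C q) * sin (x q)) *\<^sub>R grad x q \<times> w2 q) \<bullet> w3 q
    - cos (x q) * ((grad A q \<times> w2 q) \<bullet> w3 q) = 0"
proof -
  have P1: "GDERIV P1 q :> (- (\<epsilon> * sin (x q) + (A q + C q) * cos (x q))) *\<^sub>R grad x q
      - sin (x q) *\<^sub>R (grad A q + C3 q *\<^sub>R w3 q)"
    unfolding P1_def[abs_def]
    by (rule GDERIV_subst[OF GDERIV_diff[OF GDERIV_mult[OF GDERIV_const GDERIV_cos[OF q]]
        GDERIV_mult[OF GDERIV_add[OF GDERIV_A[OF q] GDERIV_C[OF q]] GDERIV_sin[OF q]]]])
       (simp add: algebra_simps)
  have P2: "GDERIV P2 q :> (cos (x q) + (A q - C q) * sin (x q)) *\<^sub>R grad x q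
      - cos (x q) *\<^sub>R (grad A q - C3 q *\<^sub>R w3 q)"
    unfolding P2_def[abs_def]
    by (rule GDERIV_subst[OF GDERIV_diff[OF GDERIV_sin[OF q]
        GDERIV_mult[OF GDERIV_diff[OF GDERIV_A[OF q] GDERIV_C[OF q]] GDERIV_cos[OF q]]]])
       (simp add: algebra_simps)
  note c\<gamma> = has_curl_diff[OF has_curl_diff[OF has_curl_grad[OF smooth_fun(1) q]
        has_curl_scaleR[OF P1 curl_w1[OF q]]] has_curl_scaleR[OF P2 curl_w2[OF q]], folded K1_def K2_def \<gamma>_def]
  \<comment> \<open>Since \<gamma> is a multiple of \<omega>^3, the term \<gamma> \<and> d\<omega>^3
    vanishes and d\<gamma> \<and> \<omega>^3 = 0 remains.\<close>
  have "\<gamma> q \<bullet> (n2 q \<times> w3 q) = 0"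
    by (subst parallel_expansion[OF T_nz[OF q] \<gamma>_cross[OF q]]) (simp add: dot_cross_self)
  with cross_product_eq_0_curl[OF W \<gamma>_cross q c\<gamma> curl_w3_n2[OF q]]
  show ?thesis
    by (simp add: K_w3 tp_simps algebra_simps)
qed

definition a where "a q = (grad x q \<times> n2 q) \<bullet> w3 q / T q"

lemma smooth_n: "Ck_on n W n1" "Ck_on n W n2"
  unfolding n1_def[abs_def] n2_def[abs_def] by (intro Ck_on_intros W smooth_w smooth_fun)+

lemma smooth_a: "Ck_on n W a"
  unfolding a_def[abs_def] T_def using T_nz by (intro Ck_on_intros W smooth_w Ck_on_grad smooth_fun smooth_n)

lemma grad_x_expansion:
  assumes "q \<in> W"
  shows "grad x q = a q *\<^sub>R n1 q + y q *\<^sub>R w3 q"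
  using frame_expansion[of "n1 q" "n2 q" "w3 q" "grad x q"] T[OF assms] grad_x_n1[OF assms]
  by (simp add: triple_simps a_def n1_cross_n2 y_def[OF assms])

text \<open>Inserting dx = a \<eta>^1 + y \<omega>^3 and the components of dA3 into
  \<open>grad_P_relation\<close> cancels A3 altogether; \<open>L\<close> collects the factor of
  \<open>a\<close> and \<open>R\<close> the rest.\<close>

definition L where "L q = (cos (x q))^2 - \<epsilon> * (sin (x q))^2 - 2 * C q * sin (x q) * cos (x q)"
definition R where "R q = \<epsilon> * (cos (x q))^2 - (sin (x q))^2 - 2 * C q * sin (x q) * cos (x q)"

lemma a_L: assumes q: "q \<in> W" shows "a q * L q = R q"
proof -
  define s where "s = sin (x q)" define c where "c = cos (x q)"
  have g: "(grad x q \<times> w1 q) \<bullet> w3 q = a q * s * T q" "(grad x q \<times> w2 q) \<bullet> w3 q = a q * c * T q"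
    by (simp_all add: grad_x_expansion[OF q] n1_def tp_simps s_def c_def)
  have "T q * (a q * L q - R q) = 0"
    using grad_P_relation[OF q] unfolding L_def R_def grad_A_w1[OF q] grad_A_w2[OF q] cross_mult_left inner_scaleR_left g
    by (simp add: s_def c_def algebra_simps power2_eq_square)
  then show ?thesis using T[OF q] by simp
qed

text \<open>This is \<open>d\<^sup>2x \<and> \<omega>\<^sup>3 = 0\<close>.\<close>
lemma grad_a_n1: assumes q: "q \<in> W" shows "(grad a q \<times> n1 q) \<bullet> w3 q = (a q)^2 * T q"
proof -
  have "has_curl (\<lambda>q. a q *\<^sub>R n1 q + y q *\<^sub>R w3 q) 0 q"
    by (rule has_curl_transform[OF has_curl_grad[OF smooth_fun(2) q] W q]) (rule grad_x_expansion)
  from has_curl_unique[OF this has_curl_add[OF has_curl_scaleR[OF GDERIV_smooth[OF smooth_a q] curl_n1[OF q]]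
        has_curl_scaleR[OF GDERIV_y[OF q] curl_w3_n2[OF q]]]]
  have "0 = (a q *\<^sub>R (- (grad x q \<times> n2 q) + cos (x q) *\<^sub>R K1 q - sin (x q) *\<^sub>R K2 q) + grad a q \<times> n1 q +
     (y q *\<^sub>R (n2 q \<times> w3 q) + grad y q \<times> w3 q)) \<bullet> w3 q" by simp
  then show ?thesis
    by (simp add: K_w3 tp_simps grad_x_expansion[OF q] algebra_simps power2_eq_square)
qed

text \<open>\<open>L\<close> and \<open>R\<close> differ by a constant, so that they share the gradient \<open>gR\<close>.\<close>
definition gR where "gR q = (- (2 * (1 + \<epsilon>) * sin (x q) * cos (x q) + 2 * C q * ((cos (x q))^2 - (sin (x q))^2))) *\<^sub>R grad x q
   - (2 * sin (x q) * cos (x q) * C3 q) *\<^sub>R w3 q"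

lemma GDERIV_L_R:
  assumes q: "q \<in> W"
  shows "GDERIV L q :> gR q" "GDERIV R q :> gR q"
proof -
  have s2: "GDERIV (\<lambda>q. (sin (x q))^2) q :> (2 * sin (x q) * cos (x q)) *\<^sub>R grad x q"
    unfolding power2_eq_square by (rule GDERIV_subst[OF GDERIV_mult[OF GDERIV_sin[OF q] GDERIV_sin[OF q]]])
      (simp only: scaleR_scaleR scaleR_add_left[symmetric], simp)
  have c2: "GDERIV (\<lambda>q. (cos (x q))^2) q :> (- 2 * sin (x q) * cos (x q)) *\<^sub>R grad x q"
    unfolding power2_eq_square by (rule GDERIV_subst[OF GDERIV_mult[OF GDERIV_cos[OF q] GDERIV_cos[OF q]]])
      (simp only: scaleR_scaleR scaleR_add_left[symmetric], simp)
  note m = GDERIV_mult[OF GDERIV_mult[OF GDERIV_mult[OF GDERIV_const GDERIV_C[OF q]] GDERIV_sin[OF q]] GDERIV_cos[OF q]]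
  show "GDERIV L q :> gR q"
    unfolding L_def[abs_def] gR_def
    by (rule GDERIV_subst[OF GDERIV_diff[OF GDERIV_diff[OF c2 GDERIV_mult[OF GDERIV_const s2]] m]])
       (simp add: algebra_simps power2_eq_square)
  show "GDERIV R q :> gR q"
    unfolding R_def[abs_def] gR_def
    by (rule GDERIV_subst[OF GDERIV_diff[OF GDERIV_diff[OF GDERIV_mult[OF GDERIV_const c2] s2] m]])
       (simp add: algebra_simps power2_eq_square)
qed

lemma gR_n1: "q \<in> W \<Longrightarrow> (gR q \<times> n1 q) \<bullet> w3 q = 0"
  by (simp add: gR_def tp_simps grad_x_n1)

text \<open>Differentiating \<open>a L = R\<close> in the direction dual to \<open>\<eta>\<^sup>2\<close>, where \<open>x\<close> and \<open>C\<close> are constant and the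
  derivative of \<open>a\<close> is \<open>- a\<^sup>2\<close>, gives \<open>a\<^sup>2 L = 0\<close>.\<close>
lemma R_eq_0: assumes q: "q \<in> W" shows "R q = 0"
proof -
  have "GDERIV (\<lambda>q. a q * L q) q :> gR q"
    by (rule GDERIV_transform[OF GDERIV_L_R(2)[OF q] W q]) (simp add: a_L)
  from GDERIV_unique[OF this GDERIV_mult[OF GDERIV_smooth[OF smooth_a q] GDERIV_L_R(1)[OF q]]]
  have "(gR q \<times> n1 q) \<bullet> w3 q = ((a q *\<^sub>R gR q + L q *\<^sub>R grad a q) \<times> n1 q) \<bullet> w3 q" by simp
  then have "L q * ((a q)^2 * T q) = 0"
    by (simp add: tp_simps gR_n1[OF q] grad_a_n1[OF q])
  then have "a q = 0 \<or> L q = 0" using T[OF q] by auto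
  then show ?thesis using a_L[OF q] by auto
qed

lemma gR_eq_0: assumes q: "q \<in> W" shows "gR q = 0"
proof -
  have "GDERIV (\<lambda>q. 0) q :> gR q"
    by (rule GDERIV_transform[OF GDERIV_L_R(2)[OF q] W q]) (simp add: R_eq_0)
  from GDERIV_unique[OF this GDERIV_const] show ?thesis .
qed

text \<open>For \<epsilon> = -1 one has L = R + 2 = 2, so that a L = R = 0 suffices. For \<epsilon>
  = 1 the functions L and R coincide, and the \<eta>^1 component of dR = 0 is used instead: its
  factor of a is -2 B, and R = 0 gives 2 s c B = (s^2 + c^2)^2 = 1.\<close>

lemma a_eq_0: assumes q: "q \<in> W" shows "a q = 0"
proof -
  define s where "s = sin (x q)" define c where "c = cos (x q)"
  have sc: "s^2 + c^2 = 1" by (simp add: s_def c_def)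
  have R: "\<epsilon> * c^2 - s^2 - 2 * C q * s * c = 0" using R_eq_0[OF q] by (simp add: R_def s_def c_def)
  from eps show ?thesis
  proof
    assume e: "\<epsilon> = 1"
    define B where "B = 2 * s * c + C q * (c^2 - s^2)"
    have "0 = (gR q \<times> n2 q) \<bullet> w3 q" by (simp add: gR_eq_0[OF q])
    also have "\<dots> = - (2 * (1 + \<epsilon>) * s * c + 2 * C q * (c^2 - s^2)) * (a q * T q)"
      by (simp add: gR_def tp_simps grad_x_expansion[OF q] s_def c_def algebra_simps)
    also have "\<dots> = - (2 * B) * (a q * T q)"
      by (simp add: B_def e algebra_simps)
    finally have "B * a q = 0" using T[OF q] by simp
    then have "(2 * s * c + C q * (c^2 - s^2)) * a q = 0" by (simp only: B_def)
    then have "2 * s * c * (2 * s * c + C q * (c^2 - s^2)) * a q = 0" by simp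
    moreover have "2 * s * c * (2 * s * c + C q * (c^2 - s^2)) = 1"
      using sc R e by algebra
    ultimately show ?thesis by simp
  next
    assume e: "\<epsilon> = -1"
    have "L q = R q + 2" using sc e unfolding L_def R_def s_def c_def by algebra
    then show ?thesis using a_L[OF q] R_eq_0[OF q] by simp
  qed
qed

lemma grad_x: "q \<in> W \<Longrightarrow> grad x q = y q *\<^sub>R w3 q"
  using grad_x_expansion a_eq_0 by simp

lemma w3_nz: "q \<in> W \<Longrightarrow> w3 q \<noteq> 0"
  using T_nz by fastforce

text \<open>Where y vanishes, dx does too, and dR = 0 is reduced to its term in C3.\<close>

lemma y_nz: assumes q: "q \<in> W" shows "y q \<noteq> 0"
proof
  assume "y q = 0"
  then have "(2 * sin (x q) * cos (x q) * C3 q) *\<^sub>R w3 q = 0"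
    using gR_eq_0[OF q] by (simp add: gR_def grad_x[OF q])
  then show False using sin_nz[OF q] cos_nz[OF q] C3_nz[OF q] w3_nz[OF q] by simp
qed

lemma C_eq: "q \<in> W \<Longrightarrow> C q = (\<epsilon> * (cos (x q))^2 - (sin (x q))^2) / (2 * sin (x q) * cos (x q))"
  using R_eq_0[of q] sin_nz[of q] cos_nz[of q] by (simp add: R_def field_simps)

end

section \<open>The normal form in a chart\<close>

text \<open>Vectors form a ring, in which the simplifier turns \<open>v + v\<close> into the componentwise product \<open>2 * v\<close>.\<close>
lemma two_times_vec: "2 * v = 2 *\<^sub>R v" for v :: "real^3"
  by (simp add: vec_eq_iff)

context local_coframing
begin

section \<open>The rotated structure equations and the differentials of x, y, z\<close>

abbreviation k where "k q \<equiv> kfun \<epsilon> (x q)"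

text \<open>The origin of \<open>kfun\<close>: rotating the coframing produces these two
  combinations of \<epsilon> and C, and once C is known they involve one and the same function of
  x.\<close>

lemma trig_relations:
  assumes q: "q \<in> W"
  shows "\<epsilon> * cos (x q) - C q * sin (x q) = k q * sin (x q)" "sin (x q) + C q * cos (x q) = k q * cos (x q)"
proof -
  show "\<epsilon> * cos (x q) - C q * sin (x q) = k q * sin (x q)"
    using sin_nz[OF q] cos_nz[OF q] by (simp add: C_eq[OF q] kfun_def field_simps power2_eq_square)
  show "sin (x q) + C q * cos (x q) = k q * cos (x q)"
    using sin_nz[OF q] cos_nz[OF q] by (simp add: C_eq[OF q] kfun_def field_simps power2_eq_square)
qed

lemma smooth_k: "Ck_on n W k"
  unfolding kfun_def using sin_nz cos_nz by (intro Ck_on_intros W smooth_fun) simp_all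

lemma GDERIV_k: "q \<in> W \<Longrightarrow> GDERIV k q :> kder \<epsilon> (x q) *\<^sub>R grad x q"
  by (rule GDERIV_DERIV_compose[OF GDERIV_x DERIV_kfun]) (simp_all add: sin_nz cos_nz)

lemma curl_n2':
  assumes q: "q \<in> W"
  shows "has_curl n2 ((- y q *\<^sub>R n1 q + (A q + k q) *\<^sub>R n2 q) \<times> w3 q) q"
proof (rule has_curl_eq[OF curl_n2[OF q]])
  have "sin (x q) *\<^sub>R K1 q + cos (x q) *\<^sub>R K2 q =
    ((A q * sin (x q) + (\<epsilon> * cos (x q) - C q * sin (x q))) *\<^sub>R w1 q
      + (A q * cos (x q) + (sin (x q) + C q * cos (x q))) *\<^sub>R w2 q) \<times> w3 q"
    unfolding K1_def K2_def by (simp add: tp_simps algebra_simps)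
  also have "\<dots> = (A q + k q) *\<^sub>R n2 q \<times> w3 q"
    unfolding trig_relations[OF q] n2_def by (simp add: tp_simps algebra_simps)
  finally show "grad x q \<times> n1 q + sin (x q) *\<^sub>R K1 q + cos (x q) *\<^sub>R K2 q =
      (- y q *\<^sub>R n1 q + (A q + k q) *\<^sub>R n2 q) \<times> w3 q"
    unfolding grad_x[OF q] using cross_skew[of "w3 q" "n1 q"] by (simp add: tp_simps algebra_simps)
qed

lemma curl_n1':
  assumes q: "q \<in> W"
  shows "has_curl n1 (((A q - k q) *\<^sub>R n1 q + (y q + 1 - \<epsilon>) *\<^sub>R n2 q) \<times> w3 q) q"
proof (rule has_curl_eq[OF curl_n1[OF q]])
  have "cos (x q) *\<^sub>R K1 q - sin (x q) *\<^sub>R K2 q =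
    ((A q * cos (x q) + (1 - \<epsilon>) * sin (x q) - (sin (x q) + C q * cos (x q))) *\<^sub>R w1 q
      + (- A q * sin (x q) + (1 - \<epsilon>) * cos (x q) + (\<epsilon> * cos (x q) - C q * sin (x q))) *\<^sub>R w2 q) \<times> w3 q"
    unfolding K1_def K2_def by (simp add: tp_simps algebra_simps)
  also have "\<dots> = ((A q - k q) *\<^sub>R n1 q + (1 - \<epsilon>) *\<^sub>R n2 q) \<times> w3 q"
    unfolding trig_relations[OF q] n1_def n2_def by (simp add: tp_simps algebra_simps)
  finally show "- (grad x q \<times> n2 q) + cos (x q) *\<^sub>R K1 q - sin (x q) *\<^sub>R K2 q =
      ((A q - k q) *\<^sub>R n1 q + (y q + 1 - \<epsilon>) *\<^sub>R n2 q) \<times> w3 q"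
    unfolding grad_x[OF q] using cross_skew[of "w3 q" "n2 q"] by (simp add: tp_simps algebra_simps)
qed

lemma dual_simps: "n1 q \<bullet> (w1 q \<times> w2 q) = 0" "n2 q \<bullet> (w1 q \<times> w2 q) = 0" "w3 q \<bullet> (w1 q \<times> w2 q) = T q"
  using dot_cross_self[of "n1 q" "n2 q"] dot_cross_self[of "n2 q" "n1 q"]
  by (simp_all add: n1_cross_n2 T_def inner_commute)

lemma grad_y:
  assumes q: "q \<in> W"
  shows "grad y q = - y q *\<^sub>R n2 q + z q *\<^sub>R w3 q"
proof -
  have "has_curl (\<lambda>q. y q *\<^sub>R w3 q) 0 q"
    by (rule has_curl_transform[OF has_curl_grad[OF smooth_fun(2) q] W q]) (rule grad_x)
  from has_curl_unique[OF this has_curl_scaleR[OF GDERIV_y[OF q] curl_w3_n2[OF q]]]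
  have "(grad y q + y q *\<^sub>R n2 q) \<times> w3 q = 0" by (simp add: tp_simps algebra_simps)
  from parallel_expansion[OF T_nz[OF q] this]
  have "grad y q + y q *\<^sub>R n2 q = z q *\<^sub>R w3 q"
    by (simp add: inner_add_left dual_simps z_def[OF q])
  then show ?thesis by (simp add: algebra_simps)
qed

definition w where "w q = grad z q \<bullet> (w1 q \<times> w2 q) / ((w1 q \<times> w2 q) \<bullet> w3 q)"

lemma smooth_w': "Ck_on n W w"
  unfolding w_def[abs_def] using T_nz by (intro Ck_on_intros W smooth_w Ck_on_grad smooth_z)

lemma grad_z:
  assumes q: "q \<in> W"
  shows "grad z q = (- ((y q)^2)) *\<^sub>R n1 q - (2 * z q - y q * (A q + k q)) *\<^sub>R n2 q + w q *\<^sub>R w3 q"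
proof -
  define g where "g = (y q)^2 *\<^sub>R n1 q + (2 * z q - y q * (A q + k q)) *\<^sub>R n2 q"
  have "has_curl (\<lambda>q. - y q *\<^sub>R n2 q + z q *\<^sub>R w3 q) 0 q"
    by (rule has_curl_transform[OF has_curl_grad[OF smooth_y q] W q]) (rule grad_y)
  from has_curl_unique[OF this has_curl_add[OF has_curl_scaleR[OF GDERIV_minus[OF GDERIV_y[OF q]] curl_n2'[OF q]]
        has_curl_scaleR[OF GDERIV_z[OF q] curl_w3_n2[OF q]]]]
  have "(grad z q + g) \<times> w3 q = 0"
    unfolding grad_y[OF q] g_def using cross_skew[of "w3 q" "n2 q"]
    by (simp add: tp_simps algebra_simps power2_eq_square two_times_vec)
  from parallel_expansion[OF T_nz[OF q] this]
  have "grad z q + g = w q *\<^sub>R w3 q"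
    by (simp add: g_def inner_add_left inner_diff_left dual_simps w_def)
  then show ?thesis unfolding g_def by (simp add: algebra_simps)
qed

text \<open>In terms of \<omega>^3, \<eta>^2, \<eta>^1 the differentials dx, dy, dz are triangular
  with diagonal y, -y, -y^2; the sign comes from the reversed order of the frame.\<close>

lemma jacobian_eq:
  assumes q: "q \<in> W" shows "jacobian x y z q = - ((y q)^4 * T q)"
proof -
  have "w3 q \<bullet> (n2 q \<times> n1 q) = - T q"
    using triple_simps(10)[of q] by (simp add: inner_commute)
  moreover have "v \<bullet> (n2 q \<times> v) = 0" "v \<bullet> (v \<times> u) = 0" for u v
    by (simp_all add: dot_cross_self)
  ultimately show ?thesis
    unfolding jacobian_def grad_x[OF q] grad_y[OF q] grad_z[OF q]
    by (simp add: tp_simps algebra_simps power2_eq_square power4_eq_xxxx)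
qed

lemma coordinate_triple: "coordinate_triple W x y z"
  by unfold_locales (use W smooth_fun smooth_y smooth_z jacobian_eq y_nz T in auto)

text \<open>By \<open>trig_relations\<close>, \<open>P1\<close> and \<open>P2\<close> are sin x and
  cos x times the common factor -(A3 - k), so that the components along \<omega>^1 and \<omega>^2
  combine to a multiple of \<eta>^2.\<close>

lemma grad_A:
  assumes q: "q \<in> W"
  obtains l where "grad A q = - (A q - k q) *\<^sub>R n2 q + l *\<^sub>R w3 q"
proof -
  have P: "P1 q = - (A q - k q) * sin (x q)" "P2 q = - (A q - k q) * cos (x q)"
    using trig_relations[OF q] by (simp_all add: P1_def P2_def algebra_simps)
  obtain l where "\<gamma> q = l *\<^sub>R w3 q"
    using parallel_expansion[OF T_nz[OF q] \<gamma>_cross[OF q]] by blast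
  then have "grad A q = - (A q - k q) *\<^sub>R n2 q + l *\<^sub>R w3 q"
    unfolding \<gamma>_def P n2_def by (simp add: algebra_simps)
  then show thesis using that by blast
qed

section \<open>Integration of A3 and of the coefficient N1\<close>

definition f0 where "f0 q = (A q - k q) / y q"

lemma smooth_f0: "Ck_on n W f0"
  unfolding f0_def[abs_def] using y_nz by (intro Ck_on_intros W smooth_fun smooth_k smooth_y)

lemma A_eq: "q \<in> W \<Longrightarrow> A q = y q * f0 q + k q"
  using y_nz by (simp add: f0_def)

text \<open>Modulo \<omega>^3 one has d(A3 - k) = -(A3 - k) \<eta>^2 and dy = -y \<eta>^2, so the
  differential of the quotient is a multiple of \<omega>^3, that is, of dx. The quotient becomes
  f(x).\<close>

lemma grad_f0_parallel:
  assumes q: "q \<in> W" shows "grad f0 q \<times> grad x q = 0"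
proof -
  obtain l where l: "grad A q = - (A q - k q) *\<^sub>R n2 q + l *\<^sub>R w3 q" using grad_A[OF q] .
  have "grad f0 q = (1 / y q) *\<^sub>R (grad A q - kder \<epsilon> (x q) *\<^sub>R grad x q) - ((A q - k q) / (y q)^2) *\<^sub>R grad y q"
    unfolding f0_def[abs_def]
    by (rule GDERIV_grad, rule GDERIV_divide[OF GDERIV_diff[OF GDERIV_A[OF q] GDERIV_k[OF q]] GDERIV_y[OF q] y_nz[OF q]])
  then show ?thesis
    unfolding l grad_y[OF q] grad_x[OF q] using y_nz[OF q]
    by (simp add: tp_simps power2_eq_square)
       (simp only: scaleR_add_left[symmetric] add_divide_distrib[symmetric], simp)
qed

text \<open>The coefficients of \<open>dx\<close> and \<open>dy\<close> in \<open>y\<^sup>2 \<eta>\<^sup>1\<close>, before \<open>A\<^sub>3\<close> and \<open>w\<close> are integrated.\<close>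
definition N20 where "N20 q = 2 * z q / y q - y q * f0 q - 2 * k q"
definition N10 where "N10 q = w q / y q - N20 q * z q / y q"

lemma smooth_N: "Ck_on n W N20" "Ck_on n W N10"
proof -
  show N2: "Ck_on n W N20" for n
    unfolding N20_def[abs_def] using y_nz by (intro Ck_on_intros W smooth_f0 smooth_k smooth_y smooth_z)
  show "Ck_on n W N10"
    unfolding N10_def[abs_def] using y_nz by (intro Ck_on_intros W N2 smooth_w' smooth_y smooth_z)
qed

lemma n2_eq: assumes q: "q \<in> W" shows "n2 q = (z q / (y q)^2) *\<^sub>R grad x q - (1 / y q) *\<^sub>R grad y q"
  unfolding grad_x[OF q] grad_y[OF q] using y_nz[OF q] by (simp add: algebra_simps power2_eq_square)

lemma n1_eq: assumes q: "q \<in> W"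
  shows "(y q)^2 *\<^sub>R n1 q = N10 q *\<^sub>R grad x q + N20 q *\<^sub>R grad y q - grad z q"
proof -
  have "2 * z q - y q * (A q + k q) = y q * N20 q" "N10 q * y q + N20 q * z q = w q"
    using y_nz[OF q] by (simp_all add: A_eq[OF q] N20_def N10_def field_simps)
  then show ?thesis
    unfolding grad_x[OF q] grad_y[OF q] grad_z[OF q]
    by (simp add: algebra_simps) (metis scaleR_add_left)
qed

lemma n1_eq': "q \<in> W \<Longrightarrow> n1 q = (1 / (y q)^2) *\<^sub>R (N10 q *\<^sub>R grad x q + N20 q *\<^sub>R grad y q - grad z q)"
  using n1_eq[symmetric] y_nz by simp

lemma w3_eq: "q \<in> W \<Longrightarrow> w3 q = (1 / y q) *\<^sub>R grad x q"
  using grad_x y_nz by simp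

text \<open>The exterior derivative of y^2 \<eta>^1 is computed twice: from its coordinate
  expression and from the equation for d\<eta>^1. The comparison yields the derivatives of
  \<open>N10\<close> in y and z, a linear system for \<open>N10\<close>.\<close>

lemma grad_N10:
  assumes q: "q \<in> W" and f0: "grad f0 q = f' *\<^sub>R grad x q"
  shows "grad N10 q \<times> grad x q = (2 * N10 q / y q - y q - (1 - \<epsilon>) + f0 q * N20 q - y q * f' - 2 * kder \<epsilon> (x q)) *\<^sub>R
      (grad y q \<times> grad x q) - f0 q *\<^sub>R (grad z q \<times> grad x q)"
proof -
  define X where "X = grad x q" define Y where "Y = grad y q" define Z where "Z = grad z q"
  have y: "y q \<noteq> 0" using y_nz[OF q] .
  have "GDERIV N20 q :> (2 / y q) *\<^sub>R Z - (2 * z q / (y q)^2) *\<^sub>R Y - (y q *\<^sub>R (f' *\<^sub>R X) + f0 q *\<^sub>R Y)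
     - (2 * kder \<epsilon> (x q)) *\<^sub>R X"
    unfolding N20_def[abs_def] X_def Y_def Z_def f0[symmetric]
    by (rule GDERIV_subst[OF GDERIV_diff[OF GDERIV_diff[OF GDERIV_divide[OF GDERIV_mult[OF GDERIV_const GDERIV_z[OF q]]
          GDERIV_y[OF q] y] GDERIV_mult[OF GDERIV_y[OF q] GDERIV_smooth[OF smooth_f0 q]]] GDERIV_mult[OF GDERIV_const GDERIV_k[OF q]]]])
       simp
  then have gN2: "grad N20 q = (2 / y q) *\<^sub>R Z - (2 * z q / (y q)^2) *\<^sub>R Y - (y q *\<^sub>R (f' *\<^sub>R X) + f0 q *\<^sub>R Y)
     - (2 * kder \<epsilon> (x q)) *\<^sub>R X" by (rule GDERIV_grad)
  have "has_curl (\<lambda>q. (y q * y q) *\<^sub>R n1 q) ((grad N10 q \<times> X + grad N20 q \<times> Y)) q"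
  proof (rule has_curl_transform[OF _ W q])
    show "has_curl (\<lambda>q. N10 q *\<^sub>R grad x q + N20 q *\<^sub>R grad y q - grad z q) (grad N10 q \<times> X + grad N20 q \<times> Y) q"
      unfolding X_def Y_def
      by (rule has_curl_eq[OF has_curl_diff[OF has_curl_add[OF has_curl_scaleR[OF GDERIV_smooth[OF smooth_N(2) q] has_curl_grad[OF smooth_fun(2) q]]
          has_curl_scaleR[OF GDERIV_smooth[OF smooth_N(1) q] has_curl_grad[OF smooth_y q]]] has_curl_grad[OF smooth_z q]]]) simp
  qed (simp add: n1_eq power2_eq_square[symmetric])
  from has_curl_unique[OF this has_curl_scaleR[OF GDERIV_mult[OF GDERIV_y[OF q] GDERIV_y[OF q]] curl_n1'[OF q]]]
  have c: "grad N10 q \<times> X = (y q * y q) *\<^sub>R (((A q - k q) *\<^sub>R n1 q + (y q + 1 - \<epsilon>) *\<^sub>R n2 q) \<times> w3 q)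
      + (2 * y q) *\<^sub>R (Y \<times> n1 q) - grad N20 q \<times> Y"
    by (simp add: Y_def tp_simps algebra_simps two_times_vec)
  have Ak: "A q - k q = y q * f0 q" using A_eq[OF q] by simp
  have YX: "Y \<times> X = - (X \<times> Y)" "Z \<times> X = - (X \<times> Z)" "Z \<times> Y = - (Y \<times> Z)"
    by (rule cross_skew)+
  have "Y \<times> n1 q = (N10 q / (y q)^2) *\<^sub>R (Y \<times> X) - (1 / (y q)^2) *\<^sub>R (Y \<times> Z)"
    unfolding n1_eq'[OF q] X_def[symmetric] Y_def[symmetric] Z_def[symmetric]
    by (simp add: tp_simps algebra_simps)
  then have t1: "(2 * y q) *\<^sub>R (Y \<times> n1 q) = (2 * N10 q / y q) *\<^sub>R (Y \<times> X) - (2 / y q) *\<^sub>R (Y \<times> Z)"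
    using y by (simp add: scaleR_diff_right power2_eq_square)
  have "n2 q \<times> w3 q = - (1 / (y q)^2) *\<^sub>R (Y \<times> X)"
    unfolding n2_eq[OF q] w3_eq[OF q] X_def[symmetric] Y_def[symmetric]
    by (simp add: tp_simps power2_eq_square)
  then have t2: "(y q * y q) *\<^sub>R (n2 q \<times> w3 q) = - (Y \<times> X)" using y by (simp add: power2_eq_square)
  have "n1 q \<times> w3 q = (1 / (y q)^3) *\<^sub>R (N20 q *\<^sub>R (Y \<times> X) - Z \<times> X)"
    unfolding n1_eq'[OF q] w3_eq[OF q] X_def[symmetric] Y_def[symmetric] Z_def[symmetric]
    by (simp add: tp_simps power2_eq_square power3_eq_cube algebra_simps)
  then have t3: "(y q * y q) *\<^sub>R ((y q * f0 q) *\<^sub>R (n1 q \<times> w3 q)) = f0 q *\<^sub>R (N20 q *\<^sub>R (Y \<times> X) - Z \<times> X)"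
    using y by (simp add: power3_eq_cube)
  have t4: "grad N20 q \<times> Y = - (2 / y q) *\<^sub>R (Y \<times> Z) + (y q * f' + 2 * kder \<epsilon> (x q)) *\<^sub>R (Y \<times> X)"
    unfolding gN2 by (simp add: tp_simps YX algebra_simps)
  have "grad N10 q \<times> X = (y q * y q) *\<^sub>R ((y q * f0 q) *\<^sub>R (n1 q \<times> w3 q)) + (y q + 1 - \<epsilon>) *\<^sub>R ((y q * y q) *\<^sub>R (n2 q \<times> w3 q))
      + (2 * y q) *\<^sub>R (Y \<times> n1 q) - grad N20 q \<times> Y"
    unfolding c Ak by (simp add: tp_simps algebra_simps)
  \<comment> \<open>The terms in Y \<times> Z of \<open>t1\<close> and \<open>t4\<close>
    cancel.\<close>
  also have "\<dots> = (2 * N10 q / y q - y q - (1 - \<epsilon>) + f0 q * N20 q - y q * f' - 2 * kder \<epsilon> (x q)) *\<^sub>R (Y \<times> X) - f0 q *\<^sub>R (Z \<times> X)"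
    unfolding t1 t2 t3 t4 by (simp add: algebra_simps)
  finally show ?thesis unfolding X_def Y_def Z_def .
qed

theorem local_normal_form:
  assumes p: "p \<in> W"
  shows "\<exists>V f g. coordinate_chart V x y z \<and> p \<in> V \<and> V \<subseteq> W \<and> Ck_on 3 UNIV f \<and> Ck_on 2 UNIV g \<and>
    (\<forall>q\<in>V. n1 q = (1 / (y q)^2) *\<^sub>R (N1 \<epsilon> f g (x q) (y q) (z q) *\<^sub>R grad x q
              + N2 \<epsilon> f (x q) (y q) (z q) *\<^sub>R grad y q - grad z q))"
proof -
  interpret ct: coordinate_triple W x y z by (rule coordinate_triple)
  obtain V0 where V0: "open V0" "p \<in> V0" "V0 \<subseteq> W" "inj_on (coords x y z) V0"
    using ct.locally_injective[OF p] .
  interpret c0: coordinate_chart V0 x y z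
    using V0 ct.nondegenerate by unfold_locales
      (auto intro: Ck_on_subset[OF ct.smooth(1)] Ck_on_subset[OF ct.smooth(2)] Ck_on_subset[OF ct.smooth(3)])
  obtain r where r: "r > 0" "ball (coords x y z p) r \<subseteq> coords x y z ` V0"
    using c0.open_image V0(2) open_contains_ball by blast
  define V1 where "V1 = V0 \<inter> coords x y z -` ball (coords x y z p) r"
  note V1 = c0.restrict_to_ball[OF V0(2) r, folded V1_def]
  interpret c1: coordinate_chart V1 x y z by (rule V1)
  have V1W: "V1 \<subseteq> W" using V1(3) V0(3) by blast
  have "Ck_on n V1 f0" for n using smooth_f0 V1W by (rule Ck_on_subset)
  from c1.extended_function_of_first_coordinate[OF V1(2,4) r(1) this, of 3] V1W grad_f0_parallel
  obtain f V2 where V2: "coordinate_chart V2 x y z" "p \<in> V2" "V2 \<subseteq> V1"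
      "coords x y z ` V2 = ball (coords x y z p) (r / 2)"
    and f: "Ck_on 3 UNIV f" "\<And>q. q \<in> V2 \<Longrightarrow> f0 q = f (x q)" "\<And>n. Ck_on n V2 (\<lambda>q. deriv f (x q))"
    by blast
  interpret c2: coordinate_chart V2 x y z by (rule V2)
  have V2W: "V2 \<subseteq> W" using V2(3) V1W by blast
  have f': "(f has_real_derivative deriv f t) (at t)" for t
    using f(1) Ck_on_deriv(2)[of UNIV 2 f] by (simp add: numeral_3_eq_3 numeral_2_eq_2)
  define f'' where "f'' t = deriv (deriv f) t" for t
  have f'': "(deriv f has_real_derivative f'' t) (at t)" for t
    using f(1) Ck_on_deriv(1)[of UNIV 2 f] Ck_on_deriv(2)[of UNIV 1 "deriv f"]
    unfolding f''_def by (simp add: numeral_3_eq_3 numeral_2_eq_2)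
  define m where "m q = 2 * kder \<epsilon> (x q) + (1 - \<epsilon>) + 2 * k q * f0 q" for q
  define h where "h q = deriv f (x q)" for q
  \<comment> \<open>The formula of \<open>N1\<close> solved for g, with \<open>f0\<close> and
    \<open>h\<close> standing for f(x) and f'(x). By \<open>grad_N10\<close> its differential is a
    multiple of dx.\<close>
  define g0 where "g0 q = N10 q / (y q)^2 - m q / y q + ((f0 q)^2 + h q + 1) * ln \<bar>y q\<bar> + z q * f0 q / (y q)^2" for q
  have smooth_kder: "Ck_on n W (\<lambda>q. kder \<epsilon> (x q))" for n
    unfolding kder_def using sin_nz cos_nz by (intro Ck_on_intros W smooth_fun smooth_k) simp_all
  have smooth_m: "Ck_on n W m" for n
    unfolding m_def[abs_def] by (intro Ck_on_intros W smooth_kder smooth_k smooth_f0)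
  note sub = Ck_on_subset[OF _ V2W]
  have smooth_h: "Ck_on n V2 h" for n using f(3) by (simp add: h_def[abs_def])
  have "y q \<noteq> 0" if "q \<in> V2" for q using y_nz V2W that by blast
  then have smooth_g0: "Ck_on n V2 g0" for n
    unfolding g0_def[abs_def]
    by (intro Ck_on_intros c2.V sub[OF smooth_N(2)] sub[OF smooth_m] sub[OF smooth_f0] sub[OF smooth_y]
        sub[OF smooth_z] smooth_h) auto
  have par: "grad g0 q \<times> grad x q = 0" if q2: "q \<in> V2" for q
  proof -
    have q: "q \<in> W" using q2 V2W by blast
    have y: "y q \<noteq> 0" using y_nz[OF q] .
    define X where "X = grad x q" define Y where "Y = grad y q" define Z where "Z = grad z q"
    have gf0: "GDERIV f0 q :> deriv f (x q) *\<^sub>R X"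
      unfolding X_def
      by (rule GDERIV_transform[OF GDERIV_DERIV_compose[OF GDERIV_x[OF q] f'] c2.V q2]) (simp add: f)
    have gh: "GDERIV h q :> f'' (x q) *\<^sub>R X"
      unfolding X_def h_def[abs_def] by (rule GDERIV_DERIV_compose[OF GDERIV_x[OF q] f''])
    have "(\<lambda>t. 2 * kder \<epsilon> t) differentiable (at (x q))"
    proof -
      have "sin differentiable (at (x q))" "cos differentiable (at (x q))" "kfun \<epsilon> differentiable (at (x q))"
        using DERIV_sin DERIV_cos DERIV_kfun[OF sin_nz[OF q] cos_nz[OF q]] real_differentiable_def by blast+
      then show ?thesis
        unfolding kder_def using sin_nz[OF q] cos_nz[OF q]
        by (intro derivative_intros) simp_all
    qed
    then obtain d where d: "((\<lambda>t. 2 * kder \<epsilon> t) has_real_derivative d) (at (x q))"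
      using real_differentiable_def by blast
    define gm where "gm = d + 2 * k q * deriv f (x q) + f0 q * 2 * kder \<epsilon> (x q)"
    have gm: "GDERIV m q :> gm *\<^sub>R X"
      unfolding m_def[abs_def] gm_def
      by (rule GDERIV_subst[OF GDERIV_add[OF GDERIV_add[OF GDERIV_DERIV_compose[OF GDERIV_x[OF q] d] GDERIV_const]
            GDERIV_mult[OF GDERIV_mult[OF GDERIV_const GDERIV_k[OF q]] gf0]]])
         (simp add: X_def algebra_simps)
    have yy: "GDERIV (\<lambda>q. (y q)^2) q :> (2 * y q) *\<^sub>R Y"
      unfolding power2_eq_square Y_def
      by (rule GDERIV_subst[OF GDERIV_mult[OF GDERIV_y[OF q] GDERIV_y[OF q]]]) (simp add: two_times_vec)
    have lny: "GDERIV (\<lambda>q. ln \<bar>y q\<bar>) q :> (1 / y q) *\<^sub>R Y"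
      using GDERIV_DERIV_compose[OF GDERIV_y[OF q] DERIV_ln_abs[OF y]] by (simp add: Y_def divide_inverse)
    have ff: "GDERIV (\<lambda>q. (f0 q)^2) q :> (2 * f0 q * deriv f (x q)) *\<^sub>R X"
      unfolding power2_eq_square
      by (rule GDERIV_subst[OF GDERIV_mult[OF gf0 gf0]]) (simp add: two_times_vec)
    have "y q ^ 2 \<noteq> 0" using y by simp
    note D = GDERIV_add[OF GDERIV_add[OF GDERIV_diff[OF GDERIV_divide[OF GDERIV_smooth[OF smooth_N(2) q] yy this]
              GDERIV_divide[OF gm GDERIV_y[OF q] y]] GDERIV_mult[OF GDERIV_add[OF GDERIV_add[OF ff gh] GDERIV_const[of 1]] lny]]
              GDERIV_divide[OF GDERIV_mult[OF GDERIV_z[OF q] gf0] yy this]]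
    have "grad g0 q \<times> X = (1 / (y q)^2) *\<^sub>R (grad N10 q \<times> X) +
        (- (2 * N10 q / (y q)^3) + m q / (y q)^2 + ((f0 q)^2 + h q + 1) / y q - 2 * z q * f0 q / (y q)^3) *\<^sub>R (Y \<times> X)
        + (f0 q / (y q)^2) *\<^sub>R (Z \<times> X)"
      unfolding GDERIV_grad[OF D, folded g0_def[abs_def]] X_def[symmetric] Y_def[symmetric] Z_def[symmetric]
      using y
      by (simp add: tp_simps algebra_simps power2_eq_square power3_eq_cube add_divide_distrib)
    also have "grad N10 q \<times> X = (2 * N10 q / y q - y q - (1 - \<epsilon>) + f0 q * N20 q - y q * h q - 2 * kder \<epsilon> (x q)) *\<^sub>R
      (Y \<times> X) - f0 q *\<^sub>R (Z \<times> X)"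
      unfolding X_def Y_def Z_def h_def by (rule grad_N10[OF q GDERIV_grad[OF gf0[unfolded X_def]]])
    also have "(1 / (y q)^2) *\<^sub>R \<dots> + (- (2 * N10 q / (y q)^3) + m q / (y q)^2 + ((f0 q)^2 + h q + 1) / y q - 2 * z q * f0 q / (y q)^3) *\<^sub>R (Y \<times> X)
        + (f0 q / (y q)^2) *\<^sub>R (Z \<times> X) =
        ((1 / (y q)^2) * (2 * N10 q / y q - y q - (1 - \<epsilon>) + f0 q * N20 q - y q * h q - 2 * kder \<epsilon> (x q))
          + (- (2 * N10 q / (y q)^3) + m q / (y q)^2 + ((f0 q)^2 + h q + 1) / y q - 2 * z q * f0 q / (y q)^3)) *\<^sub>R (Y \<times> X)"
      by (simp only: scaleR_diff_right scaleR_add_left scaleR_scaleR) simp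
    \<comment> \<open>Through \<open>N20\<close> the first summand contains -(f^2 + f' + 1)/y, which
      the derivative of the logarithm compensates: this is where the logarithm in \<open>N1\<close>
      comes from.\<close>
    also have "(1 / (y q)^2) * (2 * N10 q / y q - y q - (1 - \<epsilon>) + f0 q * N20 q - y q * h q - 2 * kder \<epsilon> (x q))
          + (- (2 * N10 q / (y q)^3) + m q / (y q)^2 + ((f0 q)^2 + h q + 1) / y q - 2 * z q * f0 q / (y q)^3) = 0"
      unfolding m_def N20_def using y by (simp add: field_simps power2_eq_square power3_eq_cube)
    finally show ?thesis by (simp add: X_def)
  qed
  have r2: "0 < r / 2" using r by simp
  \<comment> \<open>A second shrinking, from r/2 to r/4: \<open>g0\<close> contains
    \<open>deriv f\<close>, so f has to be settled first.\<close>
  from c2.extended_function_of_first_coordinate[OF V2(2,4) r2 smooth_g0 par, of 2]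
  obtain g V where V: "coordinate_chart V x y z" "p \<in> V" "V \<subseteq> V2" and g: "Ck_on 2 UNIV g" "\<And>q. q \<in> V \<Longrightarrow> g0 q = g (x q)"
    by blast
  have "n1 q = (1 / (y q)^2) *\<^sub>R (N1 \<epsilon> f g (x q) (y q) (z q) *\<^sub>R grad x q
              + N2 \<epsilon> f (x q) (y q) (z q) *\<^sub>R grad y q - grad z q)" if qV: "q \<in> V" for q
  proof -
    have q2: "q \<in> V2" and q: "q \<in> W" using qV V V2W by auto
    have y: "y q \<noteq> 0" using y_nz[OF q] .
    have "N20 q = N2 \<epsilon> f (x q) (y q) (z q)"
      by (simp add: N2_kfun[OF eps sin_nz[OF q] cos_nz[OF q] y] N20_def f(2)[OF q2])
    moreover have "N10 q = N1 \<epsilon> f g (x q) (y q) (z q)"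
    proof -
      have "N10 q = (y q)^2 * g0 q + y q * m q - ((f0 q)^2 + h q + 1) * (y q)^2 * ln \<bar>y q\<bar> - z q * f0 q"
        unfolding g0_def using y by (simp add: field_simps power2_eq_square)
      then show ?thesis
        by (simp add: N1_kfun[OF eps sin_nz[OF q] cos_nz[OF q]] g(2)[OF qV] f(2)[OF q2] h_def m_def)
    qed
    ultimately show ?thesis using n1_eq'[OF q] by simp
  qed
  then show ?thesis
    using V f(1) g(1) V2W by blast
qed

end

section \<open>From the manifold to a chart\<close>

text \<open>2-forms on 3-space correspond to vectors through antisymmetric matrices. The map is
  linear and injective, so equations between 2-forms become equations between cross products and
  curls.\<close>

definition skew :: "real^3 \<Rightarrow> real^3^3" where
  "skew K = vector [vector [0, K$3, - K$2], vector [- K$3, 0, K$1], vector [K$2, - K$1, 0]]"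

lemma skew_add: "skew (K + L) = skew K + skew L"
  and skew_scaleR: "skew (r *\<^sub>R K) = r *\<^sub>R skew K"
  by (simp_all add: skew_def vec_eq_iff forall_3)

lemma skew_eq_iff: "skew K = skew L \<longleftrightarrow> K = L"
  by (auto simp: skew_def vec_eq_iff forall_3)

lemma wedge_skew: "wedge \<alpha> \<beta> c p = skew (\<alpha> c p \<times> \<beta> c p)"
  by (simp add: wedge_def skew_def cross3_def vec_eq_iff forall_3)

lemma ext_deriv_skew:
  assumes "has_curl (\<alpha> c \<circ> chart_inv c) K (chart_map c p)"
  shows "ext_deriv \<alpha> c p = skew K"
  unfolding has_curl_pd[OF assms]
  by (simp add: ext_deriv_def partial_def skew_def vec_eq_iff forall_3 comp_def)

lemma differential_grad: "differential h c p = grad (h \<circ> chart_inv c) (chart_map c p)"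
  by (simp add: differential_def partial_def grad_def)

text \<open>The first two forms annihilate their cross product; uniqueness is Cramer's rule.\<close>

lemma dual_e3_eq:
  assumes "(\<omega>1 c p \<times> \<omega>2 c p) \<bullet> \<omega>3 c p \<noteq> 0"
  shows "dual_e3 \<omega>1 \<omega>2 \<omega>3 c p = inverse ((\<omega>1 c p \<times> \<omega>2 c p) \<bullet> \<omega>3 c p) *\<^sub>R (\<omega>1 c p \<times> \<omega>2 c p)"
  unfolding dual_e3_def
proof (rule the_equality)
  have tr: "u \<bullet> (v \<times> w) = (u \<times> v) \<bullet> w" for u v w :: "real^3"
    by (simp add: cross3_def inner_vec_def sum_3 algebra_simps)
  show "\<omega>1 c p \<bullet> (inverse ((\<omega>1 c p \<times> \<omega>2 c p) \<bullet> \<omega>3 c p) *\<^sub>R (\<omega>1 c p \<times> \<omega>2 c p)) = 0 \<and>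
    \<omega>2 c p \<bullet> (inverse ((\<omega>1 c p \<times> \<omega>2 c p) \<bullet> \<omega>3 c p) *\<^sub>R (\<omega>1 c p \<times> \<omega>2 c p)) = 0 \<and>
    \<omega>3 c p \<bullet> (inverse ((\<omega>1 c p \<times> \<omega>2 c p) \<bullet> \<omega>3 c p) *\<^sub>R (\<omega>1 c p \<times> \<omega>2 c p)) = 1"
    using assms by (simp add: dot_cross_self inner_commute[of "\<omega>3 c p"])
  show "v = inverse ((\<omega>1 c p \<times> \<omega>2 c p) \<bullet> \<omega>3 c p) *\<^sub>R (\<omega>1 c p \<times> \<omega>2 c p)"
    if "\<omega>1 c p \<bullet> v = 0 \<and> \<omega>2 c p \<bullet> v = 0 \<and> \<omega>3 c p \<bullet> v = 1" for v
    using triple_product_dual_basis[of "\<omega>1 c p" "\<omega>2 c p" "\<omega>3 c p" v] that assms by (simp add: tr)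
qed

lemma det_triple: "det (vector [u, v, w] :: real^3^3) = (u \<times> v) \<bullet> w"
  by (simp add: det_3 cross3_def inner_vec_def sum_3 algebra_simps)

section \<open>Charts and changes of charts\<close>

lemma class_on_infinity: "class_on \<infinity> S f \<longleftrightarrow> (\<forall>n. Ck_on n S f)"
  by (simp add: class_on_def)

lemma is_chart_props:
  assumes "is_chart c"
  shows "open (chart_dom c)" "open (chart_image c)" "continuous_on (chart_dom c) (chart_map c)"
    "continuous_on (chart_image c) (chart_inv c)"
    "\<And>p. p \<in> chart_dom c \<Longrightarrow> chart_inv c (chart_map c p) = p"
    "\<And>u. u \<in> chart_image c \<Longrightarrow> chart_map c (chart_inv c u) = u"
    "\<And>u. u \<in> chart_image c \<Longrightarrow> chart_inv c u \<in> chart_dom c"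
  using assms unfolding is_chart_def homeomorphism_def by - (elim conjE, (assumption | blast))+

lemma open_chart_image_Int:
  assumes "is_chart c" "open S"
  shows "open (chart_map c ` (chart_dom c \<inter> S))"
proof -
  have "chart_map c ` (chart_dom c \<inter> S) = chart_image c \<inter> chart_inv c -` S"
    using is_chart_props(5-7)[OF assms(1)] by force
  then show ?thesis
    using continuous_open_preimage[OF is_chart_props(4,2)[OF assms(1)] assms(2)] by simp
qed

locale manifold_atlas =
  fixes A :: "'m::{t2_space, second_countable_topology} chart set"
  assumes atlas: "smooth_atlas A"
begin

lemma chart: "c \<in> A \<Longrightarrow> is_chart c"
  using atlas by (auto simp: smooth_atlas_def compatible_chart_def)

lemma transition: "c \<in> A \<Longrightarrow> d \<in> A \<Longrightarrow> Ck_on n (chart_map c ` (chart_dom c \<inter> chart_dom d)) (chart_map d \<circ> chart_inv c)"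
  using atlas by (auto simp: smooth_atlas_def compatible_chart_def smooth_transition_def class_on_infinity)

text \<open>Change of the components of a 1-form from chart c to chart d. Its linearity carries
  identities between forms from one chart to another.\<close>

definition transfer :: "'m chart \<Rightarrow> 'm chart \<Rightarrow> 'm \<Rightarrow> real^3 \<Rightarrow> real^3" where
  "transfer c d p v = (\<chi> i. \<Sum>j\<in>UNIV. v $ j * partial d (\<lambda>q. chart_map c q $ j) p i)"

lemma linear_transfer: "linear (transfer c d p)"
  by (rule linearI) (simp_all add: transfer_def vec_eq_iff sum_3 algebra_simps)

lemma form1_transfer:
  assumes "is_form1 A k \<alpha>" "c \<in> A" "d \<in> A" "p \<in> chart_dom c" "p \<in> chart_dom d"
  shows "\<alpha> d p = transfer c d p (\<alpha> c p)"
  using assms by (simp add: is_form1_def transfer_def vec_eq_iff)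

text \<open>For forms the transformation law is part of \<open>is_form1\<close>; for differentials
  it comes from the chain rule.\<close>

lemma differential_transfer:
  assumes c: "c \<in> A" and d: "d \<in> A" and pc: "p \<in> chart_dom c" and pd: "p \<in> chart_dom d"
    and h: "(h \<circ> chart_inv c) differentiable (at (chart_map c p))"
  shows "differential h d p = transfer c d p (differential h c p)"
proof -
  note cc = is_chart_props[OF chart[OF c]] and dd = is_chart_props[OF chart[OF d]]
  define S where "S = chart_map d ` (chart_dom d \<inter> chart_dom c)"
  define \<tau> where "\<tau> = chart_map c \<circ> chart_inv d"
  have S: "open S" "chart_map d p \<in> S"
    unfolding S_def using open_chart_image_Int[OF chart[OF d] cc(1)] pc pd by auto
  have \<tau>p: "\<tau> (chart_map d p) = chart_map c p" by (simp add: \<tau>_def dd(5)[OF pd])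
  have \<tau>: "(\<tau> has_derivative frechet_derivative \<tau> (at (chart_map d p))) (at (chart_map d p))"
    by (rule Ck_on_SucD[OF transition[OF d c, of "Suc 0", folded S_def \<tau>_def] S(2)])
  have "(h \<circ> chart_inv c has_derivative (\<lambda>v. v \<bullet> differential h c p)) (at (\<tau> (chart_map d p)))"
    using differentiable_GDERIV[OF h] by (simp add: gderiv_def differential_grad \<tau>p)
  from has_derivative_compose[OF \<tau> this]
  have "((\<lambda>u. (h \<circ> chart_inv c) (\<tau> u)) has_derivative
      (\<lambda>v. frechet_derivative \<tau> (at (chart_map d p)) v \<bullet> differential h c p)) (at (chart_map d p))" .
  then have "(h \<circ> chart_inv d has_derivative
      (\<lambda>v. frechet_derivative \<tau> (at (chart_map d p)) v \<bullet> differential h c p)) (at (chart_map d p))"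
    by (rule has_derivative_transform_within_open[OF _ S]) (auto simp: S_def \<tau>_def cc dd)
  from frechet_derivative_at[OF this, symmetric]
  have "partial d h p i = frechet_derivative \<tau> (at (chart_map d p)) (axis i 1) \<bullet> differential h c p" for i
    by (simp add: partial_def)
  moreover have "partial d (\<lambda>q. chart_map c q $ j) p i = frechet_derivative \<tau> (at (chart_map d p)) (axis i 1) $ j" for i j
    using frechet_derivative_vec_nth[OF \<tau>] by (simp add: partial_def comp_def \<tau>_def)
  ultimately show ?thesis
    by (simp add: transfer_def differential_def[of h d] vec_eq_iff inner_vec_def mult.commute)
qed

text \<open>The chart asked for is (\<zeta>, \<zeta>3, \<zeta>33), whereas the normal form is
  written in \<delta> times these functions. Scaling by \<delta> is its own inverse and passes from
  one to the other.\<close>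

lemma compatible_chart_scaled:
  fixes \<delta> :: real and \<phi> :: "'m \<Rightarrow> real^3"
  assumes c: "c \<in> A" and V0: "coordinate_chart V0 x y z" and sub: "V0 \<subseteq> chart_image c"
    and \<delta>: "\<delta> * \<delta> = 1"
    and \<phi>: "\<And>q. q \<in> chart_dom c \<Longrightarrow> chart_map c q \<in> V0 \<Longrightarrow> \<phi> q = \<delta> *\<^sub>R coords x y z (chart_map c q)"
  defines "V \<equiv> chart_inv c ` V0"
  shows "open V" "compatible_chart A (V, \<phi>)"
proof -
  interpret cc: coordinate_chart V0 x y z by (rule V0)
  note c' = is_chart_props[OF chart[OF c]]
  have V: "V = chart_dom c \<inter> chart_map c -` V0"
    using sub c'(5-7) unfolding V_def by force
  show oV: "open V" unfolding V by (rule continuous_open_preimage[OF c'(3,1) cc.V])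
  have \<phi>V: "\<phi> q = \<delta> *\<^sub>R cc.F (chart_map c q)" "chart_map c q \<in> V0" "q \<in> chart_dom c" if "q \<in> V" for q
    using that \<phi> V by auto
  have \<delta>u: "\<delta> *\<^sub>R \<delta> *\<^sub>R u = u" for u :: "real^3" using \<delta> by simp
  define S where "S = (\<lambda>u. \<delta> *\<^sub>R u) -` (cc.F ` V0)"
  have lin: "bounded_linear (\<lambda>u::real^3. \<delta> *\<^sub>R u)" by (rule bounded_linear_scaleR_right)
  have oS: "open S"
    unfolding S_def by (rule open_vimage[OF cc.open_image linear_continuous_on[OF lin]])
  have \<phi>S: "\<phi> ` V = S"
  proof
    show "\<phi> ` V \<subseteq> S" using \<phi>V by (auto simp: S_def \<delta>)
    show "S \<subseteq> \<phi> ` V"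
    proof
      fix u assume "u \<in> S"
      then obtain v where v: "v \<in> V0" "\<delta> *\<^sub>R u = cc.F v" by (auto simp: S_def)
      have "chart_inv c v \<in> V" using v by (simp add: V_def)
      moreover have "\<phi> (chart_inv c v) = u"
        using \<phi>V(1)[OF calculation] v c'(6)[of v] sub \<delta>u[of u] by auto
      ultimately show "u \<in> \<phi> ` V" by blast
    qed
  qed
  \<comment> \<open>The inverse of \<open>\<phi>\<close>: back through the coordinates x, y, z and
    then through the original chart c.\<close>
  define H where "H u = chart_inv c (cc.G (\<delta> *\<^sub>R u))" for u
  have H\<phi>: "H (\<phi> q) = q" if "q \<in> V" for q
    using \<phi>V[OF that] by (simp add: H_def \<delta>u cc.G_F c'(5) del: scaleR_scaleR)
  then have inj: "inj_on \<phi> V" by (rule inj_on_inverseI)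
  have inv: "chart_inv (V, \<phi>) u = H u" if "u \<in> S" for u
    using that H\<phi> inv_into_f_f[OF inj] \<phi>S by (auto simp: chart_inv_def)
  have G_mem: "cc.G (\<delta> *\<^sub>R u) \<in> V0" if "u \<in> S" for u
    using that cc.G_mem by (simp add: S_def)
  have G_Ck: "Ck_on n S (\<lambda>u. cc.G (\<delta> *\<^sub>R u))" for n
    by (rule Ck_on_compose[OF oS cc.open_image Ck_on_linear[OF lin oS] cc.Ck_on_G]) (auto simp: S_def)
  have "continuous_on S H"
    unfolding H_def[abs_def]
    by (rule continuous_on_compose2[OF c'(4) Ck_on_imp_continuous[OF G_Ck]]) (use G_mem sub in auto)
  then have cinv: "continuous_on S (chart_inv (V, \<phi>))"
    by (simp add: inv cong: continuous_on_cong)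
  have "continuous_on V (\<lambda>q. \<delta> *\<^sub>R cc.F (chart_map c q))"
    by (intro continuous_intros continuous_on_compose2[OF Ck_on_imp_continuous[OF cc.Ck_on_coords]]
        continuous_on_subset[OF c'(3)]) (auto simp: V)
  then have "continuous_on V \<phi>" by (simp add: \<phi>V(1) cong: continuous_on_cong)
  then have hom: "homeomorphism V S \<phi> (chart_inv (V, \<phi>))"
    using cinv H\<phi> \<phi>S inv by (intro homeomorphismI) force+
  then have ch: "is_chart (V, \<phi>)"
    using oV oS \<phi>S by (simp add: is_chart_def)
  have "smooth_transition (V, \<phi>) d" "smooth_transition d (V, \<phi>)" if d: "d \<in> A" for d
  proof -
    note d' = is_chart_props[OF chart[OF d]]
    define S1 where "S1 = \<phi> ` (V \<inter> chart_dom d)"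
    have oS1: "open S1" using open_chart_image_Int[OF ch d'(1)] by (simp add: S1_def)
    have S1S: "S1 \<subseteq> S" using \<phi>S by (auto simp: S1_def)
    define T1 where "T1 = chart_map c ` (chart_dom c \<inter> chart_dom d)"
    have oT1: "open T1" unfolding T1_def by (rule open_chart_image_Int[OF chart[OF c] d'(1)])
    have "cc.G (\<delta> *\<^sub>R u) \<in> T1" if u: "u \<in> S1" for u
    proof -
      obtain q where q: "q \<in> V" "q \<in> chart_dom d" "u = \<phi> q" using u unfolding S1_def by blast
      then have "cc.G (\<delta> *\<^sub>R u) = chart_map c q" using \<phi>V[OF q(1)] by (simp add: \<delta>u cc.G_F del: scaleR_scaleR)
      then show ?thesis using \<phi>V(3)[OF q(1)] q by (auto simp: T1_def)
    qed
    then have "Ck_on n S1 (\<lambda>u. (chart_map d \<circ> chart_inv c) (cc.G (\<delta> *\<^sub>R u)))" for n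
      by (intro Ck_on_compose[OF oS1 oT1 Ck_on_subset[OF G_Ck S1S] transition[OF c d, folded T1_def]]) auto
    moreover have "(chart_map d \<circ> chart_inv (V, \<phi>)) u = (chart_map d \<circ> chart_inv c) (cc.G (\<delta> *\<^sub>R u))"
      if "u \<in> S1" for u
      using inv[of u] that S1S by (auto simp: H_def)
    ultimately have "Ck_on n S1 (chart_map d \<circ> chart_inv (V, \<phi>))" for n
      using Ck_on_cong[OF oS1, of "chart_map d \<circ> chart_inv (V, \<phi>)"
          "\<lambda>u. (chart_map d \<circ> chart_inv c) (cc.G (\<delta> *\<^sub>R u))" n] by blast
    then show "smooth_transition (V, \<phi>) d"
      by (simp add: smooth_transition_def class_on_infinity S1_def)
    define S2 where "S2 = chart_map d ` (chart_dom d \<inter> V)"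
    have oS2: "open S2" unfolding S2_def by (rule open_chart_image_Int[OF chart[OF d] oV])
    have S2: "S2 \<subseteq> chart_map d ` (chart_dom d \<inter> chart_dom c)" using V by (auto simp: S2_def)
    have mem: "(chart_map c \<circ> chart_inv d) u \<in> V0" "chart_inv d u \<in> V" if "u \<in> S2" for u
      using that \<phi>V d'(5) by (auto simp: S2_def)
    have "Ck_on n S2 (\<lambda>u. cc.F ((chart_map c \<circ> chart_inv d) u))" for n
      by (rule Ck_on_compose[OF oS2 cc.V Ck_on_subset[OF transition[OF d c] S2] cc.Ck_on_coords]) (use mem in auto)
    then have "Ck_on n S2 (\<lambda>u. \<delta> *\<^sub>R cc.F ((chart_map c \<circ> chart_inv d) u))" for n
      by (intro Ck_on_scaleR Ck_on_const oS2)
    moreover have "(\<phi> \<circ> chart_inv d) u = \<delta> *\<^sub>R cc.F ((chart_map c \<circ> chart_inv d) u)" if "u \<in> S2" for u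
      using \<phi>V(1)[OF mem(2)[OF that]] by simp
    ultimately have "Ck_on n S2 (\<phi> \<circ> chart_inv d)" for n
      using Ck_on_cong[OF oS2, of "\<phi> \<circ> chart_inv d"
          "\<lambda>u. \<delta> *\<^sub>R cc.F ((chart_map c \<circ> chart_inv d) u)" n] by blast
    then show "smooth_transition d (V, \<phi>)"
      by (simp add: smooth_transition_def class_on_infinity S2_def)
  qed
  with ch show "compatible_chart A (V, \<phi>)" by (simp add: compatible_chart_def)
qed

lemma exists_normal_form:
  assumes eps: "\<epsilon> \<in> {1, -1}" and del: "\<delta> \<in> {1, -1}"
    and ac: "adapted_coframing A \<infinity> \<epsilon> \<delta> \<omega>1 \<omega>2 \<omega>3 A1 A2 A3 \<zeta> C C3"
    and e3: "is_e3_deriv A \<omega>1 \<omega>2 \<omega>3 \<zeta> \<zeta>3" "is_e3_deriv A \<omega>1 \<omega>2 \<omega>3 \<zeta>3 \<zeta>33"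
    and U: "open U" "U \<subseteq> manifold_points A" "\<And>q. q \<in> U \<Longrightarrow> A1 q = 0 \<and> A2 q = 0"
    and p: "p \<in> U" "0 < \<zeta> p" "\<zeta> p < pi / 4"
  shows "\<exists>V f g. open V \<and> p \<in> V \<and> V \<subseteq> U \<and>
             compatible_chart A (V, \<lambda>q. vector [\<zeta> q, \<zeta>3 q, \<zeta>33 q]) \<and>
             (\<forall>q\<in>V. 0 < \<zeta> q \<and> \<zeta> q < pi / 4 \<and> \<zeta>3 q \<noteq> 0) \<and>
             Ck_on 3 (UNIV :: real set) f \<and> Ck_on 2 (UNIV :: real set) g \<and>
             has_normal_form_on A V \<epsilon> f g
               (\<lambda>q. \<delta> * \<zeta> q) (\<lambda>q. \<delta> * \<zeta>3 q) (\<lambda>q. \<delta> * \<zeta>33 q) \<omega>1 \<omega>2 \<omega>3"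
proof -
  obtain c where c: "c \<in> A" "p \<in> chart_dom c"
    using U(2) p(1) by (auto simp: manifold_points_def)
  note c' = is_chart_props[OF chart[OF c(1)]]
  define \<psi> where "\<psi> = chart_inv c"
  define D where "D = chart_image c"
  note c'' = c'[folded \<psi>_def D_def]
  have cf: "is_form1 A \<infinity> \<omega>1" "is_form1 A \<infinity> \<omega>2" "is_form1 A \<infinity> \<omega>3"
    and se: "structure_equations A \<epsilon> \<delta> \<omega>1 \<omega>2 \<omega>3 A1 A2 A3 \<zeta> C C3"
    using ac by (auto simp: adapted_coframing_def is_coframing_def)
  define w1 where "w1 = \<omega>1 c \<circ> \<psi>" define w2 where "w2 = \<omega>2 c \<circ> \<psi>" define w3 where "w3 = \<omega>3 c \<circ> \<psi>"
  have smooth_w: "Ck_on n D w1" "Ck_on n D w2" "Ck_on n D w3" for n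
    using cf c(1) by (auto simp: is_form1_def class_on_infinity D_def \<psi>_def w1_def w2_def w3_def)
  have smooth_f: "Ck_on n D (A3 \<circ> \<psi>)" "Ck_on n D (\<zeta> \<circ> \<psi>)" "Ck_on n D (C \<circ> \<psi>)" for n
    using ac c(1) by (auto simp: adapted_coframing_def fun_class_def class_on_infinity D_def \<psi>_def)
  \<comment> \<open>The part of the chart on which A1 = A2 = 0 holds and the angle is in range, so
    that sine and cosine do not vanish.\<close>
  define B where "B = {u \<in> D. \<psi> u \<in> U \<and> 0 < \<zeta> (\<psi> u) \<and> \<zeta> (\<psi> u) < pi / 4}"
  have BD: "B \<subseteq> D" by (auto simp: B_def)
  have "B = (D \<inter> \<psi> -` U) \<inter> (D \<inter> (\<zeta> \<circ> \<psi>) -` {0<..<pi/4})" by (auto simp: B_def)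
  then have oB: "open B"
    using continuous_open_preimage[OF c''(4,2) U(1)]
      continuous_open_preimage[OF Ck_on_imp_continuous[OF smooth_f(2)] c''(2) open_greaterThanLessThan] by auto
  have T: "(w1 u \<times> w2 u) \<bullet> w3 u \<noteq> 0" if "u \<in> D" for u
    using ac c(1) c''(7)[OF that]
    by (auto simp: adapted_coframing_def is_coframing_def det_triple w1_def w2_def w3_def)
  have e3_deriv: "h3 (\<psi> u) = grad (h \<circ> \<psi>) u \<bullet> (w1 u \<times> w2 u) / ((w1 u \<times> w2 u) \<bullet> w3 u)"
    if "is_e3_deriv A \<omega>1 \<omega>2 \<omega>3 h h3" "u \<in> D" for h h3 u
  proof -
    have "(\<omega>1 c (\<psi> u) \<times> \<omega>2 c (\<psi> u)) \<bullet> \<omega>3 c (\<psi> u) \<noteq> 0"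
      using T[OF that(2)] by (simp add: w1_def w2_def w3_def)
    from dual_e3_eq[of \<omega>1 c "\<psi> u" \<omega>2 \<omega>3, OF this] that c(1) c''(7)[OF that(2)] c''(6)[OF that(2)]
    show ?thesis
      by (simp add: is_e3_deriv_def differential_grad w1_def w2_def w3_def divide_inverse \<psi>_def[symmetric] mult.commute)
  qed
  \<comment> \<open>\<zeta>3 and \<zeta>33 inherit smoothness from the explicit formula for the dual
    vector.\<close>
  have smooth_e3: "Ck_on n D (h3 \<circ> \<psi>)" if "is_e3_deriv A \<omega>1 \<omega>2 \<omega>3 h h3" "\<And>n. Ck_on n D (h \<circ> \<psi>)" for h h3 n
  proof -
    have "Ck_on n D (\<lambda>u. grad (h \<circ> \<psi>) u \<bullet> (w1 u \<times> w2 u) / ((w1 u \<times> w2 u) \<bullet> w3 u))"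
      using T by (intro Ck_on_intros c''(2) smooth_w Ck_on_grad that(2))
    then show ?thesis
      using Ck_on_cong[OF c''(2), of "h3 \<circ> \<psi>"] e3_deriv[OF that(1)] by simp
  qed
  note smooth_z3 = smooth_e3[OF e3(1) smooth_f(2)]
  note smooth_z33 = smooth_e3[OF e3(2) smooth_z3]
  define x where "x u = \<delta> * \<zeta> (\<psi> u)" for u
  define y where "y u = \<delta> * \<zeta>3 (\<psi> u)" for u
  define z where "z u = \<delta> * \<zeta>33 (\<psi> u)" for u
  have dx: "grad (\<lambda>u. \<delta> * h (\<psi> u)) u = \<delta> *\<^sub>R grad (h \<circ> \<psi>) u" if "\<And>n. Ck_on n D (h \<circ> \<psi>)" "u \<in> D" for h u
  proof -
    have "GDERIV (h \<circ> \<psi>) u :> grad (h \<circ> \<psi>) u"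
      using that(1)[of "Suc 0"] that(2) by (auto intro!: differentiable_GDERIV)
    from GDERIV_mult[OF GDERIV_const[of \<delta>] this] show ?thesis
      by (intro GDERIV_grad) simp
  qed
  have d2: "\<delta> * \<delta> = 1" using del by auto
  have trig: "sin (x u) = \<delta> * sin (\<zeta> (\<psi> u))" "cos (x u) = cos (\<zeta> (\<psi> u))" for u
    using del by (auto simp: x_def)
  interpret lc: local_coframing \<epsilon> B w1 w2 w3 "A3 \<circ> \<psi>" x y z "C \<circ> \<psi>" "C3 \<circ> \<psi>"
  proof
    show "Ck_on n B w1" "Ck_on n B w2" "Ck_on n B w3" "Ck_on n B (A3 \<circ> \<psi>)" "Ck_on n B (C \<circ> \<psi>)" for n
      using smooth_w smooth_f BD by (blast intro: Ck_on_subset)+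
    show "Ck_on n B x" for n
      unfolding x_def[abs_def] using Ck_on_subset[OF smooth_f(2) BD] oB
      by (intro Ck_on_intros) (simp_all add: comp_def)
    fix u assume uB: "u \<in> B"
    then have u: "u \<in> D" and \<psi>u: "\<psi> u \<in> chart_dom c" "\<psi> u \<in> U" "0 < \<zeta> (\<psi> u)" "\<zeta> (\<psi> u) < pi / 4" and \<chi>u: "chart_map c (\<psi> u) = u"
      using c''(6,7) by (auto simp: B_def)
    show "(w1 u \<times> w2 u) \<bullet> w3 u \<noteq> 0" by (rule T[OF u])
    \<comment> \<open>Differentiability provides some curl, and injectivity of \<open>skew\<close>
      identifies it.\<close>
    have curl: "has_curl (\<omega> c \<circ> \<psi>) K u" if om: "\<And>n. Ck_on n D (\<omega> c \<circ> \<psi>)" "ext_deriv \<omega> c (\<psi> u) = skew K" for \<omega> K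
    proof -
      obtain L where L: "has_curl (\<omega> c \<circ> \<psi>) L u"
        using has_curl_exists om(1)[of "Suc 0"] u by fastforce
      then have "ext_deriv \<omega> c (\<psi> u) = skew L"
        using ext_deriv_skew[of \<omega> c L "\<psi> u"] by (simp add: \<psi>_def[symmetric] \<chi>u)
      then show ?thesis using L om(2) by (simp add: skew_eq_iff)
    qed
    have eqs: "ext_deriv \<omega>1 c (\<psi> u) = skew (((A3 (\<psi> u) - C (\<psi> u)) *\<^sub>R w1 u + w2 u) \<times> w3 u)"
      "ext_deriv \<omega>2 c (\<psi> u) = skew ((\<epsilon> *\<^sub>R w1 u + (A3 (\<psi> u) + C (\<psi> u)) *\<^sub>R w2 u) \<times> w3 u)"
      "ext_deriv \<omega>3 c (\<psi> u) = skew ((sin (x u) *\<^sub>R w1 u + cos (x u) *\<^sub>R w2 u) \<times> w3 u)"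
      "differential C c (\<psi> u) = C3 (\<psi> u) *\<^sub>R w3 u"
      using se c(1) \<psi>u U(3)[OF \<psi>u(2)]
      by (simp_all add: structure_equations_def wedge_skew w1_def w2_def w3_def trig cross_add_left cross_mult_left
          skew_add skew_scaleR)
    show "has_curl w1 ((((A3 \<circ> \<psi>) u - (C \<circ> \<psi>) u) *\<^sub>R w1 u + w2 u) \<times> w3 u) u"
      using curl[OF smooth_w(1)[unfolded w1_def] eqs(1)] by (simp add: w1_def)
    show "has_curl w2 ((\<epsilon> *\<^sub>R w1 u + ((A3 \<circ> \<psi>) u + (C \<circ> \<psi>) u) *\<^sub>R w2 u) \<times> w3 u) u"
      using curl[OF smooth_w(2)[unfolded w2_def] eqs(2)] by (simp add: w2_def)
    show "has_curl w3 ((sin (x u) *\<^sub>R w1 u + cos (x u) *\<^sub>R w2 u) \<times> w3 u) u"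
      using curl[OF smooth_w(3)[unfolded w3_def] eqs(3)] by (simp add: w3_def)
    have "GDERIV (C \<circ> \<psi>) u :> grad (C \<circ> \<psi>) u"
      using smooth_f(3)[of "Suc 0"] u by (auto intro!: differentiable_GDERIV)
    then show "GDERIV (C \<circ> \<psi>) u :> (C3 \<circ> \<psi>) u *\<^sub>R w3 u"
      using eqs(4) by (simp add: differential_grad \<psi>_def[symmetric] \<chi>u)
    show "(C3 \<circ> \<psi>) u \<noteq> 0"
      using ac \<psi>u U(2) by (auto simp: adapted_coframing_def)
    show "sin (x u) \<noteq> 0" "cos (x u) \<noteq> 0"
      using sin_gt_zero[of "\<zeta> (\<psi> u)"] cos_gt_zero[of "\<zeta> (\<psi> u)"] \<psi>u(3,4) del by (auto simp: trig)
    show "y u = grad x u \<bullet> (w1 u \<times> w2 u) / ((w1 u \<times> w2 u) \<bullet> w3 u)"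
      unfolding y_def x_def[abs_def] dx[OF smooth_f(2) u] e3_deriv[OF e3(1) u] by simp
    show "z u = grad y u \<bullet> (w1 u \<times> w2 u) / ((w1 u \<times> w2 u) \<bullet> w3 u)"
      unfolding z_def y_def[abs_def] dx[OF smooth_z3 u] e3_deriv[OF e3(2) u] by simp
  qed (use eps oB in auto)
  define u0 where "u0 = chart_map c p"
  have u0: "u0 \<in> B" "\<psi> u0 = p"
    using c c'(5)[OF c(2)] p by (auto simp: B_def D_def u0_def \<psi>_def)
  obtain V0 f g where V0: "coordinate_chart V0 x y z" "u0 \<in> V0" "V0 \<subseteq> B" and f: "Ck_on 3 UNIV f" and g: "Ck_on 2 UNIV g"
    and n1: "\<And>q. q \<in> V0 \<Longrightarrow> lc.n1 q = (1 / (y q)^2) *\<^sub>R (N1 \<epsilon> f g (x q) (y q) (z q) *\<^sub>R grad x q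
              + N2 \<epsilon> f (x q) (y q) (z q) *\<^sub>R grad y q - grad z q)"
    using lc.local_normal_form[OF u0(1)] by blast
  define V where "V = \<psi> ` V0"
  have V0D: "V0 \<subseteq> chart_image c" using V0(3) BD by (auto simp: D_def)
  have "\<delta> *\<^sub>R coords x y z (chart_map c q) = vector [\<zeta> q, \<zeta>3 q, \<zeta>33 q]" if "q \<in> chart_dom c" for q
    using d2 c''(5)[OF that] by (simp add: coords_def x_def y_def z_def vec_eq_iff forall_3 mult.assoc[symmetric])
  then have cv: "open V" "compatible_chart A (V, \<lambda>q. vector [\<zeta> q, \<zeta>3 q, \<zeta>33 q])"
    using compatible_chart_scaled[OF c(1) V0(1) V0D d2, of "\<lambda>q. vector [\<zeta> q, \<zeta>3 q, \<zeta>33 q]"]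
    by (simp_all add: V_def \<psi>_def)
  have props: "chart_map c q \<in> V0" "chart_map c q \<in> B" "\<psi> (chart_map c q) = q" "q \<in> chart_dom c" if q: "q \<in> V" for q
  proof -
    obtain v where v: "v \<in> V0" "q = \<psi> v" using q by (auto simp: V_def)
    then have "v \<in> B" "v \<in> D" using V0(3) BD by auto
    with v show "chart_map c q \<in> V0" "chart_map c q \<in> B" "\<psi> (chart_map c q) = q" "q \<in> chart_dom c"
      using c''(6,7) by auto
  qed
  have nf: "has_normal_form_on A V \<epsilon> f g (\<lambda>q. \<delta> * \<zeta> q) (\<lambda>q. \<delta> * \<zeta>3 q) (\<lambda>q. \<delta> * \<zeta>33 q) \<omega>1 \<omega>2 \<omega>3"
    unfolding has_normal_form_on_def
  proof (intro ballI)
    fix d q assume d: "d \<in> A" and "q \<in> V \<inter> chart_dom d"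
    then have q: "q \<in> V" "q \<in> chart_dom d" by auto
    define u where "u = chart_map c q"
    have u: "u \<in> V0" "u \<in> B" "\<psi> u = q" "q \<in> chart_dom c" using props[OF q(1)] by (auto simp: u_def)
    define X where "X = (\<lambda>q. \<delta> * \<zeta> q)" define Y where "Y = (\<lambda>q. \<delta> * \<zeta>3 q)" define Z where "Z = (\<lambda>q. \<delta> * \<zeta>33 q)"
    have comp: "X \<circ> \<psi> = x" "Y \<circ> \<psi> = y" "Z \<circ> \<psi> = z"
      by (auto simp: X_def Y_def Z_def x_def y_def z_def)
    have XYZ: "X q = x u" "Y q = y u" "Z q = z u" using u(3) comp by auto
    have diff: "x differentiable (at u)" "y differentiable (at u)" "z differentiable (at u)"
      using lc.GDERIV_x[OF u(2)] lc.GDERIV_y[OF u(2)] lc.GDERIV_z[OF u(2)]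
      by (auto simp: gderiv_def differentiable_def)
    \<comment> \<open>The normal form is known in chart c; \<open>L\<close> carries it to the
      arbitrary chart d.\<close>
    define L where "L = transfer c d q"
    have L: "linear L" unfolding L_def by (rule linear_transfer)
    have dif: "differential X d q = L (grad x u)" "differential Y d q = L (grad y u)" "differential Z d q = L (grad z u)"
      using differential_transfer[OF c(1) d u(4) q(2), folded \<psi>_def u_def, of X]
        differential_transfer[OF c(1) d u(4) q(2), folded \<psi>_def u_def, of Y]
        differential_transfer[OF c(1) d u(4) q(2), folded \<psi>_def u_def, of Z] diff
      by (simp_all add: comp L_def differential_grad \<psi>_def[symmetric] u_def[symmetric])
    have om: "\<omega>1 d q = L (w1 u)" "\<omega>2 d q = L (w2 u)" "\<omega>3 d q = L (w3 u)"
      using form1_transfer[OF cf(1) c(1) d u(4) q(2)] form1_transfer[OF cf(2) c(1) d u(4) q(2)]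
        form1_transfer[OF cf(3) c(1) d u(4) q(2)] by (simp_all add: L_def w1_def w2_def w3_def u(3))
    note lin = linear_add[OF L] linear_diff[OF L] linear_scale[OF L] linear_neg[OF L]
    have e1: "eta1 \<epsilon> f g X Y Z d q = L (lc.n1 u)"
      unfolding n1[OF u(1)] eta1_def dif XYZ lin ..
    have e2: "eta2 X Y Z d q = L (lc.n2 u)"
      unfolding lc.n2_eq[OF u(2)] eta2_def dif XYZ lin ..
    show "\<omega>1 d q = cos (X q) *\<^sub>R eta1 \<epsilon> f g X Y Z d q + sin (X q) *\<^sub>R eta2 X Y Z d q \<and>
        \<omega>2 d q = - sin (X q) *\<^sub>R eta1 \<epsilon> f g X Y Z d q + cos (X q) *\<^sub>R eta2 X Y Z d q \<and>
        \<omega>3 d q = (1 / Y q) *\<^sub>R differential X d q"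
      unfolding e1 e2 om XYZ dif
      using lc.w_eq[of u] lc.w3_eq[OF u(2)] lin by metis
  qed
  have "p \<in> V" using V0(2) u0 by (auto simp: V_def)
  moreover have "V \<subseteq> U" using V0(3) by (auto simp: V_def B_def)
  moreover have "0 < \<zeta> q \<and> \<zeta> q < pi / 4 \<and> \<zeta>3 q \<noteq> 0" if "q \<in> V" for q
    using props[OF that] lc.y_nz[of "chart_map c q"] by (auto simp: B_def y_def)
  ultimately show ?thesis using cv f g nf by blast
qed

end

section \<open>The model coframings\<close>

text \<open>\<open>cfun\<close> is the invariant \<open>C\<close> as a function of \<open>x\<close>.\<close>
definition cfun :: "real \<Rightarrow> real \<Rightarrow> real" where
  "cfun \<epsilon> t = (\<epsilon> * (cos t)^2 - (sin t)^2) / (2 * sin t * cos t)"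

definition cder :: "real \<Rightarrow> real \<Rightarrow> real" where
  "cder \<epsilon> t = - (4 * (\<epsilon> + 1) * (sin t * cos t)^2
     + 2 * (\<epsilon> * (cos t)^2 - (sin t)^2) * ((cos t)^2 - (sin t)^2)) / (2 * sin t * cos t)^2"

lemma DERIV_cfun:
  assumes "sin t \<noteq> 0" "cos t \<noteq> 0"
  shows "(cfun \<epsilon> has_real_derivative cder \<epsilon> t) (at t)"
proof -
  have "((\<lambda>t. (\<epsilon> * (cos t)^2 - (sin t)^2) / (2 * sin t * cos t)) has_real_derivative
    ((\<epsilon> * (2 * cos t * - sin t) - 2 * sin t * cos t) * (2 * sin t * cos t)
      - (\<epsilon> * (cos t)^2 - (sin t)^2) * (2 * cos t * cos t + 2 * sin t * - sin t)) / ((2 * sin t * cos t) * (2 * sin t * cos t))) (at t)"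
    by (rule DERIV_divide) (use assms in \<open>auto intro!: derivative_eq_intros\<close>)
  then show ?thesis
    unfolding cfun_def[abs_def] cder_def
    by (rule DERIV_cong) (use assms in \<open>simp add: field_simps power2_eq_square\<close>)
qed

text \<open>Up to the denominator, the derivative of C is a constant for \<epsilon> = 1 and a
  multiple of cos (2t) for \<epsilon> = -1.\<close>

lemma cder_nonzero:
  assumes "\<epsilon> = 1 \<or> \<epsilon> = -1" "sin t \<noteq> 0" "cos t \<noteq> 0" "cos (2 * t) \<noteq> 0"
  shows "cder \<epsilon> t \<noteq> 0"
proof -
  define s where "s = sin t" define c where "c = cos t"
  have sc: "s^2 + c^2 = 1" by (simp add: s_def c_def)
  have ne: "c^2 - s^2 \<noteq> 0" using assms(4) by (simp add: cos_double s_def c_def)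
  have "4 * (\<epsilon> + 1) * (s * c)^2 + 2 * (\<epsilon> * c^2 - s^2) * (c^2 - s^2) \<noteq> 0"
    using assms(1)
  proof
    assume "\<epsilon> = 1"
    then have "4 * (\<epsilon> + 1) * (s * c)^2 + 2 * (\<epsilon> * c^2 - s^2) * (c^2 - s^2) = 2"
      using sc by algebra
    then show ?thesis by simp
  next
    assume "\<epsilon> = -1"
    then have "4 * (\<epsilon> + 1) * (s * c)^2 + 2 * (\<epsilon> * c^2 - s^2) * (c^2 - s^2) = - (2 * (c^2 - s^2))"
      using sc by algebra
    then show ?thesis using ne by simp
  qed
  then show ?thesis
    using assms(2,3) unfolding cder_def s_def[symmetric] c_def[symmetric] by simp
qed

lemma kfun_cfun:
  assumes "sin t \<noteq> 0" "cos t \<noteq> 0"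
  shows "kfun \<epsilon> t * sin t = \<epsilon> * cos t - cfun \<epsilon> t * sin t" "kfun \<epsilon> t * cos t = sin t + cfun \<epsilon> t * cos t"
  using assms by (simp_all add: cfun_def kfun_def field_simps power2_eq_square)

lemma Ck_on_kfun_cfun:
  assumes "open S" "Ck_on n S h" "\<And>p. p \<in> S \<Longrightarrow> sin (h p) \<noteq> 0" "\<And>p. p \<in> S \<Longrightarrow> cos (h p) \<noteq> 0"
  shows "Ck_on n S (\<lambda>p. kfun \<epsilon> (h p))" "Ck_on n S (\<lambda>p. kder \<epsilon> (h p))"
    "Ck_on n S (\<lambda>p. cfun \<epsilon> (h p))" "Ck_on n S (\<lambda>p. cder \<epsilon> (h p))"
  unfolding kder_def kfun_def cfun_def cder_def using assms by (auto intro!: Ck_on_intros)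

lemma kder_differentiable:
  assumes "sin t \<noteq> 0" "cos t \<noteq> 0"
  shows "\<exists>d. (kder \<epsilon> has_real_derivative d) (at t)" "\<exists>d. (cder \<epsilon> has_real_derivative d) (at t)"
proof -
  have *: "sin differentiable (at t)" "cos differentiable (at t)" "kfun \<epsilon> differentiable (at t)"
    using DERIV_sin DERIV_cos DERIV_kfun[OF assms] real_differentiable_def by blast+
  have "kder \<epsilon> differentiable (at t)" "cder \<epsilon> differentiable (at t)"
    unfolding kder_def[abs_def] cder_def[abs_def] using assms *
    by (auto intro!: derivative_intros)
  then show "\<exists>d. (kder \<epsilon> has_real_derivative d) (at t)" "\<exists>d. (cder \<epsilon> has_real_derivative d) (at t)"
    by (auto simp: real_differentiable_def)
qed

text \<open>In the following locale \<open>n\<close> and \<open>b\<close> are \<open>N\<^sub>1\<close> and \<open>N\<^sub>2\<close>, and \<open>X\<close>, \<open>Y\<close>, \<open>Z\<close> are the gradients of \<open>x\<close>, \<open>y\<close>, \<open>z\<close>.\<close>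
locale model_coframing =
  fixes \<epsilon> \<delta> :: real and f g :: "real \<Rightarrow> real"
  assumes eps: "\<epsilon> = 1 \<or> \<epsilon> = -1" and del: "\<delta> = 1 \<or> \<delta> = -1"
    and f: "Ck_on 3 UNIV f" and g: "Ck_on 2 UNIV g"
begin

text \<open>A point v has the coordinates (\<zeta>, \<zeta>3, \<zeta>33); multiplying them by
  \<delta> treats both signs at once.\<close>

definition x :: "real^3 \<Rightarrow> real" where "x v = \<delta> * v $ 1"
definition y :: "real^3 \<Rightarrow> real" where "y v = \<delta> * v $ 2"
definition z :: "real^3 \<Rightarrow> real" where "z v = \<delta> * v $ 3"
definition X :: "real^3" where "X = \<delta> *\<^sub>R axis 1 1"
definition Y :: "real^3" where "Y = \<delta> *\<^sub>R axis 2 1"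
definition Z :: "real^3" where "Z = \<delta> *\<^sub>R axis 3 1"

lemma GDERIV_xyz: "GDERIV x p :> X" "GDERIV y p :> Y" "GDERIV z p :> Z"
proof -
  have "((\<lambda>v. \<delta> * v $ i) has_derivative (\<lambda>h. h \<bullet> (\<delta> *\<^sub>R axis i 1))) (at p)" for i :: 3
  proof -
    have "(\<lambda>v. \<delta> * v $ i) = (\<lambda>v::real^3. v \<bullet> (\<delta> *\<^sub>R axis i 1))"
      by (simp add: fun_eq_iff cart_eq_inner_axis)
    then show ?thesis by (simp only: bounded_linear_imp_has_derivative[OF bounded_linear_inner_left])
  qed
  then show "GDERIV x p :> X" "GDERIV y p :> Y" "GDERIV z p :> Z"
    unfolding gderiv_def x_def[abs_def] y_def[abs_def] z_def[abs_def] X_def Y_def Z_def by blast+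
qed

lemma open_model_dom: "open model_dom"
proof -
  have eq: "model_dom = {v. 0 < v $ 1} \<inter> {v. v $ 1 < pi / 4} \<inter> - {v. v $ 2 = 0}"
    by (auto simp: model_dom_def)
  show ?thesis
    unfolding eq
    by (intro open_Int open_Compl open_Collect_less closed_Collect_eq continuous_intros)
qed

lemma Ck_on_xyz: "Ck_on n model_dom x" "Ck_on n model_dom y" "Ck_on n model_dom z"
proof -
  have "Ck_on n model_dom (\<lambda>v. \<delta> * v $ i)" for i :: 3
    by (intro Ck_on_mult Ck_on_const open_model_dom Ck_on_linear bounded_linear_vec_nth)
  then show "Ck_on n model_dom x" "Ck_on n model_dom y" "Ck_on n model_dom z"
    unfolding x_def[abs_def] y_def[abs_def] z_def[abs_def] by blast+
qed

lemma nz: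
  assumes "p \<in> model_dom"
  shows "y p \<noteq> 0" "sin (x p) \<noteq> 0" "cos (x p) \<noteq> 0" "cos (2 * x p) \<noteq> 0"
proof -
  have p: "0 < p $ 1" "p $ 1 < pi / 4" "p $ 2 \<noteq> 0" using assms by (auto simp: model_dom_def)
  have "sin (p $ 1) > 0" using p sin_gt_zero[of "p $ 1"] by simp
  moreover have "cos (p $ 1) > 0" using p by (intro cos_gt_zero) simp_all
  moreover have "cos (2 * p $ 1) > 0" using p by (intro cos_gt_zero) simp_all
  ultimately show "y p \<noteq> 0" "sin (x p) \<noteq> 0" "cos (x p) \<noteq> 0" "cos (2 * x p) \<noteq> 0"
    using del p by (auto simp: x_def y_def)
qed

definition H where "H t = (f t)^2 + deriv f t + 1" for t
definition M where "M t = 2 * kder \<epsilon> t + (1 - \<epsilon>) + 2 * kfun \<epsilon> t * f t" for t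
definition n where "n p = (y p)^2 * g (x p) + y p * M (x p) - H (x p) * ((y p)^2 * ln \<bar>y p\<bar>) - z p * f (x p)"
definition b where "b p = 2 * z p / y p - y p * f (x p) - 2 * kfun \<epsilon> (x p)"

definition n1 where "n1 p = (1 / (y p)^2) *\<^sub>R (n p *\<^sub>R X + b p *\<^sub>R Y - Z)"
definition n2 where "n2 p = (z p / (y p)^2) *\<^sub>R X - (1 / y p) *\<^sub>R Y"
definition w1 where "w1 p = cos (x p) *\<^sub>R n1 p + sin (x p) *\<^sub>R n2 p"
definition w2 where "w2 p = - sin (x p) *\<^sub>R n1 p + cos (x p) *\<^sub>R n2 p"
definition w3 where "w3 p = (1 / y p) *\<^sub>R X"
definition A where "A p = y p * f (x p) + kfun \<epsilon> (x p)"

lemma n2_eq: "n2 p = sin (x p) *\<^sub>R w1 p + cos (x p) *\<^sub>R w2 p"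
proof -
  have "sin (x p) *\<^sub>R w1 p + cos (x p) *\<^sub>R w2 p = ((sin (x p))^2 + (cos (x p))^2) *\<^sub>R n2 p"
    unfolding w1_def w2_def by (simp only: power2_eq_square) (simp add: algebra_simps del: sin_cos_squared_add3)
  then show ?thesis by simp
qed

lemma n_eq: "p \<in> model_dom \<Longrightarrow> N1 \<epsilon> f g (x p) (y p) (z p) = n p"
  and b_eq: "p \<in> model_dom \<Longrightarrow> N2 \<epsilon> f (x p) (y p) (z p) = b p"
  using nz[of p] by (simp_all add: N1_kfun[OF eps] N2_kfun[OF eps] n_def b_def M_def H_def)

lemma f': "(f has_real_derivative deriv f t) (at t)" "\<exists>d. (deriv f has_real_derivative d) (at t)"
  "\<exists>d. (g has_real_derivative d) (at t)" "Ck_on 2 UNIV (deriv f)"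
proof -
  note F = Ck_on_deriv[of UNIV 2 f]
  show "(f has_real_derivative deriv f t) (at t)" using f F(2) by (simp add: numeral_3_eq_3 numeral_2_eq_2)
  show f2: "Ck_on 2 UNIV (deriv f)" using f F(1) by (simp add: numeral_3_eq_3 numeral_2_eq_2)
  show "\<exists>d. (deriv f has_real_derivative d) (at t)"
    using f2 Ck_on_deriv(2)[of UNIV 1 "deriv f"] by (auto simp: numeral_2_eq_2)
  show "\<exists>d. (g has_real_derivative d) (at t)"
    using g Ck_on_deriv(2)[of UNIV 1 g] by (auto simp: numeral_2_eq_2)
qed

lemma Ck_on_compose_x: "Ck_on k UNIV h \<Longrightarrow> Ck_on k model_dom (\<lambda>p. h (x p))" for h :: "real \<Rightarrow> real"
  by (rule Ck_on_compose[OF open_model_dom open_UNIV Ck_on_xyz(1)]) auto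

text \<open>The order is governed by \<open>deriv f\<close> and g, both of class C^2, in the
  coefficient \<open>n\<close>.\<close>

lemma Ck_on_forms: "Ck_on 2 model_dom w1" "Ck_on 2 model_dom w2" "Ck_on 2 model_dom w3" "Ck_on 2 model_dom A"
proof -
  note xyz = Ck_on_xyz and o = open_model_dom
  note kc = Ck_on_kfun_cfun[OF o xyz(1) nz(2,3)]
  have fx: "Ck_on 2 model_dom (\<lambda>p. f (x p))"
    by (rule Ck_on_compose_x[OF Ck_on_mono[OF f]]) simp
  note fx' = Ck_on_compose_x[OF f'(4)] and gx = Ck_on_compose_x[OF g]
  have n: "Ck_on 2 model_dom n" "Ck_on 2 model_dom b"
    unfolding n_def[abs_def] b_def[abs_def] M_def H_def using nz(1)
    by (intro Ck_on_intros o xyz kc fx fx' gx; simp)+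
  have n12: "Ck_on 2 model_dom n1" "Ck_on 2 model_dom n2"
    unfolding n1_def[abs_def] n2_def[abs_def] using nz(1)
    by (intro Ck_on_intros o xyz n; simp)+
  show "Ck_on 2 model_dom w1" "Ck_on 2 model_dom w2"
    unfolding w1_def[abs_def] w2_def[abs_def] by (intro Ck_on_intros o xyz n12)+
  show "Ck_on 2 model_dom w3" "Ck_on 2 model_dom A"
    unfolding w3_def[abs_def] A_def[abs_def] using nz(1) by (intro Ck_on_intros o xyz kc fx; simp)+
qed

section \<open>The structure equations of the model\<close>

lemma frame_simps: "Y \<times> X = - (X \<times> Y)" "Z \<times> X = - (X \<times> Z)" "Z \<times> Y = - (Y \<times> Z)"
  by (rule cross_skew)+

lemmas cross_simps = cross_add_left cross_add_right Cross3.left_diff_distrib Cross3.right_diff_distrib cross_mult_left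
  cross_mult_right

lemma n2_cross_w3: "n2 p \<times> w3 p = (1 / (y p)^2) *\<^sub>R (X \<times> Y)"
  unfolding n2_def w3_def by (simp add: cross_simps frame_simps power2_eq_square)

lemma n1_cross_w3: "n1 p \<times> w3 p = (1 / (y p)^3) *\<^sub>R (X \<times> Z - b p *\<^sub>R (X \<times> Y))"
  unfolding n1_def w3_def by (simp add: cross_simps frame_simps power2_eq_square power3_eq_cube algebra_simps)

context
  fixes p assumes p: "p \<in> model_dom"
begin

lemma GDERIV_inverse_y: "GDERIV (\<lambda>p. 1 / y p) p :> (- (1 / (y p)^2)) *\<^sub>R Y"
  by (rule GDERIV_subst[OF GDERIV_divide[OF GDERIV_const GDERIV_xyz(2) nz(1)[OF p]]]) simp

lemma GDERIV_y2: "GDERIV (\<lambda>p. (y p)^2) p :> (2 * y p) *\<^sub>R Y"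
  unfolding power2_eq_square
  by (rule GDERIV_subst[OF GDERIV_mult[OF GDERIV_xyz(2) GDERIV_xyz(2)]]) (simp add: two_times_vec)

lemma has_curl_w3: "has_curl w3 (n2 p \<times> w3 p) p"
  unfolding n2_cross_w3 unfolding w3_def[abs_def]
  by (rule has_curl_eq[OF has_curl_scaleR[OF GDERIV_inverse_y has_curl_const]])
     (simp add: cross_simps frame_simps)

lemma has_curl_n2: "has_curl n2 ((- y p *\<^sub>R n1 p + (A p + kfun \<epsilon> (x p)) *\<^sub>R n2 p) \<times> w3 p) p"
proof -
  have y: "y p \<noteq> 0" "(y p)^2 \<noteq> 0" using nz(1)[OF p] by simp_all
  have "has_curl n2 ((2 * z p / (y p)^3) *\<^sub>R (X \<times> Y) - (1 / (y p)^2) *\<^sub>R (X \<times> Z)) p"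
    unfolding n2_def[abs_def]
    by (rule has_curl_eq[OF has_curl_diff[OF has_curl_scaleR[OF GDERIV_divide[OF GDERIV_xyz(3) GDERIV_y2 y(2)] has_curl_const]
          has_curl_scaleR[OF GDERIV_inverse_y has_curl_const]]])
       (use y in \<open>simp add: cross_simps frame_simps power2_eq_square power3_eq_cube mult_ac\<close>)
  moreover have "(- y p *\<^sub>R n1 p + (A p + kfun \<epsilon> (x p)) *\<^sub>R n2 p) \<times> w3 p =
      (2 * z p / (y p)^3) *\<^sub>R (X \<times> Y) - (1 / (y p)^2) *\<^sub>R (X \<times> Z)"
  proof -
    have "(- y p *\<^sub>R n1 p + (A p + kfun \<epsilon> (x p)) *\<^sub>R n2 p) \<times> w3 p =
      (b p * (1 / (y p)^2) + (A p + kfun \<epsilon> (x p)) * (1 / (y p)^2)) *\<^sub>R (X \<times> Y) - (1 / (y p)^2) *\<^sub>R (X \<times> Z)"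
      using y by (simp add: cross_simps n1_cross_w3 n2_cross_w3 power2_eq_square power3_eq_cube algebra_simps
        add_divide_distrib)
    \<comment> \<open>\<open>b\<close> is made for this cancellation: its terms in f and
      \<open>kfun\<close> compensate those of A + kfun.\<close>
    also have "b p * (1 / (y p)^2) + (A p + kfun \<epsilon> (x p)) * (1 / (y p)^2) = 2 * z p / (y p)^3"
      using y by (simp add: b_def A_def field_simps power2_eq_square power3_eq_cube)
    finally show ?thesis .
  qed
  ultimately show ?thesis by simp
qed

lemma has_curl_n1: "has_curl n1 (((y p * f (x p)) *\<^sub>R n1 p + (y p + 1 - \<epsilon>) *\<^sub>R n2 p) \<times> w3 p) p"
proof -
  have y: "y p \<noteq> 0" "(y p)^2 \<noteq> 0" using nz(1)[OF p] by simp_all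
  have sc: "sin (x p) \<noteq> 0" "cos (x p) \<noteq> 0" using nz[OF p] by simp_all
  obtain f2 g1 k2 where d: "(deriv f has_real_derivative f2) (at (x p))" "(g has_real_derivative g1) (at (x p))"
    "(kder \<epsilon> has_real_derivative k2) (at (x p))"
    using f'(2,3)[of "x p"] kder_differentiable(1)[OF sc] by blast
  note k1 = DERIV_kfun[OF sc, of \<epsilon>]
  define M' where "M' = 2 * k2 + 2 * (kder \<epsilon> (x p) * f (x p) + deriv f (x p) * kfun \<epsilon> (x p))"
  have M': "(M has_real_derivative M') (at (x p))"
    unfolding M_def[abs_def] M'_def
    by (rule DERIV_cong, (rule derivative_intros d k1 f'(1))+) (simp add: algebra_simps)
  define H' where "H' = 2 * f (x p) * deriv f (x p) + f2"
  have H': "(H has_real_derivative H') (at (x p))"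
    unfolding H_def[abs_def] H'_def
    by (rule DERIV_cong, (rule derivative_intros d f'(1))+) (simp add: algebra_simps)
  note comp = GDERIV_DERIV_compose[OF GDERIV_xyz(1)]
  have lny: "GDERIV (\<lambda>p. ln \<bar>y p\<bar>) p :> (1 / y p) *\<^sub>R Y"
    using GDERIV_DERIV_compose[OF GDERIV_xyz(2) DERIV_ln_abs[OF y(1)]] by (simp add: divide_inverse)
  \<comment> \<open>\<open>ny\<close> and \<open>nx\<close> are the derivatives of \<open>n\<close>
    in y and x. The second contains f'' and g', but it enters the curl only with X \<times> X =
    0.\<close>
  define ny where "ny = 2 * y p * g (x p) + M (x p) - H (x p) * (2 * y p * ln \<bar>y p\<bar> + y p)"
  define nx where "nx = (y p)^2 * g1 + y p * M' - (y p)^2 * ln \<bar>y p\<bar> * H' - z p * deriv f (x p)"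
  have gn: "GDERIV n p :> nx *\<^sub>R X + ny *\<^sub>R Y - f (x p) *\<^sub>R Z"
    unfolding n_def[abs_def]
    by (rule GDERIV_subst[OF GDERIV_diff[OF GDERIV_diff[OF GDERIV_add[OF GDERIV_mult[OF GDERIV_y2 comp[OF d(2)]]
          GDERIV_mult[OF GDERIV_xyz(2) comp[OF M']]] GDERIV_mult[OF comp[OF H'] GDERIV_mult[OF GDERIV_y2 lny]]]
          GDERIV_mult[OF GDERIV_xyz(3) comp[OF f'(1)]]]])
       (use y in \<open>simp add: nx_def ny_def algebra_simps power2_eq_square\<close>)
  have gb: "GDERIV b p :> (2 / y p) *\<^sub>R Z - (2 * z p / (y p)^2 + f (x p)) *\<^sub>R Y
      - (y p * deriv f (x p) + 2 * kder \<epsilon> (x p)) *\<^sub>R X"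
    unfolding b_def[abs_def]
    by (rule GDERIV_subst[OF GDERIV_diff[OF GDERIV_diff[OF GDERIV_divide[OF GDERIV_mult[OF GDERIV_const GDERIV_xyz(3)] GDERIV_xyz(2) y(1)]
         GDERIV_mult[OF GDERIV_xyz(2) comp[OF f'(1)]]] GDERIV_mult[OF GDERIV_const comp[OF k1]]]])
       (simp add: algebra_simps)
  have iy2: "GDERIV (\<lambda>p. 1 / (y p)^2) p :> (- (2 / (y p)^3)) *\<^sub>R Y"
    by (rule GDERIV_subst[OF GDERIV_divide[OF GDERIV_const GDERIV_y2 y(2)]])
       (use y in \<open>simp add: power2_eq_square power3_eq_cube\<close>)
  have "has_curl n1 ((1 / (y p)^2) *\<^sub>R ((nx *\<^sub>R X + ny *\<^sub>R Y - f (x p) *\<^sub>R Z) \<times> X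
      + ((2 / y p) *\<^sub>R Z - (2 * z p / (y p)^2 + f (x p)) *\<^sub>R Y - (y p * deriv f (x p) + 2 * kder \<epsilon> (x p)) *\<^sub>R X) \<times> Y)
      + (- (2 / (y p)^3)) *\<^sub>R Y \<times> (n p *\<^sub>R X + b p *\<^sub>R Y - Z)) p"
    unfolding n1_def[abs_def]
    by (rule has_curl_eq[OF has_curl_scaleR[OF iy2 has_curl_diff[OF has_curl_add[OF has_curl_scaleR[OF gn has_curl_const]
          has_curl_scaleR[OF gb has_curl_const]] has_curl_const]]])
       (simp add: cross_mult_left)
  also have "(1 / (y p)^2) *\<^sub>R ((nx *\<^sub>R X + ny *\<^sub>R Y - f (x p) *\<^sub>R Z) \<times> X
      + ((2 / y p) *\<^sub>R Z - (2 * z p / (y p)^2 + f (x p)) *\<^sub>R Y - (y p * deriv f (x p) + 2 * kder \<epsilon> (x p)) *\<^sub>R X) \<times> Y)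
      + (- (2 / (y p)^3)) *\<^sub>R Y \<times> (n p *\<^sub>R X + b p *\<^sub>R Y - Z)
    = (2 * n p / (y p)^3 - (ny + y p * deriv f (x p) + 2 * kder \<epsilon> (x p)) / (y p)^2) *\<^sub>R (X \<times> Y) + (f (x p) / (y p)^2) *\<^sub>R (X \<times> Z)"
    using y by (simp add: cross_simps frame_simps power2_eq_square power3_eq_cube algebra_simps add_divide_distrib)
  \<comment> \<open>Here g and the logarithm cancel between 2 n/y^3 and ny/y^2; differentiating the
    logarithm leaves the summand H/y.\<close>
  also have "2 * n p / (y p)^3 - (ny + y p * deriv f (x p) + 2 * kder \<epsilon> (x p)) / (y p)^2
      = (y p + 1 - \<epsilon>) / (y p)^2 - f (x p) * b p / (y p)^2"
    using y by (simp add: n_def ny_def b_def H_def M_def field_simps power2_eq_square power3_eq_cube)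
  also have "((y p + 1 - \<epsilon>) / (y p)^2 - f (x p) * b p / (y p)^2) *\<^sub>R (X \<times> Y) + (f (x p) / (y p)^2) *\<^sub>R (X \<times> Z)
    = ((y p * f (x p)) *\<^sub>R n1 p + (y p + 1 - \<epsilon>) *\<^sub>R n2 p) \<times> w3 p"
    using y by (simp add: cross_simps n1_cross_w3 n2_cross_w3 power2_eq_square power3_eq_cube algebra_simps
        add_divide_distrib diff_divide_distrib)
  finally show ?thesis .
qed

text \<open>Rotating back by x: differentiating sine and cosine brings in dx = y \<omega>^3, whose
  contributions cancel the terms y \<eta>^2 and -y \<eta>^1 in d\<eta>^1 and d\<eta>^2. What remains
  is \<open>kfun_cfun\<close>.\<close>

lemma has_curl_w12:
  shows "has_curl w1 (((A p - cfun \<epsilon> (x p)) *\<^sub>R w1 p + w2 p) \<times> w3 p) p"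
    and "has_curl w2 ((\<epsilon> *\<^sub>R w1 p + (A p + cfun \<epsilon> (x p)) *\<^sub>R w2 p) \<times> w3 p) p"
proof -
  define s where "s = sin (x p)" define c where "c = cos (x p)"
  have kc: "kfun \<epsilon> (x p) * s = \<epsilon> * c - cfun \<epsilon> (x p) * s" "kfun \<epsilon> (x p) * c = s + cfun \<epsilon> (x p) * c"
    using kfun_cfun[OF nz(2,3)[OF p]] by (simp_all add: s_def c_def)
  have sin: "GDERIV (\<lambda>p. sin (x p)) p :> c *\<^sub>R X" and cos: "GDERIV (\<lambda>p. cos (x p)) p :> (- s) *\<^sub>R X"
    using GDERIV_DERIV_compose[OF GDERIV_xyz(1) DERIV_sin] GDERIV_DERIV_compose[OF GDERIV_xyz(1) DERIV_cos]
    by (simp_all add: s_def c_def)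
  have Xw: "X = y p *\<^sub>R w3 p" using nz(1)[OF p] by (simp add: w3_def)
  have sk: "w3 p \<times> n1 p = - (n1 p \<times> w3 p)" "w3 p \<times> n2 p = - (n2 p \<times> w3 p)" by (rule cross_skew)+
  define Q where "Q = y p * f (x p)"
  have A: "A p = Q + kfun \<epsilon> (x p)" by (simp add: A_def Q_def)
  show "has_curl w1 (((A p - cfun \<epsilon> (x p)) *\<^sub>R w1 p + w2 p) \<times> w3 p) p"
  proof -
    have "has_curl w1 ((c * Q) *\<^sub>R (n1 p \<times> w3 p) + (c * (1 - \<epsilon>) + s * (A p + kfun \<epsilon> (x p))) *\<^sub>R (n2 p \<times> w3 p)) p"
      unfolding w1_def[abs_def]
      by (rule has_curl_eq[OF has_curl_add[OF has_curl_scaleR[OF cos has_curl_n1] has_curl_scaleR[OF sin has_curl_n2]]])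
         (simp add: Xw s_def[symmetric] c_def[symmetric] Q_def[symmetric] cross_simps sk algebra_simps)
    also have "(c * Q) = (A p - cfun \<epsilon> (x p)) * c - s" using kc by (simp add: A algebra_simps)
    also have "c * (1 - \<epsilon>) + s * (A p + kfun \<epsilon> (x p)) = (A p - cfun \<epsilon> (x p)) * s + c" using kc by (simp add: algebra_simps)
    finally show ?thesis
      by (rule has_curl_eq) (simp add: w1_def w2_def s_def c_def cross_simps algebra_simps)
  qed
  show "has_curl w2 ((\<epsilon> *\<^sub>R w1 p + (A p + cfun \<epsilon> (x p)) *\<^sub>R w2 p) \<times> w3 p) p"
  proof -
    have "has_curl w2 ((- (s * Q)) *\<^sub>R (n1 p \<times> w3 p) + (c * (A p + kfun \<epsilon> (x p)) - s * (1 - \<epsilon>)) *\<^sub>R (n2 p \<times> w3 p)) p"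
      unfolding w2_def[abs_def]
      by (rule has_curl_eq[OF has_curl_add[OF has_curl_scaleR[OF GDERIV_minus[OF sin] has_curl_n1] has_curl_scaleR[OF cos has_curl_n2]]])
         (simp add: Xw s_def[symmetric] c_def[symmetric] Q_def[symmetric] cross_simps sk algebra_simps)
    also have "- (s * Q) = \<epsilon> * c - (A p + cfun \<epsilon> (x p)) * s" using kc by (simp add: A algebra_simps)
    also have "c * (A p + kfun \<epsilon> (x p)) - s * (1 - \<epsilon>) = \<epsilon> * s + (A p + cfun \<epsilon> (x p)) * c" using kc by (simp add: algebra_simps)
    finally show ?thesis
      by (rule has_curl_eq) (simp add: w1_def w2_def s_def c_def cross_simps algebra_simps)
  qed
qed

lemma triple: "(w1 p \<times> w2 p) \<bullet> w3 p \<noteq> 0"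
proof -
  have "(c *\<^sub>R u + s *\<^sub>R v) \<times> (- s *\<^sub>R u + c *\<^sub>R v) = (s\<^sup>2 + c\<^sup>2) *\<^sub>R (u \<times> v)" for s c and u v :: "real^3"
    by (simp add: cross3_def vec_eq_iff forall_3 algebra_simps power2_eq_square)
  then have "w1 p \<times> w2 p = n1 p \<times> n2 p" by (simp add: w1_def w2_def)
  moreover have "X \<bullet> (Y \<times> Z) = \<delta>" "X \<bullet> (Z \<times> Y) = - \<delta>" "X \<bullet> (X \<times> v) = 0" "X \<bullet> (v \<times> X) = 0" for v
    using del by (auto simp: X_def Y_def Z_def cross3_def inner_vec_def sum_3 axis_def)
  ultimately have "(w1 p \<times> w2 p) \<bullet> w3 p = - \<delta> / (y p)^4"
    unfolding n1_def n2_def w3_def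
    by (simp add: cross_simps inner_commute[of _ X] inner_add_right inner_diff_right power2_eq_square power4_eq_xxxx)
  then show ?thesis using del nz(1)[OF p] by auto
qed

end

section \<open>The model as a manifold with one chart\<close>

abbreviation c0 :: "(real^3) chart" where "c0 \<equiv> (model_dom, \<lambda>v. v)"

lemma chart_inv_model: "p \<in> model_dom \<Longrightarrow> chart_inv c0 p = p"
  by (simp add: chart_inv_def inv_into_f_eq)

lemma GDERIV_model: "GDERIV h p :> D \<Longrightarrow> p \<in> model_dom \<Longrightarrow> GDERIV (h \<circ> chart_inv c0) p :> D"
  by (rule GDERIV_transform[OF _ open_model_dom]) (auto simp: chart_inv_model)

lemma differential_model: "GDERIV h p :> D \<Longrightarrow> p \<in> model_dom \<Longrightarrow> differential h c0 p = D"
  using GDERIV_grad[OF GDERIV_model] by (simp add: differential_grad)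

lemma class_on_model:
  assumes "Ck_on 2 model_dom h" "\<And>p. p \<in> model_dom \<Longrightarrow> h' p = h p"
  shows "class_on 2 (chart_image c0) (h' \<circ> chart_inv c0)"
proof -
  have "Ck_on k model_dom (h' \<circ> chart_inv c0)" if "k \<le> 2" for k
    using Ck_on_cong[OF open_model_dom, of "h' \<circ> chart_inv c0" h k] Ck_on_mono[OF assms(1) that] assms(2)
    by (simp add: chart_inv_model)
  then show ?thesis by (auto simp: class_on_def numeral_eq_enat)
qed

lemma is_form1_model:
  assumes "Ck_on 2 model_dom w" "\<And>p. p \<in> model_dom \<Longrightarrow> \<omega> c0 p = w p"
  shows "is_form1 model_atlas 2 \<omega>"
proof -
  have "partial c0 (\<lambda>q. q $ j) p i = axis j 1 $ i" if "p \<in> model_dom" for p i j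
  proof -
    have "GDERIV (\<lambda>q::real^3. q $ j) p :> axis j 1"
      unfolding gderiv_def cart_eq_inner_axis
      by (rule bounded_linear_imp_has_derivative[OF bounded_linear_inner_left])
    from GDERIV_pd[OF GDERIV_model[OF this that]] show ?thesis by (simp add: partial_def)
  qed
  then show ?thesis
    using class_on_model[OF assms] by (auto simp: is_form1_def model_atlas_def sum_3 axis_def forall_3)
qed

lemma smooth_atlas_model: "smooth_atlas model_atlas"
proof -
  have "homeomorphism model_dom model_dom (\<lambda>v. v) (chart_inv c0)"
    by (intro homeomorphismI) (auto simp: chart_inv_model cong: continuous_on_cong)
  moreover have "Ck_on k model_dom (chart_inv c0)" for k
    using Ck_on_cong[OF open_model_dom, of "chart_inv c0" "\<lambda>v. v"] chart_inv_model
      Ck_on_linear[OF bounded_linear_ident open_model_dom] by blast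
  ultimately show ?thesis
    using open_model_dom
    by (simp add: smooth_atlas_def compatible_chart_def is_chart_def smooth_transition_def class_on_infinity
        model_atlas_def comp_def)
qed

lemma ext_deriv_model:
  assumes "has_curl w K p" "p \<in> model_dom" "\<And>p. p \<in> model_dom \<Longrightarrow> \<omega> c0 p = w p"
  shows "ext_deriv \<omega> c0 p = skew K"
proof (rule ext_deriv_skew)
  show "has_curl (\<omega> c0 \<circ> chart_inv c0) K (chart_map c0 p)"
    using has_curl_transform[OF assms(1) open_model_dom assms(2), of "\<omega> c0 \<circ> chart_inv c0"] assms(3)
    by (simp add: chart_inv_model)
qed

text \<open>The vector e3 annihilates n2, a combination of w1 and w2, so the coefficient of w3 is
  the derivative along e3.\<close>

lemma is_e3_deriv_model:
  assumes "\<And>p. p \<in> model_dom \<Longrightarrow> \<omega>1 c0 p = w1 p" "\<And>p. p \<in> model_dom \<Longrightarrow> \<omega>2 c0 p = w2 p"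
    "\<And>p. p \<in> model_dom \<Longrightarrow> \<omega>3 c0 p = w3 p"
    and h: "\<And>p. p \<in> model_dom \<Longrightarrow> GDERIV h p :> l p *\<^sub>R n2 p + h3 p *\<^sub>R w3 p"
  shows "is_e3_deriv model_atlas \<omega>1 \<omega>2 \<omega>3 h h3"
proof -
  have "h3 p = differential h c0 p \<bullet> dual_e3 \<omega>1 \<omega>2 \<omega>3 c0 p" if p: "p \<in> model_dom" for p
  proof -
    have "n2 p \<bullet> (w1 p \<times> w2 p) = 0" by (simp add: n2_eq inner_add_left dot_cross_self)
    then show ?thesis
      using differential_model[OF h[OF p] p] dual_e3_eq[of \<omega>1 c0 p \<omega>2 \<omega>3] triple[OF p] assms(1-3) p
      by (simp add: inner_add_left inner_commute[of "w3 p"])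
  qed
  then show ?thesis by (simp add: is_e3_deriv_def model_atlas_def)
qed

lemma exists_model_coframing:
  "\<exists>\<omega>1 \<omega>2 \<omega>3 A3 C C3.
     has_normal_form_on model_atlas model_dom \<epsilon> f g x y z \<omega>1 \<omega>2 \<omega>3 \<and>
     adapted_coframing model_atlas 2 \<epsilon> \<delta> \<omega>1 \<omega>2 \<omega>3 (\<lambda>_. 0) (\<lambda>_. 0) A3 (\<lambda>v. v $ 1) C C3 \<and>
     is_e3_deriv model_atlas \<omega>1 \<omega>2 \<omega>3 (\<lambda>v. v $ 1) (\<lambda>v. v $ 2) \<and>
     is_e3_deriv model_atlas \<omega>1 \<omega>2 \<omega>3 (\<lambda>v. v $ 2) (\<lambda>v. v $ 3)"
proof -
  define o1 :: "(real^3) form1" where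
    "o1 = (\<lambda>c p. cos (x p) *\<^sub>R eta1 \<epsilon> f g x y z c p + sin (x p) *\<^sub>R eta2 x y z c p)"
  define o2 :: "(real^3) form1" where
    "o2 = (\<lambda>c p. - sin (x p) *\<^sub>R eta1 \<epsilon> f g x y z c p + cos (x p) *\<^sub>R eta2 x y z c p)"
  define o3 :: "(real^3) form1" where "o3 = (\<lambda>c p. (1 / y p) *\<^sub>R differential x c p)"
  define C where "C p = cfun \<epsilon> (x p)" for p
  \<comment> \<open>From dC = C'(x) dx and dx = y \<omega>^3.\<close>
  define C3 where "C3 p = cder \<epsilon> (x p) * y p" for p
  have nf: "has_normal_form_on model_atlas model_dom \<epsilon> f g x y z o1 o2 o3"
    by (simp add: has_normal_form_on_def o1_def o2_def o3_def)
  have d: "differential x c0 p = X" "differential y c0 p = Y" "differential z c0 p = Z" if "p \<in> model_dom" for p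
    using differential_model[OF _ that] GDERIV_xyz by blast+
  have o: "o1 c0 p = w1 p" "o2 c0 p = w2 p" "o3 c0 p = w3 p" if p: "p \<in> model_dom" for p
    using d[OF p] n_eq[OF p] b_eq[OF p]
    by (simp_all add: o1_def o2_def o3_def w1_def w2_def w3_def eta1_def eta2_def n1_def n2_def)
  have kc: "Ck_on k model_dom (\<lambda>p. cfun \<epsilon> (x p))" "Ck_on k model_dom (\<lambda>p. cder \<epsilon> (x p))" for k
    using Ck_on_kfun_cfun[OF open_model_dom Ck_on_xyz(1) nz(2,3)] by blast+
  have C: "GDERIV C p :> C3 p *\<^sub>R w3 p" "GDERIV C p :> cder \<epsilon> (x p) *\<^sub>R X" if p: "p \<in> model_dom" for p
  proof -
    show "GDERIV C p :> cder \<epsilon> (x p) *\<^sub>R X"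
      unfolding C_def[abs_def] by (rule GDERIV_DERIV_compose[OF GDERIV_xyz(1) DERIV_cfun[OF nz(2,3)[OF p]]])
    then show "GDERIV C p :> C3 p *\<^sub>R w3 p" using nz(1)[OF p] by (simp add: C3_def w3_def)
  qed
  have form: "is_form1 model_atlas 2 o1" "is_form1 model_atlas 2 o2" "is_form1 model_atlas 2 o3"
    using is_form1_model[OF Ck_on_forms(1)] is_form1_model[OF Ck_on_forms(2)] is_form1_model[OF Ck_on_forms(3)] o by blast+
  have cofr: "is_coframing model_atlas 2 o1 o2 o3"
    using form triple o by (simp add: is_coframing_def model_atlas_def det_triple)
  have cl: "fun_class model_atlas 2 h" if "Ck_on 2 model_dom h" for h
    using class_on_model[OF that refl] by (simp add: fun_class_def model_atlas_def)
  have comp: "Ck_on k model_dom (\<lambda>v. v $ i)" for k i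
    by (intro open_model_dom Ck_on_linear bounded_linear_vec_nth)
  have funs: "fun_class model_atlas 2 (\<lambda>_. 0)" "fun_class model_atlas 2 A" "fun_class model_atlas 2 (\<lambda>v. v $ 1)"
    "fun_class model_atlas 2 C" "fun_class model_atlas 2 C3"
    unfolding C_def[abs_def] C3_def[abs_def]
    by (intro cl Ck_on_const Ck_on_forms comp kc Ck_on_mult Ck_on_xyz open_model_dom)+
  have trig: "\<delta> * sin (p $ 1) = sin (x p)" "cos (p $ 1) = cos (x p)" for p
    using del by (auto simp: x_def)
  have "structure_equations model_atlas \<epsilon> \<delta> o1 o2 o3 (\<lambda>_. 0) (\<lambda>_. 0) A (\<lambda>v. v $ 1) C C3"
    unfolding structure_equations_def model_atlas_def
  proof (simp only: ball_simps fst_conv, intro ballI conjI)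
    fix p assume "p \<in> model_dom"
    note p = this and op = o[OF this]
    show "ext_deriv o1 c0 p = 0 *\<^sub>R wedge o1 o2 c0 p + (A p - C p) *\<^sub>R wedge o1 o3 c0 p + wedge o2 o3 c0 p"
      using ext_deriv_model[of w1 _ p o1, OF has_curl_w12(1)[OF p] p o(1)]
      by (simp add: wedge_skew op skew_add skew_scaleR cross_simps C_def)
    show "ext_deriv o2 c0 p = - 0 *\<^sub>R wedge o1 o2 c0 p + \<epsilon> *\<^sub>R wedge o1 o3 c0 p + (A p + C p) *\<^sub>R wedge o2 o3 c0 p"
      using ext_deriv_model[of w2 _ p o2, OF has_curl_w12(2)[OF p] p o(2)]
      by (simp add: wedge_skew op skew_add skew_scaleR cross_simps C_def)
    show "ext_deriv o3 c0 p = (\<delta> * sin (p $ 1)) *\<^sub>R wedge o1 o3 c0 p + cos (p $ 1) *\<^sub>R wedge o2 o3 c0 p"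
      using ext_deriv_model[of w3 _ p o3, OF has_curl_w3[OF p] p o(3)]
      by (simp add: wedge_skew op trig n2_eq skew_add skew_scaleR cross_simps)
    show "differential C c0 p = C3 p *\<^sub>R o3 c0 p"
      using differential_model[OF C(1)[OF p] p] op by simp
  qed simp
  moreover have "C3 p \<noteq> 0" if p: "p \<in> model_dom" for p
    using cder_nonzero[OF eps nz(2,3,4)[OF p]] nz(1)[OF p] by (simp add: C3_def)
  \<comment> \<open>As C3 is C'(x) y, the product dC \<and> dC3 equals C'(x)^2 dx \<and> dy; the
    part of dC3 along dx is lost in the product.\<close>
  moreover have "wedge (differential C) (differential C3) c0 p \<noteq> 0" if p: "p \<in> model_dom" for p
  proof -
    obtain d where d: "(cder \<epsilon> has_real_derivative d) (at (x p))"
      using kder_differentiable(2)[OF nz(2,3)[OF p]] by blast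
    have "GDERIV C3 p :> cder \<epsilon> (x p) *\<^sub>R Y + y p *\<^sub>R (d *\<^sub>R X)"
      unfolding C3_def[abs_def] by (rule GDERIV_mult[OF GDERIV_DERIV_compose[OF GDERIV_xyz(1) d] GDERIV_xyz(2)])
    then have "wedge (differential C) (differential C3) c0 p = skew ((cder \<epsilon> (x p))^2 *\<^sub>R (X \<times> Y))"
      using differential_model[OF C(2)[OF p] p] differential_model[OF _ p]
      by (simp add: wedge_skew cross_simps power2_eq_square)
    moreover have "X \<times> Y \<noteq> 0"
      using del by (auto simp: X_def Y_def cross_simps cross_basis axis_eq_0_iff)
    moreover have "skew 0 = 0" by (simp add: skew_def vec_eq_iff forall_3)
    ultimately show ?thesis
      using cder_nonzero[OF eps nz(2,3,4)[OF p]] skew_eq_iff[of _ 0] by simp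
  qed
  ultimately have ac: "adapted_coframing model_atlas 2 \<epsilon> \<delta> o1 o2 o3 (\<lambda>_. 0) (\<lambda>_. 0) A (\<lambda>v. v $ 1) C C3"
    using smooth_atlas_model cofr funs
    by (simp add: adapted_coframing_def manifold_points_def) (simp add: model_atlas_def)
  have lin: "GDERIV (\<lambda>v::real^3. v $ i) p :> axis i 1" for i p
    unfolding gderiv_def cart_eq_inner_axis
    by (rule bounded_linear_imp_has_derivative[OF bounded_linear_inner_left])
  have d2: "\<delta> * \<delta> = 1" using del by auto
  have "is_e3_deriv model_atlas o1 o2 o3 (\<lambda>v. v $ 1) (\<lambda>v. v $ 2)"
  proof (rule is_e3_deriv_model)
    show "o1 c0 p = w1 p" "o2 c0 p = w2 p" "o3 c0 p = w3 p" if "p \<in> model_dom" for p using o[OF that] .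
    show "GDERIV (\<lambda>v::real^3. v $ 1) p :> 0 *\<^sub>R n2 p + p $ 2 *\<^sub>R w3 p" if "p \<in> model_dom" for p
      by (rule GDERIV_subst[OF lin]) (use nz(1)[OF that] d2 in \<open>simp add: w3_def X_def y_def\<close>)
  qed
  moreover have "is_e3_deriv model_atlas o1 o2 o3 (\<lambda>v. v $ 2) (\<lambda>v. v $ 3)"
  proof (rule is_e3_deriv_model)
    show "o1 c0 p = w1 p" "o2 c0 p = w2 p" "o3 c0 p = w3 p" if "p \<in> model_dom" for p using o[OF that] .
    \<comment> \<open>Here d\<zeta>3 = \<delta> dy, and dy = -y \<eta>^2 + (z/y) dx is the
      definition of \<open>n2\<close> solved for dy.\<close>
    show "GDERIV (\<lambda>v::real^3. v $ 2) p :> (- (\<delta> * y p)) *\<^sub>R n2 p + p $ 3 *\<^sub>R w3 p" if "p \<in> model_dom" for p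
    proof (rule GDERIV_subst[OF lin])
      have "(- (\<delta> * y p)) *\<^sub>R n2 p = \<delta> *\<^sub>R Y - (\<delta> * z p / y p) *\<^sub>R X"
        unfolding n2_def using nz(1)[OF that] by (simp add: algebra_simps power2_eq_square)
      moreover have "\<delta> *\<^sub>R Y = axis 2 1" "\<delta> * z p = p $ 3"
        using d2 by (simp_all add: Y_def z_def mult.assoc[symmetric])
      ultimately show "axis 2 1 = (- (\<delta> * y p)) *\<^sub>R n2 p + p $ 3 *\<^sub>R w3 p"
        by (simp add: w3_def)
    qed
  qed
  ultimately show ?thesis using nf ac by blast
qed

end

text \<open>The second conjunct is the precise meaning of "arbitrary functions": every admissible
  pair is realised, by a coframing whose invariants \<zeta>, \<zeta>3, \<zeta>33 are the coordinates
  themselves. Its class is 2 because f and g are given with finite class.\<close>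

theorem theorem4:
  fixes \<epsilon> \<delta> :: real
  assumes "\<epsilon> \<in> {1, -1}" and "\<delta> \<in> {1, -1}"
  shows
    "(\<forall>(A :: 'm::{t2_space, second_countable_topology} chart set) \<omega>1 \<omega>2 \<omega>3 A1 A2 A3 \<zeta> C C3 \<zeta>3 \<zeta>33 U.
        adapted_coframing A \<infinity> \<epsilon> \<delta> \<omega>1 \<omega>2 \<omega>3 A1 A2 A3 \<zeta> C C3 \<longrightarrow>
        is_e3_deriv A \<omega>1 \<omega>2 \<omega>3 \<zeta> \<zeta>3 \<longrightarrow> is_e3_deriv A \<omega>1 \<omega>2 \<omega>3 \<zeta>3 \<zeta>33 \<longrightarrow>
        open U \<longrightarrow> U \<subseteq> manifold_points A \<longrightarrow> (\<forall>p\<in>U. A1 p = 0 \<and> A2 p = 0) \<longrightarrow>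
        (\<forall>p\<in>U. 0 < \<zeta> p \<and> \<zeta> p < pi / 4 \<longrightarrow>
          (\<exists>V f g. open V \<and> p \<in> V \<and> V \<subseteq> U \<and>
             compatible_chart A (V, \<lambda>q. vector [\<zeta> q, \<zeta>3 q, \<zeta>33 q]) \<and>
             (\<forall>q\<in>V. 0 < \<zeta> q \<and> \<zeta> q < pi / 4 \<and> \<zeta>3 q \<noteq> 0) \<and>
             Ck_on 3 (UNIV :: real set) f \<and> Ck_on 2 (UNIV :: real set) g \<and>
             has_normal_form_on A V \<epsilon> f g
               (\<lambda>q. \<delta> * \<zeta> q) (\<lambda>q. \<delta> * \<zeta>3 q) (\<lambda>q. \<delta> * \<zeta>33 q) \<omega>1 \<omega>2 \<omega>3)))
     \<and>
     (\<forall>f g. Ck_on 3 (UNIV :: real set) f \<longrightarrow> Ck_on 2 (UNIV :: real set) g \<longrightarrow>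
        (\<exists>\<omega>1 \<omega>2 \<omega>3 A3 C C3.
           has_normal_form_on model_atlas model_dom \<epsilon> f g
             (\<lambda>v. \<delta> * v $ 1) (\<lambda>v. \<delta> * v $ 2) (\<lambda>v. \<delta> * v $ 3) \<omega>1 \<omega>2 \<omega>3 \<and>
           adapted_coframing model_atlas 2 \<epsilon> \<delta> \<omega>1 \<omega>2 \<omega>3 (\<lambda>_. 0) (\<lambda>_. 0) A3 (\<lambda>v. v $ 1) C C3 \<and>
           is_e3_deriv model_atlas \<omega>1 \<omega>2 \<omega>3 (\<lambda>v. v $ 1) (\<lambda>v. v $ 2) \<and>
           is_e3_deriv model_atlas \<omega>1 \<omega>2 \<omega>3 (\<lambda>v. v $ 2) (\<lambda>v. v $ 3)))"
  (is "?forward \<and> ?converse")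
proof
  show ?forward
  proof (intro allI impI ballI, elim conjE)
    fix A :: "'m chart set" and \<omega>1 \<omega>2 \<omega>3 A1 A2 A3 \<zeta> C C3 \<zeta>3 \<zeta>33 U p
    assume *: "adapted_coframing A \<infinity> \<epsilon> \<delta> \<omega>1 \<omega>2 \<omega>3 A1 A2 A3 \<zeta> C C3"
      "is_e3_deriv A \<omega>1 \<omega>2 \<omega>3 \<zeta> \<zeta>3" "is_e3_deriv A \<omega>1 \<omega>2 \<omega>3 \<zeta>3 \<zeta>33"
      "open U" "U \<subseteq> manifold_points A" "\<forall>p\<in>U. A1 p = 0 \<and> A2 p = 0" "p \<in> U" "0 < \<zeta> p" "\<zeta> p < pi / 4"
    interpret manifold_atlas A using *(1) by unfold_locales (simp add: adapted_coframing_def)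
    show "\<exists>V f g. open V \<and> p \<in> V \<and> V \<subseteq> U \<and>
             compatible_chart A (V, \<lambda>q. vector [\<zeta> q, \<zeta>3 q, \<zeta>33 q]) \<and>
             (\<forall>q\<in>V. 0 < \<zeta> q \<and> \<zeta> q < pi / 4 \<and> \<zeta>3 q \<noteq> 0) \<and>
             Ck_on 3 (UNIV :: real set) f \<and> Ck_on 2 (UNIV :: real set) g \<and>
             has_normal_form_on A V \<epsilon> f g
               (\<lambda>q. \<delta> * \<zeta> q) (\<lambda>q. \<delta> * \<zeta>3 q) (\<lambda>q. \<delta> * \<zeta>33 q) \<omega>1 \<omega>2 \<omega>3"
      by (rule exists_normal_form[OF assms *(1-5) _ *(7-9)]) (rule *(6)[rule_format])
  qed
  show ?converse
  proof (intro allI impI)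
    fix f g :: "real \<Rightarrow> real"
    assume fg: "Ck_on 3 UNIV f" "Ck_on 2 UNIV g"
    interpret model_coframing \<epsilon> \<delta> f g using assms fg by unfold_locales auto
    show "\<exists>\<omega>1 \<omega>2 \<omega>3 A3 C C3.
           has_normal_form_on model_atlas model_dom \<epsilon> f g
             (\<lambda>v. \<delta> * v $ 1) (\<lambda>v. \<delta> * v $ 2) (\<lambda>v. \<delta> * v $ 3) \<omega>1 \<omega>2 \<omega>3 \<and>
           adapted_coframing model_atlas 2 \<epsilon> \<delta> \<omega>1 \<omega>2 \<omega>3 (\<lambda>_. 0) (\<lambda>_. 0) A3 (\<lambda>v. v $ 1) C C3 \<and>
           is_e3_deriv model_atlas \<omega>1 \<omega>2 \<omega>3 (\<lambda>v. v $ 1) (\<lambda>v. v $ 2) \<and>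
           is_e3_deriv model_atlas \<omega>1 \<omega>2 \<omega>3 (\<lambda>v. v $ 2) (\<lambda>v. v $ 3)"
      using exists_model_coframing unfolding x_def[abs_def] y_def[abs_def] z_def[abs_def] .
  qed
qed

end
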